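(* Let $\mathbb{T}^2=\mathbb{R}^2/\mathbb{Z}^2$ be the square flat torus. The maximum, over all sets of $6$ points of $\mathbb{T}^2$, of the minimal pairwise distance between the points equals $$d=\frac{\sqrt{3}}{2}-\frac{\sqrt{2}\,\sqrt{3\sqrt{3}+2}}{6}+\frac16\approx 0.40040554 .$$ Moreover the optimal arrangement is unique up to isometry of $\mathbb{T}^2$: with $R=\sqrt2\,\sqrt{3\sqrt3+2}$, a set of $6$ points has minimal pairwise distance equal to $d$ if and only if it is the image under an isometry of $\mathbb{T}^2$ of the set of the six points (taken modulo $\mathbb{Z}^2$) $$(0,0),\quad \Big(\tfrac d2,\tfrac{\sqrt3}{2}d\Big),\quad \Big(1-\tfrac d2,\tfrac{\sqrt3}{2}d\Big),\quad \Big(\tfrac12,\;1+\tfrac{\sqrt3}{3}-\tfrac{\sqrt3}{12}R-\tfrac14R\Big),$$ $$\Big(\tfrac{1-d}{2},\;\tfrac54+\tfrac{\sqrt3}{4}-\tfrac14R\Big),\quad \Big(\tfrac{1+d}{2},\;\tfrac54+\tfrac{\sqrt3}{4}-\tfrac14R\Big).$$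
   Context: $\mathbb{T}^2=\mathbb{R}^2/\mathbb{Z}^2$ carries the flat metric induced from $\mathbb{R}^2$: $\mathrm{dist}(p,q)=\min_{z\in\mathbb{Z}^2}|\tilde p-\tilde q+z|$ for lifts $\tilde p,\tilde q\in\mathbb{R}^2$. The minimal pairwise distance of a finite set $X\subset\mathbb{T}^2$ is $\min_{u\ne v\in X}\mathrm{dist}(u,v)$. *)

theory Defs
  imports "HOL-Analysis.Analysis"
begin

section \<open>The square flat torus\<close>

abbreviation int_lattice :: "(real \<times> real) set" where
  "int_lattice \<equiv> \<int> \<times> \<int>"

definition lattice_equiv :: "real \<times> real \<Rightarrow> real \<times> real \<Rightarrow> bool" where
  "lattice_equiv p q \<longleftrightarrow> p - q \<in> int_lattice"

lemma int_lattice_closed: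
  "0 \<in> int_lattice"
  "z \<in> int_lattice \<Longrightarrow> w \<in> int_lattice \<Longrightarrow> z + w \<in> int_lattice"
  "z \<in> int_lattice \<Longrightarrow> - z \<in> int_lattice"
  "z \<in> int_lattice \<Longrightarrow> w \<in> int_lattice \<Longrightarrow> z - w \<in> int_lattice"
  by (auto simp: zero_prod_def)

text \<open>The map \<open>proj_torus\<close> is the canonical projection from the plane onto the torus.\<close>

quotient_type torus = "real \<times> real" / lattice_equiv
  morphisms rep_torus proj_torus
proof (rule equivpI)
  show "reflp lattice_equiv"
    using int_lattice_closed(1) by (simp add: reflp_def lattice_equiv_def)
  show "symp lattice_equiv"
  proof (rule sympI)
    fix p q assume "lattice_equiv p q"
    then have "- (p - q) \<in> int_lattice"
      unfolding lattice_equiv_def by (rule int_lattice_closed(3))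
    then show "lattice_equiv q p" by (simp add: lattice_equiv_def)
  qed
  show "transp lattice_equiv"
  proof (rule transpI)
    fix p q r assume "lattice_equiv p q" "lattice_equiv q r"
    then have "(p - q) + (q - r) \<in> int_lattice"
      unfolding lattice_equiv_def by (rule int_lattice_closed(2))
    then show "lattice_equiv p r" by (simp add: lattice_equiv_def)
  qed
qed

definition lattice_dist :: "real \<times> real \<Rightarrow> real \<times> real \<Rightarrow> real" where
  "lattice_dist p q = (INF z\<in>int_lattice. norm (p - q + z))"

lemma lattice_dist_le:
  assumes "z \<in> int_lattice"
  shows "lattice_dist p q \<le> norm (p - q + z)"
  unfolding lattice_dist_def
  by (rule cINF_lower[OF _ assms]) (auto intro!: bdd_belowI[of _ 0])

text \<open>The infimum is a minimum.\<close>

lemma lattice_dist_attained: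
  obtains z where "z \<in> int_lattice" "lattice_dist p q = norm (p - q + z)"
proof -
  define z :: "real \<times> real" where
    "z = (- of_int (round (fst (p - q))), - of_int (round (snd (p - q))))"
  have z: "z \<in> int_lattice" by (simp add: z_def)
  have "norm (p - q + z) \<le> norm (p - q + w)" if "w \<in> int_lattice" for w
  proof -
    from that obtain m n :: int where w: "w = (of_int m, of_int n)"
      by (auto elim!: Ints_cases)
    have "\<bar>fst (p - q) + fst z\<bar> \<le> \<bar>fst (p - q) + fst w\<bar>"
      using round_diff_minimal[of "fst (p - q)" "- m"] by (simp add: z_def w)
    moreover have "\<bar>snd (p - q) + snd z\<bar> \<le> \<bar>snd (p - q) + snd w\<bar>"
      using round_diff_minimal[of "snd (p - q)" "- n"] by (simp add: z_def w)
    ultimately have "(fst (p - q) + fst z)\<^sup>2 + (snd (p - q) + snd z)\<^sup>2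
        \<le> (fst (p - q) + fst w)\<^sup>2 + (snd (p - q) + snd w)\<^sup>2"
      by (intro add_mono) (simp_all only: abs_le_square_iff)
    then show ?thesis by (simp add: norm_prod_def)
  qed
  then have "norm (p - q + z) \<le> lattice_dist p q"
    unfolding lattice_dist_def using z by (intro cINF_greatest) auto
  with lattice_dist_le[OF z, of p q] have "lattice_dist p q = norm (p - q + z)" by simp
  with z that show ?thesis by blast
qed

lemma lattice_dist_cong_le:
  assumes "lattice_equiv p p'" "lattice_equiv q q'"
  shows "lattice_dist p q \<le> lattice_dist p' q'"
proof -
  obtain z where z: "z \<in> int_lattice" "lattice_dist p' q' = norm (p' - q' + z)"
    by (rule lattice_dist_attained)
  from assms have "p - p' \<in> int_lattice" "q - q' \<in> int_lattice"
    by (simp_all only: lattice_equiv_def)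
  from int_lattice_closed(2)[OF int_lattice_closed(4)[OF z(1) this(1)] this(2)]
  have "z - (p - p') + (q - q') \<in> int_lattice" .
  from lattice_dist_le[OF this, of p q] show ?thesis
    by (simp add: z(2) algebra_simps)
qed

lemma lattice_dist_eq_0_iff: "lattice_dist p q = 0 \<longleftrightarrow> lattice_equiv p q"
proof
  assume "lattice_dist p q = 0"
  moreover obtain z where z: "z \<in> int_lattice" "lattice_dist p q = norm (p - q + z)"
    by (rule lattice_dist_attained)
  ultimately have "p - q = - z" by (simp add: eq_neg_iff_add_eq_0)
  then show "lattice_equiv p q"
    using int_lattice_closed(3)[OF z(1)] by (simp add: lattice_equiv_def)
next
  assume "lattice_equiv p q"
  then have "- (p - q) \<in> int_lattice"
    unfolding lattice_equiv_def by (rule int_lattice_closed(3))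
  from lattice_dist_le[OF this, of p q] have "lattice_dist p q \<le> 0" by simp
  moreover obtain z where "lattice_dist p q = norm (p - q + z)"
    by (rule lattice_dist_attained)
  ultimately show "lattice_dist p q = 0" by simp
qed

lemma lattice_dist_triangle2:
  "lattice_dist p q \<le> lattice_dist p r + lattice_dist q r"
proof -
  obtain z where z: "z \<in> int_lattice" "lattice_dist p r = norm (p - r + z)"
    by (rule lattice_dist_attained)
  obtain w where w: "w \<in> int_lattice" "lattice_dist q r = norm (q - r + w)"
    by (rule lattice_dist_attained)
  have "lattice_dist p q \<le> norm (p - q + (z - w))"
    using int_lattice_closed(4)[OF z(1) w(1)] by (rule lattice_dist_le)
  also have "p - q + (z - w) = (p - r + z) - (q - r + w)" by simp
  also have "norm \<dots> \<le> norm (p - r + z) + norm (q - r + w)" by (rule norm_triangle_ineq4)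
  finally show ?thesis by (simp add: z w)
qed

instantiation torus :: metric_space
begin

lift_definition dist_torus :: "torus \<Rightarrow> torus \<Rightarrow> real" is lattice_dist
proof -
  fix p p' q q' assume *: "lattice_equiv p p'" "lattice_equiv q q'"
  then have "lattice_equiv p' p" "lattice_equiv q' q"
    using torus_equivp by (auto dest: equivp_symp)
  with * show "lattice_dist p q = lattice_dist p' q'"
    by (intro antisym lattice_dist_cong_le)
qed

definition uniformity_torus :: "(torus \<times> torus) filter" where
  "uniformity_torus = (INF e\<in>{0<..}. principal {(x, y). dist x y < e})"

definition open_torus :: "torus set \<Rightarrow> bool" where
  "open_torus U \<longleftrightarrow> (\<forall>x\<in>U. eventually (\<lambda>(x', y). x' = x \<longrightarrow> y \<in> U) uniformity)"

instance
proof
  show "dist x y = 0 \<longleftrightarrow> x = y" for x y :: torus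
    by transfer (rule lattice_dist_eq_0_iff)
  show "dist x y \<le> dist x z + dist y z" for x y z :: torus
    by transfer (rule lattice_dist_triangle2)
qed (simp_all only: uniformity_torus_def open_torus_def)

end

section \<open>Minimal distance and isometries\<close>

text \<open>Only meaningful for finite \<open>X\<close> with at least two elements.\<close>

definition min_dist :: "'a::metric_space set \<Rightarrow> real" where
  "min_dist X = Min {dist u v | u v. u \<in> X \<and> v \<in> X \<and> u \<noteq> v}"

definition isometry :: "('a::metric_space \<Rightarrow> 'b::metric_space) \<Rightarrow> bool" where
  "isometry f \<longleftrightarrow> bij f \<and> (\<forall>x y. dist (f x) (f y) = dist x y)"

end

theory Submission
  imports Defs
begin

text \<open>Lift the six points to the plane and sort their coordinates, so that a configuration is given
  by two cyclically sorted sequences and the permutation relating them. Up to the symmetries of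
  the torus there are ten such permutations. For two points, each of the four vectors with
  nonnegative coordinates joining their lifts has length at least \<open>d\<close>. Once its direction is known
  to lie in the sector between two vectors \<open>e\<close>, \<open>e'\<close> of length at most \<open>d\<close>, the vector lies beyond
  the chord from \<open>e\<close> to \<open>e'\<close>, which is a linear condition. A finite tree of sector bisections whose
  leaves are refuted by nonnegative linear combinations excludes every configuration outside
  small boxes around the copies of the optimal one. Inside such a box the twelve contact conditions,
  which carry positive stresses, contract the deviation from the optimal configuration to zero.\<close>

section \<open>The flat torus\<close>

text \<open>Two obstacles shape the argument. On the torus a difference of points is defined only up
  to lattice vectors, and the outside of a disc is not convex. Fixing the cyclic order on both axes
  turns the vectors joining two points into fixed linear forms; cutting quadrants into sectors
  replaces the circular arc by chords. The chords, and a threshold slightly below the true squared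
  distance, lose a little everywhere, so no finite tree isolates the optimal configuration: a
  neighbourhood of it always survives, and a local argument has to cover a box of fixed size. The
  optimal configuration has two pairs of points of equal height and thus lies on the common boundary
  of several orders; all order relations are therefore weak. Maximality and uniqueness are one
  statement: six points at mutual distances at least \<open>opt_dist\<close> form an isometric copy
  of the optimal set, whose minimal distance is exactly \<open>opt_dist\<close>.\<close>

lemma dist_proj: "dist (proj_torus p) (proj_torus q) = lattice_dist p q"
  by (rule dist_torus.abs_eq)

lemma proj_torus_eq_iff: "proj_torus p = proj_torus q \<longleftrightarrow> p - q \<in> int_lattice"
  by (simp add: torus.abs_eq_iff lattice_equiv_def)

lemma proj_rep: "proj_torus (rep_torus t) = t"
  by (rule Quotient_abs_rep[OF Quotient_torus])

definition induced :: "(real \<times> real \<Rightarrow> real \<times> real) \<Rightarrow> torus \<Rightarrow> torus" where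
  "induced F t = proj_torus (F (rep_torus t))"

text \<open>\<open>induced\<close> is defined through an arbitrary choice of representatives. The
  choice is harmless because \<open>lattice_dist\<close> vanishes exactly on equivalent lifts, so a
  map that preserves it sends equivalent lifts to equivalent lifts.\<close>

lemma induced_proj:
  assumes "\<And>p q. lattice_dist (F p) (F q) = lattice_dist p q"
  shows "induced F (proj_torus p) = proj_torus (F p)"
proof -
  have "dist (induced F (proj_torus p)) (proj_torus (F p)) = dist (proj_torus (rep_torus (proj_torus p))) (proj_torus p)"
    by (simp only: induced_def dist_proj assms)
  then show ?thesis by (simp add: proj_rep)
qed

lemma isometry_induced:
  assumes "\<And>p q. lattice_dist (F p) (F q) = lattice_dist p q" "surj F"
  shows "isometry (induced F)"
proof -
  have dist: "dist (induced F s) (induced F t) = dist s t" for s t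
  proof -
    have "dist (induced F s) (induced F t) = dist (proj_torus (rep_torus s)) (proj_torus (rep_torus t))"
      by (simp only: induced_def dist_proj assms)
    then show ?thesis by (simp add: proj_rep)
  qed
  have "inj (induced F)" by (rule injI) (metis dist dist_eq_0_iff)
  moreover have "surj (induced F)"
  proof (rule surjI)
    fix t
    show "induced F (proj_torus (inv F (rep_torus t))) = t"
      by (simp add: induced_proj assms(1) surj_f_inv_f[OF assms(2)] proj_rep)
  qed
  ultimately show ?thesis using dist by (simp add: isometry_def bij_def)
qed

lemma isometry_comp: "isometry f \<Longrightarrow> isometry g \<Longrightarrow> isometry (g \<circ> f)"
  by (auto simp: isometry_def intro: bij_comp)

text \<open>The bijection \<open>h\<close> matches the lattice translates of the two differences, so
  both infima run over the same set of norms. For the reflection and for the swap \<open>h\<close>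
  is the map \<open>F\<close> itself.\<close>

lemma lattice_dist_reindex:
  assumes "\<And>p q z. norm (F p - F q + h z) = norm (p - q + z)" "bij_betw h int_lattice int_lattice"
  shows "lattice_dist (F p) (F q) = lattice_dist p q"
proof -
  have "(\<lambda>z. norm (p - q + z)) ` int_lattice = (\<lambda>z. norm (F p - F q + z)) ` h ` int_lattice"
    by (simp add: image_image assms(1))
  then show ?thesis using bij_betw_imp_surj_on[OF assms(2)] by (simp add: lattice_dist_def)
qed

lemma lattice_dist_translate: "lattice_dist (p + v) (q + v) = lattice_dist p q"
  by (simp add: lattice_dist_def)

lemma lattice_dist_reflect: "lattice_dist (- fst p, snd p) (- fst q, snd q) = lattice_dist p q"
proof (rule lattice_dist_reindex[where F = "\<lambda>p. (- fst p, snd p)" and h = "\<lambda>z. (- fst z, snd z)"])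
  fix p q z :: "real \<times> real"
  show "norm ((- fst p, snd p) - (- fst q, snd q) + (- fst z, snd z)) = norm (p - q + z)"
    using power2_minus[of "fst p - fst q + fst z"] by (simp add: norm_prod_def algebra_simps)
  show "bij_betw (\<lambda>z. (- fst z, snd z)) int_lattice int_lattice"
    by (rule bij_betw_byWitness[where f' = "\<lambda>z. (- fst z, snd z)"]) auto
qed

lemma lattice_dist_swap: "lattice_dist (prod.swap p) (prod.swap q) = lattice_dist p q"
  by (rule lattice_dist_reindex[where F = prod.swap and h = prod.swap])
    (auto simp: norm_prod_def add.commute intro!: bij_betw_byWitness[where f' = prod.swap])

text \<open>A lower bound on a minimum is a bound on every term, so separation can be stated without
  locating the nearest translate. This is the passage from the metric of the torus to polynomial
  inequalities in the coordinates.\<close>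

lemma dist_proj_ge_iff:
  assumes "0 \<le> c"
  shows "c \<le> dist (proj_torus (x, y)) (proj_torus (x', y')) \<longleftrightarrow>
    (\<forall>m n :: int. c\<^sup>2 \<le> (x - x' + of_int m)\<^sup>2 + (y - y' + of_int n)\<^sup>2)"
proof -
  have *: "c \<le> norm ((x, y) - (x', y') + (of_int m, of_int n)) \<longleftrightarrow>
      c\<^sup>2 \<le> (x - x' + of_int m)\<^sup>2 + (y - y' + of_int n)\<^sup>2" for m n :: int
    using real_le_rsqrt real_le_lsqrt assms by (simp add: norm_prod_def) (metis abs_of_nonneg real_sqrt_abs real_sqrt_le_iff)
  show ?thesis
  proof
    assume c: "c \<le> dist (proj_torus (x, y)) (proj_torus (x', y'))"
    show "\<forall>m n :: int. c\<^sup>2 \<le> (x - x' + of_int m)\<^sup>2 + (y - y' + of_int n)\<^sup>2"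
    proof (intro allI)
      fix m n :: int
      have "dist (proj_torus (x, y)) (proj_torus (x', y')) \<le> norm ((x, y) - (x', y') + (of_int m, of_int n))"
        unfolding dist_proj by (rule lattice_dist_le) simp
      with c show "c\<^sup>2 \<le> (x - x' + of_int m)\<^sup>2 + (y - y' + of_int n)\<^sup>2" unfolding *[symmetric] by simp
    qed
  next
    assume "\<forall>m n :: int. c\<^sup>2 \<le> (x - x' + of_int m)\<^sup>2 + (y - y' + of_int n)\<^sup>2"
    moreover obtain z where z: "z \<in> int_lattice" "lattice_dist (x, y) (x', y') = norm ((x, y) - (x', y') + z)"
      by (rule lattice_dist_attained)
    moreover obtain m n :: int where "z = (of_int m, of_int n)" using z(1) by (auto elim!: Ints_cases)
    ultimately show "c \<le> dist (proj_torus (x, y)) (proj_torus (x', y'))"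
      using * by (simp add: dist_proj)
  qed
qed

section \<open>The optimal configuration\<close>

definition opt_dist :: real where
  "opt_dist = sqrt 3 / 2 - sqrt 2 * sqrt (3 * sqrt 3 + 2) / 6 + 1 / 6"

lemma sqrt3_bounds: "1.7320508 < sqrt 3" "sqrt 3 < 1.7320509"
  by (rule real_less_rsqrt real_less_lsqrt; simp add: power2_eq_square)+

lemma sqrt_product: "sqrt 2 * sqrt (3 * sqrt 3 + 2) = sqrt (6 * sqrt 3 + 4)"
  by (simp add: real_sqrt_mult[symmetric])

text \<open>Squaring \<open>3 * sqrt 3 + 1 - 6 * opt_dist = sqrt (6 * sqrt 3 + 4)\<close> removes
  the nested root. The exact contact lengths use \<open>opt_dist\<close> only as a root of this
  quadratic with coefficients in the field generated by \<open>sqrt 3\<close>.\<close>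

lemma opt_dist_quadratic: "3 * opt_dist\<^sup>2 = 3 * sqrt 3 * opt_dist + opt_dist - 2"
proof -
  define s where "s = sqrt 3"
  have s: "s * s = 3" by (simp add: s_def)
  have "3 * s + 1 - 6 * opt_dist = sqrt (6 * s + 4)"
    by (simp add: opt_dist_def sqrt_product s_def)
  then have "(3 * s + 1 - 6 * opt_dist)\<^sup>2 = 6 * s + 4"
    by (simp add: s_def)
  moreover have "(3 * s + 1 - 6 * opt_dist)\<^sup>2
      = 9 * (s * s) + 1 + 36 * opt_dist\<^sup>2 + 6 * s - 36 * (s * opt_dist) - 12 * opt_dist"
    by (simp add: power2_eq_square algebra_simps)
  ultimately have "3 * opt_dist\<^sup>2 = 3 * s * opt_dist + opt_dist - 2" using s by simp
  then show ?thesis by (simp add: s_def)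
qed

lemma opt_dist_bounds: "0.40040554 < opt_dist" "opt_dist < 0.40040555"
proof -
  have "1.73205080756 < sqrt 3" "sqrt 3 < 1.73205080758"
    by (rule real_less_rsqrt real_less_lsqrt; simp add: power2_eq_square)+
  moreover have "3.79371913 < sqrt (6 * sqrt 3 + 4)" "sqrt (6 * sqrt 3 + 4) < 3.793719136"
    using calculation by - (rule real_less_rsqrt real_less_lsqrt; simp add: power2_eq_square)+
  ultimately show "0.40040554 < opt_dist" "opt_dist < 0.40040555"
    by (simp_all add: opt_dist_def sqrt_product)
qed

definition opt_x :: "nat \<Rightarrow> real" where
  "opt_x k = [0, opt_dist / 2, 1 - opt_dist / 2, 1 / 2, (1 - opt_dist) / 2, (1 + opt_dist) / 2] ! k"

text \<open>R is eliminated through \<open>R = 3 * sqrt 3 + 1 - 6 * d\<close>, which makes every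
  coordinate linear in d, \<open>sqrt 3\<close> and their product.\<close>

definition opt_y :: "nat \<Rightarrow> real" where
  "opt_y k = [0, sqrt 3 / 2 * opt_dist, sqrt 3 / 2 * opt_dist,
     (sqrt 3 + 3) / 2 * opt_dist - sqrt 3 / 2,
     1 - sqrt 3 / 2 + 3 / 2 * opt_dist, 1 - sqrt 3 / 2 + 3 / 2 * opt_dist] ! k"

lemma opt_coords [simp]:
  "opt_x 0 = 0" "opt_x (Suc 0) = opt_dist / 2" "opt_x 2 = 1 - opt_dist / 2" "opt_x 3 = 1 / 2"
  "opt_x 4 = (1 - opt_dist) / 2" "opt_x 5 = (1 + opt_dist) / 2"
  "opt_y 0 = 0" "opt_y (Suc 0) = sqrt 3 / 2 * opt_dist" "opt_y 2 = sqrt 3 / 2 * opt_dist"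
  "opt_y 3 = (sqrt 3 + 3) / 2 * opt_dist - sqrt 3 / 2"
  "opt_y 4 = 1 - sqrt 3 / 2 + 3 / 2 * opt_dist" "opt_y 5 = 1 - sqrt 3 / 2 + 3 / 2 * opt_dist"
  by (simp_all add: opt_x_def opt_y_def)

text \<open>The product is bounded as an atom of its own; with it the numerical conditions on
  coordinates are linear in three bounded quantities.\<close>

lemma opt_product_bounds: "6934 / 10000 < sqrt 3 * opt_dist" "sqrt 3 * opt_dist < 6936 / 10000"
proof -
  have "1.7320508 * 0.40040554 < sqrt 3 * opt_dist" "sqrt 3 * opt_dist < 1.7320509 * 0.40040555"
    using sqrt3_bounds opt_dist_bounds by (intro mult_strict_mono; simp)+
  then show "6934 / 10000 < sqrt 3 * opt_dist" "sqrt 3 * opt_dist < 6936 / 10000" by simp_all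
qed

lemmas opt_bounds = opt_dist_bounds sqrt3_bounds opt_product_bounds

text \<open>\<open>(i, j, m, n)\<close> says that point i touches the copy of point j shifted by (m,
  n). Of the fifteen pairs only 03, 15 and 24 are absent; their first coordinates differ by exactly
  1/2.\<close>

definition contacts :: "(nat \<times> nat \<times> int \<times> int) list" where
  "contacts = [(0, 1, 0, 0), (0, 2, -1, 0), (0, 4, 0, -1), (0, 5, -1, -1), (1, 2, -1, 0), (1, 3, 0, 0),
     (1, 4, 0, 0), (2, 3, 0, 0), (2, 5, 0, 0), (3, 4, 0, -1), (3, 5, 0, -1), (4, 5, 0, 0)]"

lemma contact_dist:
  assumes "(i, j, m, n) \<in> set contacts"
  shows "(opt_x j - opt_x i + of_int m)\<^sup>2 + (opt_y j - opt_y i + of_int n)\<^sup>2 = opt_dist\<^sup>2"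
proof -
  define s d where "s = sqrt 3" "d = opt_dist"
  have s: "s * s = 3" by (simp add: s_d_def)
  have d: "3 * d\<^sup>2 = 3 * (s * d) + d - 2" using opt_dist_quadratic by (simp add: s_d_def)
  \<comment> \<open>The third length below contains the monomial \<open>s * d\<^sup>2\<close>, which
    the quadratic multiplied by s expresses through lower terms.\<close>
  have "3 * (s * d\<^sup>2) = 3 * (s * s) * d + s * d - 2 * s"
    using arg_cong[OF d, of "\<lambda>t. s * t"] by (simp add: algebra_simps)
  then have sd: "3 * (s * d\<^sup>2) = 9 * d + s * d - 2 * s" by (simp add: s)
  have eqs: "(d / 2)\<^sup>2 + (s / 2 * d)\<^sup>2 = d\<^sup>2"
    "((1 - d) / 2)\<^sup>2 + (3 / 2 * d - s / 2)\<^sup>2 = d\<^sup>2"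
    "(1 / 2 - d)\<^sup>2 + (1 - s / 2 + 3 / 2 * d - s / 2 * d)\<^sup>2 = d\<^sup>2"
  proof -
    have "(d / 2)\<^sup>2 + (s / 2 * d)\<^sup>2 = (1 + s * s) / 4 * d\<^sup>2"
      by (simp add: power2_eq_square field_simps)
    then show "(d / 2)\<^sup>2 + (s / 2 * d)\<^sup>2 = d\<^sup>2" by (simp add: s)
    have "((1 - d) / 2)\<^sup>2 + (3 / 2 * d - s / 2)\<^sup>2 = (1 + s * s) / 4 + 5 / 2 * d\<^sup>2 - (3 * (s * d) + d) / 2"
      by (simp add: power2_eq_square field_simps)
    then show "((1 - d) / 2)\<^sup>2 + (3 / 2 * d - s / 2)\<^sup>2 = d\<^sup>2" using s d by argo
    have "(1 / 2 - d)\<^sup>2 + (1 - s / 2 + 3 / 2 * d - s / 2 * d)\<^sup>2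
      = 5 / 4 + (s * s) / 4 - s + 2 * d - 5 / 2 * (s * d) + (s * s) * d / 2 + 13 / 4 * d\<^sup>2
        - 3 / 2 * (s * d\<^sup>2) + (s * s) * d\<^sup>2 / 4"
      by (simp add: power2_eq_square field_simps)
    with d sd show "(1 / 2 - d)\<^sup>2 + (1 - s / 2 + 3 / 2 * d - s / 2 * d)\<^sup>2 = d\<^sup>2"
      unfolding s by argo
  qed
  have sq: "A\<^sup>2 + B\<^sup>2 = d\<^sup>2" if "\<bar>A\<bar> = \<bar>a\<bar>" "\<bar>B\<bar> = \<bar>b\<bar>" "a\<^sup>2 + b\<^sup>2 = d\<^sup>2" for A B a b :: real
    using that by (metis power2_abs)
  \<comment> \<open>Up to the signs of the coordinates only four contact vectors occur.\<close>
  have "\<bar>opt_x j - opt_x i + of_int m\<bar> = \<bar>d / 2\<bar> \<and> \<bar>opt_y j - opt_y i + of_int n\<bar> = \<bar>s / 2 * d\<bar> \<or>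
    \<bar>opt_x j - opt_x i + of_int m\<bar> = \<bar>(1 - d) / 2\<bar> \<and> \<bar>opt_y j - opt_y i + of_int n\<bar> = \<bar>3 / 2 * d - s / 2\<bar> \<or>
    \<bar>opt_x j - opt_x i + of_int m\<bar> = \<bar>d\<bar> \<and> \<bar>opt_y j - opt_y i + of_int n\<bar> = \<bar>0\<bar> \<or>
    \<bar>opt_x j - opt_x i + of_int m\<bar> = \<bar>1 / 2 - d\<bar> \<and>
      \<bar>opt_y j - opt_y i + of_int n\<bar> = \<bar>1 - s / 2 + 3 / 2 * d - s / 2 * d\<bar>"
    using assms unfolding contacts_def abs_eq_iff
    by (auto simp: s_d_def[symmetric] field_simps)
  then show ?thesis
    unfolding s_d_def(2)[symmetric]
  proof (elim disjE conjE, goal_cases)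
    case 1
    show ?case by (rule sq[OF 1 eqs(1)])
  next
    case 2
    show ?case by (rule sq[OF 2 eqs(2)])
  next
    case 3
    from sq[OF 3] show ?case by simp
  next
    case 4
    show ?case by (rule sq[OF 4 eqs(3)])
  qed
qed

lemma nearest_image:
  fixes a :: real
  assumes "\<bar>a\<bar> \<le> 1 / 2"
  shows "a\<^sup>2 \<le> (a + of_int m)\<^sup>2"
proof -
  have "m = 0 \<or> 1 \<le> \<bar>real_of_int m\<bar>" by linarith
  with assms have "\<bar>a\<bar> \<le> \<bar>a + of_int m\<bar>" by linarith
  then show ?thesis by (simp only: abs_le_square_iff)
qed

text \<open>With both coordinates at most 1/2 in absolute value no lattice translate is shorter,
  coordinate by coordinate. One such image therefore controls all translates of the pair.\<close>

definition opt_image :: "nat \<Rightarrow> nat \<Rightarrow> int \<Rightarrow> int \<Rightarrow> bool" where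
  "opt_image i j m n \<longleftrightarrow> \<bar>opt_x j - opt_x i + of_int m\<bar> \<le> 1 / 2 \<and> \<bar>opt_y j - opt_y i + of_int n\<bar> \<le> 1 / 2 \<and>
     opt_dist\<^sup>2 \<le> (opt_x j - opt_x i + of_int m)\<^sup>2 + (opt_y j - opt_y i + of_int n)\<^sup>2"

lemma contact_image:
  assumes "(i, j, m, n) \<in> set contacts"
  shows "opt_image i j m n"
proof -
  have "\<bar>opt_x j - opt_x i + of_int m\<bar> \<le> 1 / 2 \<and> \<bar>opt_y j - opt_y i + of_int n\<bar> \<le> 1 / 2"
    using assms opt_bounds unfolding contacts_def
    by (auto simp: abs_le_iff field_simps)
  then show ?thesis using contact_dist[OF assms] by (simp add: opt_image_def)
qed

text \<open>For the pairs without contact the horizontal difference 1/2 alone exceeds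
  \<open>opt_dist\<close>.\<close>

lemma far_image: "opt_image 0 3 0 0" "opt_image 1 5 0 0" "opt_image 4 2 0 0"
proof -
  have "opt_dist\<^sup>2 \<le> (1 / 2)\<^sup>2 + y\<^sup>2" for y
    using opt_dist_bounds power_mono[of opt_dist "1 / 2" 2] by (simp add: add_increasing2)
  then have img: "opt_image i j 0 0"
    if "opt_x j - opt_x i = 1 / 2" "\<bar>opt_y j - opt_y i\<bar> \<le> 1 / 2" for i j
    using that(2) unfolding opt_image_def of_int_0 add_0_right that(1) by simp
  show "opt_image 0 3 0 0" "opt_image 1 5 0 0" "opt_image 4 2 0 0"
    using opt_bounds by (auto intro!: img simp: abs_le_iff field_simps)
qed

lemma opt_image_ex:
  assumes "i < 6" "j < 6" "i \<noteq> j"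
  shows "\<exists>m n. opt_image i j m n \<or> opt_image j i m n"
proof -
  let ?L = "contacts @ [(0, 3, 0, 0), (1, 5, 0, 0), (4, 2, 0, 0)]"
  have "\<forall>i\<in>set [0..<6]. \<forall>j\<in>set [0..<6]. i = j \<or>
      (\<exists>c\<in>set ?L. fst c = i \<and> fst (snd c) = j \<or> fst c = j \<and> fst (snd c) = i)"
    by code_simp
  moreover have "i \<in> set [0..<6]" "j \<in> set [0..<6]" using assms by simp_all
  ultimately obtain c where c: "c \<in> set ?L" "fst c = i \<and> fst (snd c) = j \<or> fst c = j \<and> fst (snd c) = i"
    using assms(3) by blast
  moreover obtain a b m n where "c = (a, b, m, n)" by (cases c)
  ultimately have abmn: "(a, b, m, n) \<in> set ?L" "a = i \<and> b = j \<or> a = j \<and> b = i" by simp_all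
  then have "opt_image a b m n" using contact_image far_image by auto
  with abmn(2) show ?thesis by blast
qed

lemma opt_separated:
  assumes "i < 6" "j < 6" "i \<noteq> j"
  shows "opt_dist\<^sup>2 \<le> (opt_x i - opt_x j + of_int m)\<^sup>2 + (opt_y i - opt_y j + of_int n)\<^sup>2"
proof -
  have *: "opt_dist\<^sup>2 \<le> (opt_x j - opt_x i + of_int m)\<^sup>2 + (opt_y j - opt_y i + of_int n)\<^sup>2"
    if "opt_image i j m' n'" for i j m' n' m n
  proof -
    have "opt_dist\<^sup>2 \<le> (opt_x j - opt_x i + of_int m')\<^sup>2 + (opt_y j - opt_y i + of_int n')\<^sup>2"
      using that by (simp add: opt_image_def)
    also have "\<dots> \<le> (opt_x j - opt_x i + of_int m' + of_int (m - m'))\<^sup>2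
        + (opt_y j - opt_y i + of_int n' + of_int (n - n'))\<^sup>2"
      using that by (intro add_mono nearest_image) (simp_all add: opt_image_def)
    also have "opt_x j - opt_x i + of_int m' + of_int (m - m') = opt_x j - opt_x i + of_int m" by simp
    also have "opt_y j - opt_y i + of_int n' + of_int (n - n') = opt_y j - opt_y i + of_int n" by simp
    finally show ?thesis .
  qed
  from opt_image_ex[OF assms] obtain m' n' where "opt_image i j m' n' \<or> opt_image j i m' n'" by blast
  then show ?thesis
  proof
    assume "opt_image i j m' n'"
    from *[OF this, of "- m" "- n"] show ?thesis
      using power2_minus[of "opt_x i - opt_x j + of_int m"] power2_minus[of "opt_y i - opt_y j + of_int n"]
      by (simp add: algebra_simps)
  next
    assume "opt_image j i m' n'"
    from *[OF this] show ?thesis .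
  qed
qed

section \<open>Local rigidity\<close>

text \<open>The large integers are exact optimal dual solutions of the linear programs that maximise the
  single coordinates.\<close>

lemma rigidity_system_half:
  fixes x1 x2 x3 x4 x5 y1 y2 y3 y4 y5 \<rho> :: real
  assumes e:
    "0 \<le> 200 * x1 + 347 * y1 + 15 * \<rho>"
    "0 \<le> - 200 * x2 + 347 * y2 + 15 * \<rho>"
    "0 \<le> 300 * x4 - 265 * y4 + 15 * \<rho>"
    "0 \<le> - 300 * x5 - 265 * y5 + 15 * \<rho>"
    "0 \<le> - 400 * x2 + 400 * x1 + 30 * \<rho>"
    "0 \<le> 300 * x3 - 300 * x1 - 265 * y3 + 265 * y1 + 30 * \<rho>"
    "0 \<le> 100 * x4 - 100 * x1 + 388 * y4 - 388 * y1 + 30 * \<rho>"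
    "0 \<le> - 300 * x3 + 300 * x2 - 265 * y3 + 265 * y2 + 30 * \<rho>"
    "0 \<le> - 100 * x5 + 100 * x2 + 388 * y5 - 388 * y2 + 30 * \<rho>"
    "0 \<le> - 200 * x4 + 200 * x3 - 347 * y4 + 347 * y3 + 30 * \<rho>"
    "0 \<le> 200 * x5 - 200 * x3 - 347 * y5 + 347 * y3 + 30 * \<rho>"
    "0 \<le> 400 * x5 - 400 * x4 + 30 * \<rho>"
    and "0 \<le> \<rho>"
  shows "x1 \<le> 0.7 * \<rho>" "- x1 \<le> 0.7 * \<rho>" "x3 \<le> 0.7 * \<rho>" "x4 \<le> 0.7 * \<rho>" "- x4 \<le> 0.7 * \<rho>"
    "y1 \<le> 0.7 * \<rho>" "- y1 \<le> 0.7 * \<rho>" "y3 \<le> 0.7 * \<rho>" "- y3 \<le> 0.7 * \<rho>"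
    "y4 \<le> 0.7 * \<rho>" "- y4 \<le> 0.7 * \<rho>"
proof -
  define f1 f2 f3 f4 f5 f6 f7 f8 f9 f10 f11 f12 where f_defs:
    "f1 = 200 * x1 + 347 * y1 + 15 * \<rho>"
    "f2 = - 200 * x2 + 347 * y2 + 15 * \<rho>"
    "f3 = 300 * x4 - 265 * y4 + 15 * \<rho>"
    "f4 = - 300 * x5 - 265 * y5 + 15 * \<rho>"
    "f5 = - 400 * x2 + 400 * x1 + 30 * \<rho>"
    "f6 = 300 * x3 - 300 * x1 - 265 * y3 + 265 * y1 + 30 * \<rho>"
    "f7 = 100 * x4 - 100 * x1 + 388 * y4 - 388 * y1 + 30 * \<rho>"
    "f8 = - 300 * x3 + 300 * x2 - 265 * y3 + 265 * y2 + 30 * \<rho>"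
    "f9 = - 100 * x5 + 100 * x2 + 388 * y5 - 388 * y2 + 30 * \<rho>"
    "f10 = - 200 * x4 + 200 * x3 - 347 * y4 + 347 * y3 + 30 * \<rho>"
    "f11 = 200 * x5 - 200 * x3 - 347 * y5 + 347 * y3 + 30 * \<rho>"
    "f12 = 400 * x5 - 400 * x4 + 30 * \<rho>"
  have f: "0 \<le> f1" "0 \<le> f2" "0 \<le> f3" "0 \<le> f4" "0 \<le> f5" "0 \<le> f6" "0 \<le> f7" "0 \<le> f8" "0 \<le> f9" "0 \<le> f10" "0 \<le> f11" "0 \<le> f12"
    using e by (simp_all add: f_defs)
  have "684539139266020000 * x1 = 404132793648584790 * \<rho> - (2718494359373840 * f2 + 1545110641208396 * f3 + 2014578199179236 * f4 + 1858650707034400 * f6 + 1269439271557000 * f7 + 816119020413840 * f8 + 2988631657506160 * f9 + 239447024333980 * f10 + 1803244554264820 * f11 + 1356469286628557 * f12)"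
    by (simp add: f_defs algebra_simps)
  with f \<open>0 \<le> \<rho>\<close> show "x1 \<le> 0.7 * \<rho>" by linarith
  have "535634209520000 * (- x1) = 315157294510860 * \<rho> - (2127151675840 * f1 + 1576355447536 * f3 + 1209009199696 * f4 + 1113192104617 * f5 + 393255061136 * f6 + 2170964491540 * f7 + 1209009199696 * f8 + 825740819380 * f9 + 1223631207840 * f10 + 1113192104617 * f12)"
    by (simp add: f_defs algebra_simps)
  with f \<open>0 \<le> \<rho>\<close> show "- x1 \<le> 0.7 * \<rho>" by linarith
  have "170475560000 * x3 = 108999289980 * \<rho> - (587719120 * f2 + 296570128 * f3 + 473009248 * f4 + 273066181 * f5 + 296570128 * f6 + 202554340 * f7 + 473009248 * f8 + 848675220 * f9 + 587719120 * f11 + 273066181 * f12)"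
    by (simp add: f_defs algebra_simps)
  with f \<open>0 \<le> \<rho>\<close> show "x3 \<le> 0.7 * \<rho>" by linarith
  have "350688812648000 * x4 = 85024941297960 * \<rho> - (138592928760 * f1 + 546469998040 * f2 + 897044662640 * f4 + 16041781041 * f5 + 59029538568 * f6 + 164264365980 * f7 + 181478287848 * f8 + 612672256700 * f9 + 183673123920 * f10 + 825951561155 * f12)"
    by (simp add: f_defs algebra_simps)
  with f \<open>0 \<le> \<rho>\<close> show "x4 \<le> 0.7 * \<rho>" by linarith
  have "2583166563268000 * (- x4) = 479336235132810 * \<rho> - (4335469439540 * f1 + 1331055357060 * f2 + 7013776252960 * f3 + 406163763720 * f4 + 32423493531 * f5 + 1336765326468 * f6 + 4790336873800 * f7 + 434810363988 * f8 + 1487373596280 * f9 + 1352932443720 * f11)"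
    by (simp add: f_defs algebra_simps)
  with f \<open>0 \<le> \<rho>\<close> show "- x4 \<le> 0.7 * \<rho>" by linarith
  have "1339085523800 * y1 = 515979084120 * \<rho> - (793976040 * f2 + 3311064736 * f3 + 2781747376 * f4 + 1384554313 * f5 + 566649944 * f6 + 3838267420 * f7 + 1742088184 * f8 + 1899904780 * f9 + 1763157360 * f10 + 2561286727 * f12)"
    by (simp add: f_defs algebra_simps)
  with f \<open>0 \<le> \<rho>\<close> show "y1 \<le> 0.7 * \<rho>" by linarith
  have "2395168436900 * (- y1) = 453361208790 * \<rho> - (4522846160 * f1 + 3102693140 * f2 + 946768680 * f4 + 75579239 * f5 + 3116003092 * f6 + 1013543972 * f8 + 3467071320 * f9 + 3153688680 * f11)"
    by (simp add: f_defs algebra_simps)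
  with f \<open>0 \<le> \<rho>\<close> show "- y1 \<le> 0.7 * \<rho>" by linarith
  have "822560 * y3 = 289020 * \<rho> - (1552 * f3 + 1552 * f4 + 1429 * f5 + 1552 * f6 + 1060 * f7 + 1552 * f8 + 1060 * f9 + 1429 * f12)"
    by (simp add: f_defs algebra_simps)
  with f \<open>0 \<le> \<rho>\<close> show "y3 \<le> 0.7 * \<rho>" by linarith
  have "764356 * (- y3) = 261480 * \<rho> - (1429 * f1 + 1429 * f2 + 429 * f3 + 429 * f4 + 429 * f6 + 1571 * f7 + 429 * f8 + 1571 * f9 + 1429 * f10 + 1429 * f11)"
    by (simp add: f_defs algebra_simps)
  with f \<open>0 \<le> \<rho>\<close> show "- y3 \<le> 0.7 * \<rho>" by linarith
  have "5356342095200 * y4 = 1411933018620 * \<rho> - (7052629440 * f2 + 17074658576 * f3 + 12372905616 * f4 + 939791853 * f5 + 1020683664 * f6 + 697116420 * f7 + 3137953104 * f8 + 8450566980 * f9 + 3175904160 * f10 + 11392320957 * f12)"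
    by (simp add: f_defs algebra_simps)
  with f \<open>0 \<le> \<rho>\<close> show "y4 \<le> 0.7 * \<rho>" by linarith
  have "8963587974539960 * (- y4) = 2316562602944910 * \<rho> - (21821369653276 * f1 + 10019124144364 * f2 + 7868163672608 * f4 + 6550992009276 * f6 + 23989763278724 * f7 + 3007840628364 * f8 + 11014726403636 * f9 + 992622990216 * f10 + 6307350061584 * f11 + 5501129324573 * f12)"
    by (simp add: f_defs algebra_simps)
  with f \<open>0 \<le> \<rho>\<close> show "- y4 \<le> 0.7 * \<rho>" by linarith
qed

text \<open>The system is invariant under reflection of the first axis, which changes the sign of
  every x, exchanges 1 with 2 and 4 with 5 and fixes 3. The half already proved, applied to the
  mirrored variables, supplies the remaining bounds.\<close>

lemma rigidity_system:
  fixes x1 x2 x3 x4 x5 y1 y2 y3 y4 y5 \<rho> :: real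
  assumes
    "0 \<le> 200 * x1 + 347 * y1 + 15 * \<rho>"
    "0 \<le> - 200 * x2 + 347 * y2 + 15 * \<rho>"
    "0 \<le> 300 * x4 - 265 * y4 + 15 * \<rho>"
    "0 \<le> - 300 * x5 - 265 * y5 + 15 * \<rho>"
    "0 \<le> - 400 * x2 + 400 * x1 + 30 * \<rho>"
    "0 \<le> 300 * x3 - 300 * x1 - 265 * y3 + 265 * y1 + 30 * \<rho>"
    "0 \<le> 100 * x4 - 100 * x1 + 388 * y4 - 388 * y1 + 30 * \<rho>"
    "0 \<le> - 300 * x3 + 300 * x2 - 265 * y3 + 265 * y2 + 30 * \<rho>"
    "0 \<le> - 100 * x5 + 100 * x2 + 388 * y5 - 388 * y2 + 30 * \<rho>"
    "0 \<le> - 200 * x4 + 200 * x3 - 347 * y4 + 347 * y3 + 30 * \<rho>"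
    "0 \<le> 200 * x5 - 200 * x3 - 347 * y5 + 347 * y3 + 30 * \<rho>"
    "0 \<le> 400 * x5 - 400 * x4 + 30 * \<rho>"
    and "0 \<le> \<rho>"
  shows "\<bar>x1\<bar> \<le> 0.7 * \<rho>" "\<bar>x2\<bar> \<le> 0.7 * \<rho>" "\<bar>x3\<bar> \<le> 0.7 * \<rho>" "\<bar>x4\<bar> \<le> 0.7 * \<rho>" "\<bar>x5\<bar> \<le> 0.7 * \<rho>"
    "\<bar>y1\<bar> \<le> 0.7 * \<rho>" "\<bar>y2\<bar> \<le> 0.7 * \<rho>" "\<bar>y3\<bar> \<le> 0.7 * \<rho>" "\<bar>y4\<bar> \<le> 0.7 * \<rho>" "\<bar>y5\<bar> \<le> 0.7 * \<rho>"
proof -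
  note half = rigidity_system_half[OF assms]
  note mirrored = rigidity_system_half[of "- x2" y2 \<rho> "- x1" y1 "- x5" y5 "- x4" y4 "- x3" y3]
  have "0 \<le> 200 * - x2 + 347 * y2 + 15 * \<rho>" "0 \<le> - 200 * - x1 + 347 * y1 + 15 * \<rho>"
    "0 \<le> 300 * - x5 - 265 * y5 + 15 * \<rho>" "0 \<le> - 300 * - x4 - 265 * y4 + 15 * \<rho>"
    "0 \<le> - 400 * - x1 + 400 * - x2 + 30 * \<rho>"
    "0 \<le> 300 * - x3 - 300 * - x2 - 265 * y3 + 265 * y2 + 30 * \<rho>"
    "0 \<le> 100 * - x5 - 100 * - x2 + 388 * y5 - 388 * y2 + 30 * \<rho>"
    "0 \<le> - 300 * - x3 + 300 * - x1 - 265 * y3 + 265 * y1 + 30 * \<rho>"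
    "0 \<le> - 100 * - x4 + 100 * - x1 + 388 * y4 - 388 * y1 + 30 * \<rho>"
    "0 \<le> - 200 * - x5 + 200 * - x3 - 347 * y5 + 347 * y3 + 30 * \<rho>"
    "0 \<le> 200 * - x4 - 200 * - x3 - 347 * y4 + 347 * y3 + 30 * \<rho>"
    "0 \<le> 400 * - x4 - 400 * - x5 + 30 * \<rho>"
    using assms by linarith+
  note mirrored = mirrored[OF this assms(13)]
  from half mirrored show "\<bar>x1\<bar> \<le> 0.7 * \<rho>" "\<bar>x2\<bar> \<le> 0.7 * \<rho>" "\<bar>x3\<bar> \<le> 0.7 * \<rho>"
    "\<bar>x4\<bar> \<le> 0.7 * \<rho>" "\<bar>x5\<bar> \<le> 0.7 * \<rho>" "\<bar>y1\<bar> \<le> 0.7 * \<rho>" "\<bar>y2\<bar> \<le> 0.7 * \<rho>"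
    "\<bar>y3\<bar> \<le> 0.7 * \<rho>" "\<bar>y4\<bar> \<le> 0.7 * \<rho>" "\<bar>y5\<bar> \<le> 0.7 * \<rho>"
    by (simp_all only: abs_le_iff minus_minus)
qed

section \<open>Packings and isometric copies\<close>

definition pts :: "(nat \<Rightarrow> real) \<Rightarrow> (nat \<Rightarrow> real) \<Rightarrow> torus set" where
  "pts x y = (\<lambda>i. proj_torus (x i, y i)) ` {..<6}"

definition packing :: "torus set \<Rightarrow> bool" where
  "packing S \<longleftrightarrow> card S = 6 \<and> (\<forall>u\<in>S. \<forall>v\<in>S. u \<noteq> v \<longrightarrow> opt_dist \<le> dist u v)"

definition isometric :: "torus set \<Rightarrow> torus set \<Rightarrow> bool" where
  "isometric S T \<longleftrightarrow> (\<exists>f. isometry f \<and> T = f ` S)"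

abbreviation optimal :: "torus set \<Rightarrow> bool" where
  "optimal \<equiv> isometric (pts opt_x opt_y)"

lemma isometric_trans: "isometric S T \<Longrightarrow> isometric T U \<Longrightarrow> isometric S U"
  unfolding isometric_def by (metis image_comp isometry_comp)

lemma isometric_sym:
  assumes "isometric S T"
  shows "isometric T S"
proof -
  from assms obtain f where f: "isometry f" "T = f ` S" by (auto simp: isometric_def)
  then have "bij f" by (simp add: isometry_def)
  then have "isometry (inv f)" using f(1)
    by (simp add: isometry_def bij_imp_bij_inv) (metis bij_is_surj surj_f_inv_f)
  moreover have "S = inv f ` T" using \<open>bij f\<close> f(2) by (simp add: image_comp bij_is_inj)
  ultimately show ?thesis by (auto simp: isometric_def)
qed

lemma packing_isometric:
  assumes "isometric S T" "packing S"
  shows "packing T"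
proof -
  from assms obtain f where f: "isometry f" "T = f ` S" by (auto simp: isometric_def)
  then have "inj f" by (simp add: isometry_def bij_is_inj)
  with assms(2) f show ?thesis
    by (auto simp: packing_def isometry_def card_image inj_on_subset)
qed

lemma opt_dist_pos: "0 < opt_dist"
  using opt_dist_bounds by simp

lemma packing_pts_iff:
  "packing (pts x y) \<longleftrightarrow> (\<forall>i<6. \<forall>j<6. i \<noteq> j \<longrightarrow>
     (\<forall>m n :: int. opt_dist\<^sup>2 \<le> (x i - x j + of_int m)\<^sup>2 + (y i - y j + of_int n)\<^sup>2))"
  (is "_ \<longleftrightarrow> ?R")
proof
  assume P: "packing (pts x y)"
  then have "inj_on (\<lambda>i. proj_torus (x i, y i)) {..<6}"
    by (intro eq_card_imp_inj_on) (simp_all add: packing_def pts_def)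
  then have "proj_torus (x i, y i) \<noteq> proj_torus (x j, y j)" if "i < 6" "j < 6" "i \<noteq> j" for i j
    using that by (auto dest: inj_onD)
  with P have "opt_dist \<le> dist (proj_torus (x i, y i)) (proj_torus (x j, y j))"
    if "i < 6" "j < 6" "i \<noteq> j" for i j
    using that unfolding packing_def pts_def by simp
  then show ?R using opt_dist_pos by (simp add: dist_proj_ge_iff)
next
  assume R: ?R
  then have far: "opt_dist \<le> dist (proj_torus (x i, y i)) (proj_torus (x j, y j))"
    if "i < 6" "j < 6" "i \<noteq> j" for i j
    using that opt_dist_pos by (simp add: dist_proj_ge_iff)
  have "inj_on (\<lambda>i. proj_torus (x i, y i)) {..<6}"
  proof (rule inj_onI, rule ccontr)
    fix i j :: nat
    assume "i \<in> {..<6}" "j \<in> {..<6}" "proj_torus (x i, y i) = proj_torus (x j, y j)" "i \<noteq> j"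
    then show False using far[of i j] opt_dist_pos by simp
  qed
  with far show "packing (pts x y)"
    unfolding packing_def pts_def by (auto simp: card_image)
qed

lemma packing_opt: "packing (pts opt_x opt_y)"
  unfolding packing_pts_iff using opt_separated by blast

lemma pts_reindex:
  assumes "\<pi> ` {..<6} = {..<6}"
    and "\<And>i. i < 6 \<Longrightarrow> x' i - x (\<pi> i) \<in> \<int>" "\<And>i. i < 6 \<Longrightarrow> y' i - y (\<pi> i) \<in> \<int>"
  shows "pts x' y' = pts x y"
proof -
  have "pts x' y' = (\<lambda>i. proj_torus (x (\<pi> i), y (\<pi> i))) ` {..<6}"
    unfolding pts_def using assms by (intro image_cong) (simp_all add: proj_torus_eq_iff)
  also have "\<dots> = (\<lambda>i. proj_torus (x i, y i)) ` \<pi> ` {..<6}" by (simp add: image_image)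
  finally show ?thesis by (simp add: assms(1) pts_def)
qed

lemma isometric_induced:
  assumes "\<And>p q. lattice_dist (F p) (F q) = lattice_dist p q" "surj F"
    and "\<And>i. i < 6 \<Longrightarrow> F (x i, y i) = (x' i, y' i)"
  shows "isometric (pts x y) (pts x' y')"
  unfolding isometric_def
proof (intro exI conjI)
  show "isometry (induced F)" by (rule isometry_induced[OF assms(1,2)])
  show "pts x' y' = induced F ` pts x y"
    unfolding pts_def image_image using assms(3) by (intro image_cong) (simp_all add: induced_proj assms(1))
qed

lemma isometric_reflect: "isometric (pts x y) (pts (\<lambda>i. - x i) y)"
proof (rule isometric_induced[where F = "\<lambda>p. (- fst p, snd p)"])
  show "surj (\<lambda>p :: real \<times> real. (- fst p, snd p))"
    by (rule surjI[of _ "\<lambda>p. (- fst p, snd p)"]) simp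
qed (simp_all add: lattice_dist_reflect)

lemma isometric_swap: "isometric (pts x y) (pts y x)"
  by (rule isometric_induced[where F = prod.swap]) (simp_all add: lattice_dist_swap)

lemma isometric_translate: "isometric (pts x y) (pts (\<lambda>i. x i + a) (\<lambda>i. y i + b))"
proof (rule isometric_induced[where F = "\<lambda>p. p + (a, b)"])
  show "surj (\<lambda>p :: real \<times> real. p + (a, b))"
    by (rule surjI[of _ "\<lambda>p. p - (a, b)"]) simp
qed (simp_all add: lattice_dist_translate)

text \<open>The defect \<open>|w|\<^sup>2\<close> of the linearised contact condition \<open>2 p \<cdot> w + |w|\<^sup>2 \<ge> 0\<close> is
  absorbed into \<open>\<rho>\<close> by \<open>|w| \<le> 14/1000\<close>.\<close>

lemma contact_linear:
  fixes p q a b c \<rho> P Q D :: real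
  assumes "p\<^sup>2 + q\<^sup>2 = D" "D \<le> (p + a)\<^sup>2 + (q + b)\<^sup>2"
    and "\<bar>p - P / 1000\<bar> \<le> 1 / 2000" "\<bar>q - Q / 1000\<bar> \<le> 1 / 2000"
    and "\<bar>a\<bar> \<le> 14 / 1000" "\<bar>b\<bar> \<le> 14 / 1000" "\<bar>a\<bar> \<le> c" "\<bar>b\<bar> \<le> c"
  shows "0 \<le> P * a + Q * b + 15 * c"
proof -
  have sq: "t\<^sup>2 \<le> 14 / 1000 * c" if "\<bar>t\<bar> \<le> 14 / 1000" "\<bar>t\<bar> \<le> c" for t
  proof -
    have "\<bar>t\<bar> * \<bar>t\<bar> \<le> 14 / 1000 * c" using that by (intro mult_mono) simp_all
    then show ?thesis by (simp add: power2_eq_square)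
  qed
  have round: "u * t \<le> v / 1000 * t + 1 / 2000 * c" if "\<bar>u - v / 1000\<bar> \<le> 1 / 2000" "\<bar>t\<bar> \<le> c" for u v t
  proof -
    have "(u - v / 1000) * t \<le> \<bar>u - v / 1000\<bar> * \<bar>t\<bar>" by (metis abs_ge_self abs_mult)
    also have "\<dots> \<le> 1 / 2000 * c" using that by (intro mult_mono) simp_all
    finally show ?thesis by (simp add: algebra_simps)
  qed
  have "0 \<le> 2 * (p * a + q * b) + a\<^sup>2 + b\<^sup>2"
    using assms(1,2) by (simp add: power2_sum algebra_simps)
  \<comment> \<open>After multiplication by 500 the two squares contribute
    \<open>2 * 500 * 14 / 1000 * c = 14 * c\<close> and the two rounding errors
    \<open>2 * 2 * 500 / 2000 * c = c\<close>: together the 15 of the statement.\<close>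
  with sq[of a] sq[of b] round[of p P a] round[of q Q b] assms show ?thesis by simp
qed

text \<open>The largest deviation \<rho> satisfies \<rho> \<le> 0.7 \<rho> and hence vanishes. The
  radius 7/1000 is what makes 0.7 attainable: two deviations differ by at most 14/1000, and this
  bounds the quadratic defect in \<open>contact_linear\<close>.\<close>

lemma rigidity:
  assumes "packing (pts u v)"
    and u: "\<And>k. k < 6 \<Longrightarrow> \<bar>u k - a - opt_x k\<bar> \<le> 7 / 1000"
    and v: "\<And>k. k < 6 \<Longrightarrow> \<bar>v k - b - opt_y k\<bar> \<le> 7 / 1000"
  shows "optimal (pts u v)"
proof -
  \<comment> \<open>Deviations are measured relative to point 0, so that the unknown translation (a,
    b) drops out and \<open>p 0 = q 0 = 0\<close>.\<close>
  define p q where "p k = u k - u 0 - opt_x k" and "q k = v k - v 0 - opt_y k" for k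
  define \<rho> where "\<rho> = Max ((\<lambda>k. max \<bar>p k\<bar> \<bar>q k\<bar>) ` {..<6})"
  have \<rho>: "\<bar>p k\<bar> \<le> \<rho>" "\<bar>q k\<bar> \<le> \<rho>" if "k < 6" for k
    using that Max_ge[of "(\<lambda>k. max \<bar>p k\<bar> \<bar>q k\<bar>) ` {..<6}" "max \<bar>p k\<bar> \<bar>q k\<bar>"]
    by (auto simp: \<rho>_def)
  have zero: "p 0 = 0" "q 0 = 0" by (simp_all add: p_def q_def)
  have small: "\<bar>p j - p i\<bar> \<le> 14 / 1000" "\<bar>q j - q i\<bar> \<le> 14 / 1000" if "i < 6" "j < 6" for i j
    using u[of i] u[of j] v[of i] v[of j] that unfolding p_def q_def by linarith+
  \<comment> \<open>An edge at point 0 has one fixed end, so its vector changes by at most \<rho>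
    per coordinate instead of 2 \<rho>; this is the origin of 15 and 30 in
    \<open>rigidity_system\<close>. P and Q are the coordinates of the contact vector in
    thousandths, rounded to integers.\<close>
  have edge: "0 \<le> P * (p j - p i) + Q * (q j - q i) + 15 * ((if i = 0 then 1 else 2) * \<rho>)"
    if "(i, j, m, n) \<in> set contacts" "\<bar>opt_x j - opt_x i + of_int m - P / 1000\<bar> \<le> 1 / 2000"
      "\<bar>opt_y j - opt_y i + of_int n - Q / 1000\<bar> \<le> 1 / 2000" for i j m n P Q
  proof (rule contact_linear[OF contact_dist[OF that(1)]])
    have ij: "i < 6" "j < 6" "i \<noteq> j" using that(1) by (auto simp: contacts_def)
    have "opt_dist\<^sup>2 \<le> (u j - u i + of_int m)\<^sup>2 + (v j - v i + of_int n)\<^sup>2"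
      using assms(1) ij unfolding packing_pts_iff by metis
    also have "u j - u i + of_int m = opt_x j - opt_x i + of_int m + (p j - p i)" by (simp add: p_def)
    also have "v j - v i + of_int n = opt_y j - opt_y i + of_int n + (q j - q i)" by (simp add: q_def)
    finally show "opt_dist\<^sup>2 \<le> (opt_x j - opt_x i + of_int m + (p j - p i))\<^sup>2
        + (opt_y j - opt_y i + of_int n + (q j - q i))\<^sup>2" .
    show "\<bar>p j - p i\<bar> \<le> (if i = 0 then 1 else 2) * \<rho>" "\<bar>q j - q i\<bar> \<le> (if i = 0 then 1 else 2) * \<rho>"
      using \<rho>[OF ij(1)] \<rho>[OF ij(2)] zero by (auto simp: abs_le_iff)
    show "\<bar>p j - p i\<bar> \<le> 14 / 1000" "\<bar>q j - q i\<bar> \<le> 14 / 1000" using small ij by simp_all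
  qed (use that in simp_all)
  have "\<bar>p 1\<bar> \<le> 0.7 * \<rho>" "\<bar>p 2\<bar> \<le> 0.7 * \<rho>" "\<bar>p 3\<bar> \<le> 0.7 * \<rho>" "\<bar>p 4\<bar> \<le> 0.7 * \<rho>" "\<bar>p 5\<bar> \<le> 0.7 * \<rho>"
    "\<bar>q 1\<bar> \<le> 0.7 * \<rho>" "\<bar>q 2\<bar> \<le> 0.7 * \<rho>" "\<bar>q 3\<bar> \<le> 0.7 * \<rho>" "\<bar>q 4\<bar> \<le> 0.7 * \<rho>" "\<bar>q 5\<bar> \<le> 0.7 * \<rho>"
  proof -
    have "0 \<le> \<rho>" using \<rho>(1)[of 0] by simp
    have "0 \<le> 200 * p 1 + 347 * q 1 + 15 * \<rho>"
      using edge[of 0 1 0 0 200 347] opt_bounds zero by (simp add: contacts_def abs_le_iff field_simps)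
    moreover have "0 \<le> - 200 * p 2 + 347 * q 2 + 15 * \<rho>"
      using edge[of 0 2 "-1" 0 "-200" 347] opt_bounds zero by (simp add: contacts_def abs_le_iff field_simps)
    moreover have "0 \<le> 300 * p 4 - 265 * q 4 + 15 * \<rho>"
      using edge[of 0 4 0 "-1" 300 "-265"] opt_bounds zero by (simp add: contacts_def abs_le_iff field_simps)
    moreover have "0 \<le> - 300 * p 5 - 265 * q 5 + 15 * \<rho>"
      using edge[of 0 5 "-1" "-1" "-300" "-265"] opt_bounds zero by (simp add: contacts_def abs_le_iff field_simps)
    moreover have "0 \<le> - 400 * p 2 + 400 * p 1 + 30 * \<rho>"
      using edge[of 1 2 "-1" 0 "-400" 0] opt_bounds zero by (simp add: contacts_def abs_le_iff field_simps)
    moreover have "0 \<le> 300 * p 3 - 300 * p 1 - 265 * q 3 + 265 * q 1 + 30 * \<rho>"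
      using edge[of 1 3 0 0 300 "-265"] opt_bounds zero by (simp add: contacts_def abs_le_iff field_simps)
    moreover have "0 \<le> 100 * p 4 - 100 * p 1 + 388 * q 4 - 388 * q 1 + 30 * \<rho>"
      using edge[of 1 4 0 0 100 388] opt_bounds zero by (simp add: contacts_def abs_le_iff field_simps)
    moreover have "0 \<le> - 300 * p 3 + 300 * p 2 - 265 * q 3 + 265 * q 2 + 30 * \<rho>"
      using edge[of 2 3 0 0 "-300" "-265"] opt_bounds zero by (simp add: contacts_def abs_le_iff field_simps)
    moreover have "0 \<le> - 100 * p 5 + 100 * p 2 + 388 * q 5 - 388 * q 2 + 30 * \<rho>"
      using edge[of 2 5 0 0 "-100" 388] opt_bounds zero by (simp add: contacts_def abs_le_iff field_simps)
    moreover have "0 \<le> - 200 * p 4 + 200 * p 3 - 347 * q 4 + 347 * q 3 + 30 * \<rho>"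
      using edge[of 3 4 0 "-1" "-200" "-347"] opt_bounds zero by (simp add: contacts_def abs_le_iff field_simps)
    moreover have "0 \<le> 200 * p 5 - 200 * p 3 - 347 * q 5 + 347 * q 3 + 30 * \<rho>"
      using edge[of 3 5 0 "-1" 200 "-347"] opt_bounds zero by (simp add: contacts_def abs_le_iff field_simps)
    moreover have "0 \<le> 400 * p 5 - 400 * p 4 + 30 * \<rho>"
      using edge[of 4 5 0 0 400 0] opt_bounds zero by (simp add: contacts_def abs_le_iff field_simps)
    ultimately show "\<bar>p 1\<bar> \<le> 0.7 * \<rho>" "\<bar>p 2\<bar> \<le> 0.7 * \<rho>" "\<bar>p 3\<bar> \<le> 0.7 * \<rho>"
      "\<bar>p 4\<bar> \<le> 0.7 * \<rho>" "\<bar>p 5\<bar> \<le> 0.7 * \<rho>" "\<bar>q 1\<bar> \<le> 0.7 * \<rho>" "\<bar>q 2\<bar> \<le> 0.7 * \<rho>" "\<bar>q 3\<bar> \<le> 0.7 * \<rho>"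
      "\<bar>q 4\<bar> \<le> 0.7 * \<rho>" "\<bar>q 5\<bar> \<le> 0.7 * \<rho>"
      using \<open>0 \<le> \<rho>\<close> by (rule rigidity_system)+
  qed
  note contraction = this
  have "max \<bar>p k\<bar> \<bar>q k\<bar> \<le> 0.7 * \<rho>" if "k < 6" for k
  proof -
    have "\<bar>p 0\<bar> \<le> 0.7 * \<rho>" "\<bar>q 0\<bar> \<le> 0.7 * \<rho>" using zero \<rho>(1)[of 0] by simp_all
    moreover have "k \<in> {0, 1, 2, 3, 4, 5}" using that by auto
    ultimately show ?thesis using contraction by (elim insertE emptyE) (simp_all only: max.bounded_iff)
  qed
  moreover have "\<rho> \<in> (\<lambda>k. max \<bar>p k\<bar> \<bar>q k\<bar>) ` {..<6}"
    unfolding \<rho>_def by (intro Max_in) (auto simp: lessThan_empty_iff)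
  ultimately obtain k where "max \<bar>p k\<bar> \<bar>q k\<bar> \<le> 0.7 * \<rho>" "\<rho> = max \<bar>p k\<bar> \<bar>q k\<bar>" by blast
  then have "\<rho> \<le> 0.7 * \<rho>" by (simp only:)
  then have pq: "p k = 0" "q k = 0" if "k < 6" for k using \<rho>[OF that] by auto
  have "u k - (opt_x k + u 0) \<in> \<int>" "v k - (opt_y k + v 0) \<in> \<int>" if "k < 6" for k
  proof -
    have "u k - (opt_x k + u 0) = p k" "v k - (opt_y k + v 0) = q k" by (simp_all add: p_def q_def)
    then show "u k - (opt_x k + u 0) \<in> \<int>" "v k - (opt_y k + v 0) \<in> \<int>" by (simp_all only: pq[OF that] Ints_0)
  qed
  then have "pts u v = pts (\<lambda>k. opt_x k + u 0) (\<lambda>k. opt_y k + v 0)"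
    by - (rule pts_reindex[of id]; simp only: id_apply image_id)
  then show ?thesis using isometric_translate by metis
qed

section \<open>Linear certificates\<close>

text \<open>\<open>Up i j\<close> and \<open>Dn i j\<close> denote the two vectors between the points \<open>i\<close> and \<open>j\<close> whose first coordinate is
  the cyclic gap from \<open>i\<close> to \<open>j\<close> and whose second coordinate is the cyclic gap from \<open>i\<close> to \<open>j\<close>,
  respectively from \<open>j\<close> to \<open>i\<close>. An entry \<open>(q, \<alpha>, \<beta>)\<close> of a leaf stands for the inequality
  \<open>\<alpha> [w, e'] + \<beta> [e, w] \<ge> min \<alpha> \<beta> [e, e']\<close>, where \<open>[_, _]\<close> is the determinant and the vector \<open>w\<close> of \<open>q\<close> lies in the
  sector from \<open>e\<close> to \<open>e'\<close>; in a \<open>Cut\<close> the triple is a vector of \<open>q\<close> and a direction dividing its sector.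
  The vectors \<open>e\<close> are integral in the unit \<open>1/502\<close>. The denominator is chosen because \<open>502 d \<approx> 201.004\<close>
  barely exceeds an integer; \<open>40402\<close> is the integral part of \<open>(502 d)\<^sup>2\<close>.\<close>

datatype quad = Up nat nat | Dn nat nat
type_synonym sector = "(int \<times> int) \<times> (int \<times> int)"
type_synonym entry = "quad \<times> int \<times> int"
datatype tree =
    End "entry list"
  | Cut entry tree tree
  | Near "(int \<times> (int \<times> entry list) \<times> (int \<times> entry list)) list"

text \<open>The length of the arc from i forward to j on a circle of circumference 1: for a fixed
  pair of indices it is an affine function of the coordinates.\<close>

definition cyc_gap :: "(nat \<Rightarrow> real) \<Rightarrow> nat \<Rightarrow> nat \<Rightarrow> real" where
  "cyc_gap X i j = X j - X i + (if i < j then 0 else 1)"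

text \<open>Ties and the full turn \<open>X 5 = X 0 + 1\<close> are allowed. Both occur in the boxes
  around the optimal configuration: the full turn is a tie between the first and the last
  point.\<close>

definition cyc_sorted :: "(nat \<Rightarrow> real) \<Rightarrow> bool" where
  "cyc_sorted X \<longleftrightarrow> X 0 \<le> X 1 \<and> X 1 \<le> X 2 \<and> X 2 \<le> X 3 \<and> X 3 \<le> X 4 \<and> X 4 \<le> X 5 \<and> X 5 \<le> X 0 + 1"

lemma cyc_sorted_mono:
  assumes "cyc_sorted X" "i \<le> j" "j < 6"
  shows "X i \<le> X j"
proof -
  have "i \<in> {0,1,2,3,4,5}" "j \<in> {0,1,2,3,4,5}" using assms by auto
  with assms show ?thesis by (auto simp: cyc_sorted_def)
qed

lemma cyc_gap_nonneg:
  assumes "cyc_sorted X" "i < 6" "j < 6"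
  shows "0 \<le> cyc_gap X i j"
proof (cases "i < j")
  case True
  then show ?thesis using cyc_sorted_mono[OF assms(1), of i j] assms by (simp add: cyc_gap_def)
next
  case False
  then show ?thesis
    using cyc_sorted_mono[OF assms(1), of 0 j] cyc_sorted_mono[OF assms(1), of i 5] assms
    by (simp add: cyc_gap_def cyc_sorted_def)
qed

text \<open>\<open>r ! i\<close> is the height rank of the i-th point in horizontal order. Signs are
  dropped, so that \<open>Up i j\<close>, \<open>Dn i j\<close>, \<open>Up j i\<close> and
  \<open>Dn j i\<close> bring the joining vectors from all four quadrants into the first
  one.\<close>

fun arcs :: "nat list \<Rightarrow> (nat \<Rightarrow> real) \<Rightarrow> (nat \<Rightarrow> real) \<Rightarrow> quad \<Rightarrow> real \<times> real" where
  "arcs r X Y (Up i j) = (cyc_gap X i j, cyc_gap Y (r ! i) (r ! j))"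
| "arcs r X Y (Dn i j) = (cyc_gap X i j, cyc_gap Y (r ! j) (r ! i))"

fun valid_quad :: "quad \<Rightarrow> bool" where
  "valid_quad (Up i j) \<longleftrightarrow> i < 6 \<and> j < 6 \<and> i \<noteq> j"
| "valid_quad (Dn i j) \<longleftrightarrow> i < 6 \<and> j < 6 \<and> i \<noteq> j"

text \<open>The accumulator \<open>(S, T, K, D)\<close> records \<open>D / 502 \<le> \<Sum> S\<^sub>i x\<^sub>i + \<Sum> T\<^sub>k y\<^sub>k + K\<close>.\<close>

type_synonym acc = "int list \<times> int list \<times> int \<times> int"

text \<open>\<open>shift\<close> and \<open>wrap\<close> together add u times an arc to a linear
  form: \<open>shift\<close> changes the coefficients of the end points, \<open>wrap\<close>
  supplies the constant 1 of an arc that passes the origin.\<close>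

definition shift :: "nat \<Rightarrow> nat \<Rightarrow> int \<Rightarrow> int list \<Rightarrow> int list" where
  "shift i j u cs = cs[i := cs ! i - u, j := cs ! j + u]"

definition wrap :: "nat \<Rightarrow> nat \<Rightarrow> int \<Rightarrow> int" where
  "wrap i j u = (if i < j then 0 else u)"

definition add_arcs :: "nat \<Rightarrow> nat \<Rightarrow> nat \<Rightarrow> nat \<Rightarrow> int \<Rightarrow> int \<Rightarrow> int \<Rightarrow> acc \<Rightarrow> acc" where
  "add_arcs i j k l u v w =
    (\<lambda>(S, T, K, D). (shift i j u S, shift k l v T, K + wrap i j u + wrap k l v, D + w))"

fun add_quad :: "nat list \<Rightarrow> quad \<Rightarrow> int \<Rightarrow> int \<Rightarrow> int \<Rightarrow> acc \<Rightarrow> acc" where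
  "add_quad r (Up i j) u v w = add_arcs i j (r ! i) (r ! j) u v w"
| "add_quad r (Dn i j) u v w = add_arcs i j (r ! j) (r ! i) u v w"

definition add_entry :: "nat list \<Rightarrow> (quad \<Rightarrow> sector) \<Rightarrow> entry \<Rightarrow> acc \<Rightarrow> acc" where
  "add_entry r \<sigma> = (\<lambda>(q, \<alpha>, \<beta>) A. case \<sigma> q of ((a, b), (a', b')) \<Rightarrow>
     add_quad r q (\<alpha> * b' - \<beta> * b) (\<beta> * a - \<alpha> * a') (min \<alpha> \<beta> * (a * b' - a' * b)) A)"

text \<open>By Abel summation, a linear form in numbers \<open>0 \<le> z\<^sub>0 \<le> \<dots> \<le> z\<^sub>5 \<le> 1\<close> is at most the largest suffix
  sum of its coefficients (or \<open>0\<close>), which is the second component of \<open>peak\<close>.\<close>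

fun peak :: "int list \<Rightarrow> int \<times> int" where
  "peak [] = (0, 0)"
| "peak (c # cs) = (case peak cs of (s, m) \<Rightarrow> (s + c, max m (s + c)))"

text \<open>The accumulated lower bound exceeds what monotonicity of the coordinates permits. The
  factor 502 keeps the comparison integral.\<close>

definition absurd_acc :: "acc \<Rightarrow> bool" where
  "absurd_acc = (\<lambda>(S, T, K, D). 502 * (K + snd (peak S) + snd (peak T)) < D)"

definition refutes :: "nat list \<Rightarrow> (quad \<Rightarrow> sector) \<Rightarrow> entry list \<Rightarrow> acc \<Rightarrow> bool" where
  "refutes r \<sigma> es A \<longleftrightarrow>
     list_all (\<lambda>(q, \<alpha>, \<beta>). valid_quad q \<and> 0 \<le> \<alpha> \<and> 0 \<le> \<beta>) es \<and>
     absurd_acc (fold (add_entry r \<sigma>) es A)"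

definition zeros :: "int list" where
  "zeros = [0, 0, 0, 0, 0, 0]"

text \<open>A bound on a single coordinate is refuted by starting from that bound, with multiplier
  \<open>u\<close>, as the first accumulated inequality. The numbers 0 to 4 denote the horizontal
  coordinates of the sorted points 1 to 5, the numbers 5 to 9 the vertical ones.\<close>

definition coord_acc :: "nat \<Rightarrow> int \<Rightarrow> int \<Rightarrow> acc" where
  "coord_acc k u w =
    (if k < 5 then (shift 0 (Suc k) u zeros, zeros, 0, w) else (zeros, shift 0 (k - 4) u zeros, 0, w))"

text \<open>A \<open>Near\<close> node lists for each of the ten coordinates a centre \<open>c\<close> and two refutations: of
  \<open>502 z \<ge> c + 3\<close> and of \<open>502 z \<le> c - 3\<close>.\<close>

fun confined ::
  "nat list \<Rightarrow> (quad \<Rightarrow> sector) \<Rightarrow> nat \<Rightarrow> (int \<times> (int \<times> entry list) \<times> (int \<times> entry list)) list \<Rightarrow> bool"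
where
  "confined r \<sigma> k [] = True"
| "confined r \<sigma> k ((c, (\<mu>, es), (\<nu>, fs)) # xs) \<longleftrightarrow>
     0 \<le> \<mu> \<and> refutes r \<sigma> es (coord_acc k \<mu> (\<mu> * (c + 3))) \<and>
     0 \<le> \<nu> \<and> refutes r \<sigma> fs (coord_acc k (- \<nu>) (\<nu> * (3 - c))) \<and>
     confined r \<sigma> (Suc k) xs"

text \<open>The length test on a cut direction keeps the bounding vectors of all sectors inside the
  disc; the chord inequality rests on this.\<close>

fun proves :: "nat list \<Rightarrow> (quad \<Rightarrow> sector) \<Rightarrow> tree \<Rightarrow> bool" where
  "proves r \<sigma> (End es) \<longleftrightarrow> refutes r \<sigma> es (zeros, zeros, 0, 0)"
| "proves r \<sigma> (Cut (q, a, b) s t) \<longleftrightarrow> a\<^sup>2 + b\<^sup>2 \<le> 40402 \<and>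
     proves r (\<sigma>(q := (fst (\<sigma> q), (a, b)))) s \<and> proves r (\<sigma>(q := ((a, b), snd (\<sigma> q)))) t"
| "proves r \<sigma> (Near xs) \<longleftrightarrow> length xs = 10 \<and> confined r \<sigma> 0 xs"

fun hits :: "tree \<Rightarrow> int list list" where
  "hits (End es) = []"
| "hits (Cut e s t) = hits s @ hits t"
| "hits (Near xs) = [map fst xs]"

definition coord :: "(nat \<Rightarrow> real) \<Rightarrow> (nat \<Rightarrow> real) \<Rightarrow> nat \<Rightarrow> real" where
  "coord X Y k = (if k < 5 then X (Suc k) - X 0 else Y (k - 4) - Y 0)"

definition near :: "(nat \<Rightarrow> real) \<Rightarrow> (nat \<Rightarrow> real) \<Rightarrow> int list \<Rightarrow> bool" where
  "near X Y cs \<longleftrightarrow> (\<forall>k<length cs. \<bar>502 * coord X Y k - of_int (cs ! k)\<bar> \<le> 3)"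

text \<open>Coordinates are taken relative to \<open>X 0\<close>, so that for sorted sequences they
  increase within [0, 1], as the suffix sum bound requires.\<close>

definition val :: "(nat \<Rightarrow> real) \<Rightarrow> int list \<Rightarrow> real" where
  "val X cs = (\<Sum>m<6. of_int (cs ! m) * (X m - X 0))"

fun acc_valid :: "(nat \<Rightarrow> real) \<Rightarrow> (nat \<Rightarrow> real) \<Rightarrow> acc \<Rightarrow> bool" where
  "acc_valid X Y (S, T, K, D) \<longleftrightarrow> length S = 6 \<and> length T = 6 \<and>
     of_int D \<le> 502 * (val X S + val Y T + of_int K)"

fun in_sector :: "sector \<Rightarrow> real \<times> real \<Rightarrow> bool" where
  "in_sector ((a, b), (a', b')) (s, t) \<longleftrightarrow>
     a\<^sup>2 + b\<^sup>2 \<le> 40402 \<and> a'\<^sup>2 + b'\<^sup>2 \<le> 40402 \<and>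
     0 \<le> of_int b' * s - of_int a' * t \<and> 0 \<le> of_int a * t - of_int b * s"

definition far :: "nat list \<Rightarrow> (nat \<Rightarrow> real) \<Rightarrow> (nat \<Rightarrow> real) \<Rightarrow> bool" where
  "far r X Y \<longleftrightarrow> (\<forall>q. valid_quad q \<longrightarrow> (case arcs r X Y q of (s, t) \<Rightarrow> 40402 \<le> 502\<^sup>2 * (s\<^sup>2 + t\<^sup>2)))"

section \<open>Soundness of the certificates\<close>

lemma length_shift [simp]: "length (shift i j u cs) = length cs"
  by (simp add: shift_def)

lemma length_zeros [simp]: "length zeros = 6"
  by (simp add: zeros_def)

lemma val_shift:
  assumes "length cs = 6" "i < 6" "j < 6" "i \<noteq> j"
  shows "val X (shift i j u cs) + of_int (wrap i j u) = val X cs + of_int u * cyc_gap X i j"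
proof -
  have "val X (shift i j u cs) = (\<Sum>m<6. of_int (cs ! m) * (X m - X 0)
      + (if m = j then of_int u * (X m - X 0) else 0) - (if m = i then of_int u * (X m - X 0) else 0))"
    unfolding val_def using assms
    by (intro sum.cong) (auto simp: shift_def nth_list_update algebra_simps)
  also have "\<dots> = val X cs + of_int u * (X j - X 0) - of_int u * (X i - X 0)"
    using assms by (simp add: val_def sum.distrib sum_subtractf)
  finally show ?thesis by (simp add: cyc_gap_def wrap_def algebra_simps)
qed

lemma acc_valid_add_arcs:
  assumes "acc_valid X Y A" "i < 6" "j < 6" "i \<noteq> j" "k < 6" "l < 6" "k \<noteq> l"
    and "of_int w \<le> 502 * (of_int u * cyc_gap X i j + of_int v * cyc_gap Y k l)"
  shows "acc_valid X Y (add_arcs i j k l u v w A)"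
proof -
  obtain S T K D where A: "A = (S, T, K, D)" by (cases A) auto
  have "val X (shift i j u S) + of_int (wrap i j u) = val X S + of_int u * cyc_gap X i j"
    "val Y (shift k l v T) + of_int (wrap k l v) = val Y T + of_int v * cyc_gap Y k l"
    using assms A by (simp_all add: val_shift)
  with assms show ?thesis by (simp add: A add_arcs_def shift_def algebra_simps)
qed

text \<open>Cramer's rule: with \<open>w = (s, t)\<close> one has \<open>[e, e'] w = [w, e'] e + [e, w] e'\<close>, and
  comparing norms shows that \<open>w\<close> lies beyond the chord from \<open>e\<close> to \<open>e'\<close>.\<close>

lemma beyond_chord:
  fixes a b a' b' s t M N :: real
  assumes "a\<^sup>2 + b\<^sup>2 \<le> M" "a'\<^sup>2 + b'\<^sup>2 \<le> M" "0 < M" "0 < N" "M \<le> N\<^sup>2 * (s\<^sup>2 + t\<^sup>2)"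
    and "0 \<le> b' * s - a' * t" "0 \<le> a * t - b * s"
  shows "a * b' - a' * b \<le> N * ((b' * s - a' * t) + (a * t - b * s))"
proof -
  define D c c' where "D = a * b' - a' * b" "c = b' * s - a' * t" "c' = a * t - b * s"
  have eq: "D * s = c * a + c' * a'" "D * t = c * b + c' * b'"
    by (simp_all add: D_c_c'_def algebra_simps)
  have "2 * (a * a' + b * b') \<le> (a\<^sup>2 + b\<^sup>2) + (a'\<^sup>2 + b'\<^sup>2)"
    using zero_le_power2[of "a - a'"] zero_le_power2[of "b - b'"] by (simp add: power2_eq_square algebra_simps)
  with assms have inner: "a * a' + b * b' \<le> M" by simp
  have "D\<^sup>2 * (s\<^sup>2 + t\<^sup>2) = (D * s)\<^sup>2 + (D * t)\<^sup>2" by (simp add: power_mult_distrib algebra_simps)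
  also have "\<dots> = c\<^sup>2 * (a\<^sup>2 + b\<^sup>2) + c'\<^sup>2 * (a'\<^sup>2 + b'\<^sup>2) + 2 * (c * c') * (a * a' + b * b')"
    unfolding eq by (simp add: power2_eq_square algebra_simps)
  also have "\<dots> \<le> c\<^sup>2 * M + c'\<^sup>2 * M + 2 * (c * c') * M"
    using assms inner by (intro add_mono mult_left_mono) (simp_all add: D_c_c'_def)
  also have "\<dots> = M * (c + c')\<^sup>2" by (simp add: power2_eq_square algebra_simps)
  finally have *: "D\<^sup>2 * (s\<^sup>2 + t\<^sup>2) \<le> M * (c + c')\<^sup>2" .
  have "D\<^sup>2 * M \<le> D\<^sup>2 * (N\<^sup>2 * (s\<^sup>2 + t\<^sup>2))" using assms by (intro mult_left_mono) simp_all
  also have "\<dots> = N\<^sup>2 * (D\<^sup>2 * (s\<^sup>2 + t\<^sup>2))" by simp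
  also have "\<dots> \<le> N\<^sup>2 * (M * (c + c')\<^sup>2)" using * by (intro mult_left_mono) simp_all
  finally have "D\<^sup>2 * M \<le> (N * (c + c'))\<^sup>2 * M" by (simp only: power_mult_distrib mult_ac)
  with \<open>0 < M\<close> have "D\<^sup>2 \<le> (N * (c + c'))\<^sup>2" by simp
  moreover have "0 \<le> N * (c + c')" using assms by (simp add: D_c_c'_def)
  ultimately have "D \<le> N * (c + c')" by (rule power2_le_imp_le)
  then show ?thesis by (simp add: D_c_c'_def)
qed

text \<open>Splitting off the smaller of \<alpha> and \<beta> leaves a multiple of the chord
  inequality plus a nonnegative multiple of one of the two sector conditions. An entry of a leaf can
  thus express either kind of inequality; a zero weight yields a pure sector condition.\<close>

lemma sector_ineq:
  fixes s t :: real
  assumes "in_sector ((a, b), (a', b')) (s, t)" "40402 \<le> 502\<^sup>2 * (s\<^sup>2 + t\<^sup>2)" "0 \<le> \<alpha>" "0 \<le> \<beta>"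
  shows "of_int (min \<alpha> \<beta> * (a * b' - a' * b))
    \<le> 502 * (of_int (\<alpha> * b' - \<beta> * b) * s + of_int (\<beta> * a - \<alpha> * a') * t)"
proof -
  define c c' where "c = of_int b' * s - of_int a' * t" "c' = of_int a * t - of_int b * s"
  have "real_of_int (a\<^sup>2 + b\<^sup>2) \<le> of_int 40402" "real_of_int (a'\<^sup>2 + b'\<^sup>2) \<le> of_int 40402"
    using assms(1) by (simp_all only: in_sector.simps of_int_le_iff)
  then have "(of_int a)\<^sup>2 + (of_int b)\<^sup>2 \<le> (40402 :: real)" "(of_int a')\<^sup>2 + (of_int b')\<^sup>2 \<le> (40402 :: real)"
    by simp_all
  moreover have cc: "0 \<le> c" "0 \<le> c'" using assms(1) by (simp_all add: c_c'_def)
  ultimately have "of_int a * of_int b' - of_int a' * of_int b \<le> 502 * (c + c')"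
    using assms beyond_chord[of "of_int a" "of_int b" 40402 "of_int a'" "of_int b'" 502 s t]
    by (simp add: c_c'_def)
  then have "of_int (min \<alpha> \<beta>) * (of_int a * of_int b' - of_int a' * of_int b)
      \<le> of_int (min \<alpha> \<beta>) * (502 * (c + c'))"
    using assms by (intro mult_left_mono) simp_all
  also have "\<dots> = 502 * (of_int (min \<alpha> \<beta>) * c + of_int (min \<alpha> \<beta>) * c')"
    by (simp add: algebra_simps)
  also have "\<dots> \<le> 502 * (of_int \<alpha> * c + of_int \<beta> * c')"
    using cc by (intro mult_left_mono add_mono mult_right_mono) simp_all
  finally show ?thesis by (simp add: c_c'_def algebra_simps)
qed

text \<open>The bound \<open>lo\<close> is a parameter so that the induction can replace it by the
  first value of the sequence. Up to that value all z i rise together and the total coefficient sum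
  counts; beyond it only proper suffix sums do. The instance \<open>lo = 0\<close> is the bound
  described at \<open>peak\<close>.\<close>

lemma peak_bound:
  fixes z :: "nat \<Rightarrow> real" and lo :: real
  assumes "\<And>i. i < length cs \<Longrightarrow> lo \<le> z i" "\<And>i j. i \<le> j \<Longrightarrow> j < length cs \<Longrightarrow> z i \<le> z j"
    and "\<And>i. i < length cs \<Longrightarrow> z i \<le> 1" "lo \<le> 1"
  shows "(\<Sum>i<length cs. of_int (cs ! i) * z i)
    \<le> of_int (fst (peak cs)) * lo + of_int (snd (peak cs)) * (1 - lo)"
  using assms
proof (induction cs arbitrary: lo z)
  case (Cons c cs)
  obtain s m where sm: "peak cs = (s, m)" by fastforce
  define m' where "m' = real_of_int (max m (s + c))"
  have "(\<Sum>i<length cs. of_int (cs ! i) * z (Suc i))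
      \<le> of_int (fst (peak cs)) * z 0 + of_int (snd (peak cs)) * (1 - z 0)"
    using Cons.prems by (intro Cons.IH) auto
  then have "(\<Sum>i<length (c # cs). of_int ((c # cs) ! i) * z i)
      \<le> of_int c * z 0 + of_int s * z 0 + of_int m * (1 - z 0)"
    unfolding length_Cons sum.lessThan_Suc_shift by (simp add: sm add.assoc)
  also have "\<dots> = (of_int s + of_int c) * lo + (of_int s + of_int c) * (z 0 - lo) + of_int m * (1 - z 0)"
    by (simp add: algebra_simps)
  also have "\<dots> \<le> (of_int s + of_int c) * lo + m' * (z 0 - lo) + m' * (1 - z 0)"
  proof (rule add_mono[OF add_mono[OF order_refl mult_right_mono] mult_right_mono])
    show "of_int s + of_int c \<le> m'" "of_int m \<le> m'" by (simp_all add: m'_def)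
    show "0 \<le> z 0 - lo" "0 \<le> 1 - z 0" using Cons.prems(1)[of 0] Cons.prems(3)[of 0] by simp_all
  qed
  finally show ?case by (simp add: sm m'_def algebra_simps)
qed simp

lemma val_le_peak:
  assumes "cyc_sorted X" "length cs = 6"
  shows "val X cs \<le> of_int (snd (peak cs))"
proof -
  have "(\<Sum>i<length cs. of_int (cs ! i) * (X i - X 0))
    \<le> of_int (fst (peak cs)) * 0 + of_int (snd (peak cs)) * (1 - 0)"
  proof (rule peak_bound)
    fix i assume "i < length cs"
    then show "0 \<le> X i - X 0" "X i - X 0 \<le> 1"
      using cyc_sorted_mono[OF assms(1), of 0 i] cyc_sorted_mono[OF assms(1), of i 5] assms
      by (simp_all add: cyc_sorted_def)
  next
    fix i j assume "i \<le> j" "j < length cs"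
    then show "X i - X 0 \<le> X j - X 0"
      using cyc_sorted_mono[OF assms(1), of i j] assms(2) by simp
  qed simp
  then show ?thesis by (simp add: val_def assms(2))
qed

text \<open>Since \<open>201\<^sup>2 = 40401\<close>, the axis vectors are admissible with hardly
  any loss. The first chord states that the two coordinates of a joining vector add up to at least
  201/502.\<close>

definition quadrant :: "quad \<Rightarrow> sector" where
  "quadrant = (\<lambda>q. ((201, 0), (0, 201)))"

locale config =
  fixes r :: "nat list" and X Y :: "nat \<Rightarrow> real"
  assumes X: "cyc_sorted X" and Y: "cyc_sorted Y" and r: "length r = 6" "distinct r" "set r \<subseteq> {..<6}"
    and far: "far r X Y"
begin

definition state_valid :: "(quad \<Rightarrow> sector) \<Rightarrow> bool" where
  "state_valid \<sigma> \<longleftrightarrow> (\<forall>q. valid_quad q \<longrightarrow> in_sector (\<sigma> q) (arcs r X Y q))"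

lemma rank: "i < 6 \<Longrightarrow> r ! i < 6" "i < 6 \<Longrightarrow> j < 6 \<Longrightarrow> i \<noteq> j \<Longrightarrow> r ! i \<noteq> r ! j"
  using r by (metis nth_mem subsetD lessThan_iff, simp add: nth_eq_iff_index_eq)

lemma acc_valid_add_entry:
  assumes "state_valid \<sigma>" "acc_valid X Y A" "valid_quad q" "0 \<le> \<alpha>" "0 \<le> \<beta>"
  shows "acc_valid X Y (add_entry r \<sigma> (q, \<alpha>, \<beta>) A)"
proof -
  obtain a b a' b' where \<sigma>: "\<sigma> q = ((a, b), (a', b'))" by (metis prod.exhaust)
  obtain s t where st: "arcs r X Y q = (s, t)" by fastforce
  have ineq: "of_int (min \<alpha> \<beta> * (a * b' - a' * b))
    \<le> 502 * (of_int (\<alpha> * b' - \<beta> * b) * s + of_int (\<beta> * a - \<alpha> * a') * t)"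
  proof (rule sector_ineq)
    show "in_sector ((a, b), (a', b')) (s, t)" using assms \<sigma> st by (force simp: state_valid_def)
    show "40402 \<le> 502\<^sup>2 * (s\<^sup>2 + t\<^sup>2)" using far assms(3) st by (force simp: far_def)
  qed (use assms in simp_all)
  show ?thesis
  proof (cases q)
    case (Up i j)
    with ineq st assms rank \<sigma> show ?thesis
      by (auto simp: add_entry_def simp del: acc_valid.simps intro!: acc_valid_add_arcs)
  next
    case (Dn i j)
    with ineq st assms rank \<sigma> show ?thesis
      by (auto simp: add_entry_def simp del: acc_valid.simps intro!: acc_valid_add_arcs)
  qed
qed

lemma refutes_sound:
  assumes "state_valid \<sigma>" "acc_valid X Y A" "refutes r \<sigma> es A"
  shows False
proof -
  have "acc_valid X Y (fold (add_entry r \<sigma>) es A)"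
    if "list_all (\<lambda>(q, \<alpha>, \<beta>). valid_quad q \<and> 0 \<le> \<alpha> \<and> 0 \<le> \<beta>) es" "acc_valid X Y A" for A
    using that
  proof (induction es arbitrary: A)
    case (Cons e es)
    obtain q \<alpha> \<beta> where "e = (q, \<alpha>, \<beta>)" by (cases e)
    with Cons acc_valid_add_entry[OF assms(1)] show ?case by simp
  qed simp
  with assms have "acc_valid X Y (fold (add_entry r \<sigma>) es A)" and
    ab: "absurd_acc (fold (add_entry r \<sigma>) es A)"
    by (simp_all add: refutes_def)
  moreover obtain S T K D where STKD: "fold (add_entry r \<sigma>) es A = (S, T, K, D)"
    by (metis prod.exhaust)
  ultimately have v: "length S = 6" "length T = 6" "of_int D \<le> 502 * (val X S + val Y T + of_int K)"
    by simp_all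
  from ab have "real_of_int (502 * (K + snd (peak S) + snd (peak T))) < of_int D"
    by (simp only: STKD absurd_acc_def prod.case of_int_less_iff)
  with v val_le_peak[OF X v(1)] val_le_peak[OF Y v(2)] show False by simp
qed

lemma acc_valid_coord:
  assumes "k < 10" "of_int w \<le> 502 * (of_int u * coord X Y k)"
  shows "acc_valid X Y (coord_acc k u w)"
proof -
  have zero: "val Z zeros = 0" for Z
    unfolding val_def by (intro sum.neutral) (auto simp: zeros_def nth_Cons split: nat.splits)
  have "val Z (shift 0 i u zeros) = of_int u * (Z i - Z 0)" if "0 < i" "i < 6" for Z i
    using val_shift[of zeros 0 i Z u] that zero by (simp add: zeros_def wrap_def cyc_gap_def)
  from this[of "Suc k" X] this[of "k - 4" Y] zero assms show ?thesis
    by (auto simp: coord_acc_def coord_def)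
qed

lemma confined_sound:
  assumes "state_valid \<sigma>" "confined r \<sigma> k xs" "length xs + k \<le> 10" "i < length xs"
  shows "\<bar>502 * coord X Y (k + i) - of_int (fst (xs ! i))\<bar> \<le> 3"
  using assms(2-)
proof (induction xs arbitrary: k i)
  case (Cons x xs)
  obtain c \<mu> es \<nu> fs where x: "x = (c, (\<mu>, es), (\<nu>, fs))" by (metis prod.exhaust)
  show ?case
  proof (cases i)
    case 0
    have "\<bar>502 * coord X Y k - of_int c\<bar> \<le> 3"
    proof (rule ccontr)
      assume "\<not> ?thesis"
      then consider "of_int (c + 3) \<le> 502 * coord X Y k" | "of_int (3 - c) \<le> - 502 * coord X Y k"
        by force
      then show False
      proof cases
        case 1
        then have "of_int \<mu> * of_int (c + 3) \<le> of_int \<mu> * (502 * coord X Y k)"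
          using Cons.prems(1) by (intro mult_left_mono) (simp_all add: x)
        then have v: "acc_valid X Y (coord_acc k \<mu> (\<mu> * (c + 3)))"
          using Cons.prems(2) by (intro acc_valid_coord) (simp_all add: algebra_simps)
        show False using refutes_sound[OF assms(1) v] Cons.prems(1)[unfolded x confined.simps] by blast
      next
        case 2
        then have "of_int \<nu> * of_int (3 - c) \<le> of_int \<nu> * (- 502 * coord X Y k)"
          using Cons.prems(1) by (intro mult_left_mono) (simp_all add: x)
        then have v: "acc_valid X Y (coord_acc k (- \<nu>) (\<nu> * (3 - c)))"
          using Cons.prems(2) by (intro acc_valid_coord) (simp_all add: algebra_simps)
        show False using refutes_sound[OF assms(1) v] Cons.prems(1)[unfolded x confined.simps] by blast
      qed
    qed
    then show ?thesis by (simp add: 0 x)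
  next
    case (Suc i')
    with Cons.IH[of "Suc k" i'] Cons.prems show ?thesis by (simp add: x)
  qed
qed simp

lemma state_valid_update:
  assumes "state_valid \<sigma>" "valid_quad q \<Longrightarrow> in_sector s (arcs r X Y q)"
  shows "state_valid (\<sigma>(q := s))"
  using assms by (simp add: state_valid_def)

text \<open>The joining vector lies on one side of the cutting ray, and each half of the sector
  inherits its outer ray, so validity passes to one of the two subtrees. Following valid states
  downwards cannot end in an \<open>End\<close> leaf, hence it ends in a box.\<close>

lemma proves_sound:
  assumes "state_valid \<sigma>" "proves r \<sigma> t"
  shows "\<exists>cs\<in>set (hits t). near X Y cs"
  using assms
proof (induction t arbitrary: \<sigma>)
  case (End es)
  have "acc_valid X Y (zeros, zeros, 0, 0)"
    using acc_valid_coord[of 0 0 0] by (simp add: coord_acc_def zeros_def shift_def)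
  with End refutes_sound show ?case by (metis proves.simps(1))
next
  case (Cut e s t)
  obtain q a b where [simp]: "e = (q, a, b)" by (cases e)
  obtain c d c' d' where \<sigma>: "\<sigma> q = ((c, d), (c', d'))" by (metis prod.exhaust)
  obtain u v where uv: "arcs r X Y q = (u, v)" by fastforce
  have "in_sector ((c, d), (c', d')) (u, v)" if "valid_quad q"
    using Cut.prems(1) that \<sigma> uv by (force simp: state_valid_def)
  \<comment> \<open>For indices out of range the sector condition is vacuous, so both alternatives
    are stated as implications.\<close>
  then have "(valid_quad q \<longrightarrow> in_sector ((c, d), (a, b)) (u, v)) \<or>
      (valid_quad q \<longrightarrow> in_sector ((a, b), (c', d')) (u, v))"
    using Cut.prems(2) linear[of "real_of_int b * u" "real_of_int a * v"] by auto
  then show ?case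
  proof
    assume "valid_quad q \<longrightarrow> in_sector ((c, d), (a, b)) (u, v)"
    then have "state_valid (\<sigma>(q := (fst (\<sigma> q), (a, b))))"
      by (intro state_valid_update Cut.prems) (simp add: \<sigma> uv)
    with Cut.IH(1) Cut.prems(2) show ?thesis by fastforce
  next
    assume "valid_quad q \<longrightarrow> in_sector ((a, b), (c', d')) (u, v)"
    then have "state_valid (\<sigma>(q := ((a, b), snd (\<sigma> q))))"
      by (intro state_valid_update Cut.prems) (simp add: \<sigma> uv)
    with Cut.IH(2) Cut.prems(2) show ?thesis by fastforce
  qed
next
  case (Near xs)
  with confined_sound[of \<sigma> 0 xs] show ?case by (simp add: near_def)
qed

lemma state_valid_quadrant: "state_valid quadrant"
  unfolding state_valid_def
proof (intro allI impI)
  fix q assume "valid_quad q"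
  with cyc_gap_nonneg[OF X] cyc_gap_nonneg[OF Y] rank show "in_sector (quadrant q) (arcs r X Y q)"
    by (cases q) (simp_all add: quadrant_def)
qed

end

section \<open>Reduction to ten permutations\<close>

abbreviation ranking :: "nat list \<Rightarrow> bool" where
  "ranking r \<equiv> distinct r \<and> set r = {..<6}"

lemma length_ranking: "ranking r \<Longrightarrow> length r = 6"
  using distinct_card[of r] by simp

text \<open>Quantification over all pairs of sorted sequences makes this a property of the ranking
  alone, on which the symmetries of the torus act combinatorially.\<close>

definition settled :: "nat list \<Rightarrow> bool" where
  "settled r \<longleftrightarrow> (\<forall>X Y. cyc_sorted X \<longrightarrow> cyc_sorted Y \<longrightarrow> packing (pts X (\<lambda>i. Y (r ! i))) \<longrightarrow>
     optimal (pts X (\<lambda>i. Y (r ! i))))"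

text \<open>Being a packing and being optimal are invariant under isometry. It is therefore enough
  to rewrite every configuration ordered by r, up to isometry, as one ordered by r'.\<close>

lemma settled_move:
  assumes "settled r'"
    and "\<And>X Y. cyc_sorted X \<Longrightarrow> cyc_sorted Y \<Longrightarrow> \<exists>X' Y'. cyc_sorted X' \<and> cyc_sorted Y' \<and>
      isometric (pts X (\<lambda>i. Y (r ! i))) (pts X' (\<lambda>i. Y' (r' ! i)))"
  shows "settled r"
  unfolding settled_def
proof (intro allI impI)
  fix X Y assume XY: "cyc_sorted X" "cyc_sorted Y" and P: "packing (pts X (\<lambda>i. Y (r ! i)))"
  from assms(2)[OF XY] obtain X' Y' where X'Y': "cyc_sorted X'" "cyc_sorted Y'"
    and C: "isometric (pts X (\<lambda>i. Y (r ! i))) (pts X' (\<lambda>i. Y' (r' ! i)))" by blast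
  with assms(1) packing_isometric[OF C P] have "optimal (pts X' (\<lambda>i. Y' (r' ! i)))"
    by (simp add: settled_def)
  then show "optimal (pts X (\<lambda>i. Y (r ! i)))"
    using C isometric_trans isometric_sym by blast
qed

lemma isometric_refl: "isometric S S"
  by (auto simp: isometric_def isometry_def intro!: exI[of _ id])

lemma Suc_mod_image: "(\<lambda>i. Suc i mod 6) ` {..<6} = {..<6}"
  by code_simp

text \<open>The horizontal circle is cut open one point later: the first point is lifted by 1 and
  becomes the last, while the set of torus points stays the same.\<close>

lemma settled_rotate1:
  assumes "length r = 6" "settled (rotate1 r)"
  shows "settled r"
proof (rule settled_move[OF assms(2)])
  fix X Y assume XY: "cyc_sorted X" "cyc_sorted Y"
  define X' where "X' i = (if i < 5 then X (Suc i) else X 0 + 1)" for i :: nat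
  have "cyc_sorted X'" using XY(1) by (simp add: cyc_sorted_def X'_def numeral_eq_Suc)
  moreover have "pts X' (\<lambda>i. Y (rotate1 r ! i)) = pts X (\<lambda>i. Y (r ! i))"
  proof (rule pts_reindex[OF Suc_mod_image])
    fix i :: nat assume i: "i < 6"
    then show "X' i - X (Suc i mod 6) \<in> \<int>" by (cases "i = 5") (simp_all add: X'_def)
    show "Y (rotate1 r ! i) - Y (r ! (Suc i mod 6)) \<in> \<int>" using i assms(1) by (simp add: nth_rotate1)
  qed
  ultimately show "\<exists>X' Y'. cyc_sorted X' \<and> cyc_sorted Y' \<and>
      isometric (pts X (\<lambda>i. Y (r ! i))) (pts X' (\<lambda>i. Y' (rotate1 r ! i)))"
    using XY(2) isometric_refl by metis
qed

lemma settled_rotate: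
  assumes "length r = 6" "settled (rotate n r)"
  shows "settled r"
  using assms
proof (induction n)
  case (Suc n)
  then have "settled (rotate n r)" using settled_rotate1[of "rotate n r"] by simp
  with Suc show ?case by simp
qed simp

lemma settled_rev:
  assumes "length r = 6" "settled (rev r)"
  shows "settled r"
proof (rule settled_move[OF assms(2)])
  fix X Y assume XY: "cyc_sorted X" "cyc_sorted Y"
  define X' where "X' i = - X (5 - i)" for i :: nat
  have "cyc_sorted X'" using XY(1) by (simp add: cyc_sorted_def X'_def)
  moreover have "pts X' (\<lambda>i. Y (rev r ! i)) = pts (\<lambda>i. - X i) (\<lambda>i. Y (r ! i))"
  proof (rule pts_reindex)
    show "(\<lambda>i. 5 - i) ` {..<6} = {..<6 :: nat}" by code_simp
  qed (use assms(1) in \<open>simp_all add: X'_def rev_nth\<close>)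
  ultimately show "\<exists>X' Y'. cyc_sorted X' \<and> cyc_sorted Y' \<and>
      isometric (pts X (\<lambda>i. Y (r ! i))) (pts X' (\<lambda>i. Y' (rev r ! i)))"
    using XY(2) isometric_reflect by metis
qed

definition inverse_ranking :: "nat list \<Rightarrow> nat list" where
  "inverse_ranking r = map (\<lambda>k. length (takeWhile (\<lambda>l. l \<noteq> k) r)) [0..<6]"

lemma inverse_ranking_nth:
  assumes "ranking r" "k < 6"
  shows "inverse_ranking r ! k < 6" "r ! (inverse_ranking r ! k) = k"
proof -
  have "length (takeWhile (\<lambda>l. l \<noteq> k) xs) < length xs" if "k \<in> set xs" for xs
    using that by (induction xs) auto
  then have l: "length (takeWhile (\<lambda>l. l \<noteq> k) r) < length r"
    using assms by simp
  then show "inverse_ranking r ! k < 6" "r ! (inverse_ranking r ! k) = k"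
    using assms length_ranking nth_length_takeWhile[OF l] by (simp_all add: inverse_ranking_def)
qed

lemma ranking_inverse:
  assumes "ranking r"
  shows "ranking (inverse_ranking r)"
proof -
  have "distinct (inverse_ranking r)"
    unfolding distinct_conv_nth using inverse_ranking_nth(2)[OF assms]
    by (simp add: inverse_ranking_def) metis
  moreover have "set (inverse_ranking r) \<subseteq> {..<6}"
    using inverse_ranking_nth(1)[OF assms] by (auto simp: in_set_conv_nth inverse_ranking_def)
  moreover have "card (set (inverse_ranking r)) = card {..<6 :: nat}"
    using distinct_card[OF calculation(1)] by (simp add: inverse_ranking_def)
  ultimately show ?thesis by (simp add: card_subset_eq)
qed

text \<open>Exchanging the axes turns a ranking into its inverse permutation.\<close>

lemma settled_inverse:
  assumes "ranking r" "settled (inverse_ranking r)"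
  shows "settled r"
proof (rule settled_move[OF assms(2)])
  fix X Y assume XY: "cyc_sorted X" "cyc_sorted Y"
  have "pts Y (\<lambda>k. X (inverse_ranking r ! k)) = pts (\<lambda>i. Y (r ! i)) X"
  proof (rule pts_reindex)
    show "(\<lambda>k. inverse_ranking r ! k) ` {..<6} = {..<6}"
      using ranking_inverse[OF assms(1)] length_ranking[OF ranking_inverse[OF assms(1)]]
      by (auto simp: set_conv_nth image_iff)
  qed (use inverse_ranking_nth[OF assms(1)] in simp_all)
  then show "\<exists>X' Y'. cyc_sorted X' \<and> cyc_sorted Y' \<and>
      isometric (pts X (\<lambda>i. Y (r ! i))) (pts X' (\<lambda>i. Y' (inverse_ranking r ! i)))"
    using XY isometric_swap by metis
qed

text \<open>The ranking \<open>r ! i - r ! 0\<close> modulo 6: rotating the inverse moves the origin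
  of the vertical circle, here to the height of the first point.\<close>

definition normal_ranking :: "nat list \<Rightarrow> nat list" where
  "normal_ranking r = inverse_ranking (rotate (hd r) (inverse_ranking r))"

lemma settled_normal:
  assumes "ranking r" "settled (normal_ranking r)"
  shows "settled r"
proof -
  let ?s = "inverse_ranking r"
  have "ranking ?s" by (rule ranking_inverse[OF assms(1)])
  with assms(2) show ?thesis
    unfolding normal_ranking_def
    by (metis settled_inverse settled_rotate distinct_rotate set_rotate length_ranking assms(1))
qed

text \<open>Unlike \<open>list_ex\<close>, evaluation by rewriting stops at the first witness.\<close>

primrec any :: "('a \<Rightarrow> bool) \<Rightarrow> 'a list \<Rightarrow> bool" where
  "any P [] = False"
| "any P (x # xs) = (if P x then True else any P xs)"

lemma any_iff: "any P xs \<longleftrightarrow> (\<exists>x\<in>set xs. P x)"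
  by (induction xs) auto

text \<open>Conjugating \<open>rev\<close> by inversion gives \<open>5 - s ! i\<close>, the
  reflection of the vertical axis, so the list holds all combinations of the two reflections. With
  the exchange of the axes, six rotations of one axis and \<open>normal_ranking\<close> for the
  other, all 4 * 2 * 6 * 6 = 288 symmetries acting on rankings are accounted for.\<close>

definition reflections :: "nat list \<Rightarrow> nat list list" where
  "reflections s = (let t = inverse_ranking (rev (inverse_ranking s)) in [s, rev s, t, rev t])"

lemma variant:
  assumes "ranking r" "u \<in> {r, inverse_ranking r}" "s \<in> set (reflections (rotate n u))"
  shows "ranking s" "settled s \<Longrightarrow> settled r"
proof -
  define good where "good s \<longleftrightarrow> ranking s \<and> (settled s \<longrightarrow> settled r)" for s
  have base: "good r" using assms(1) by (simp add: good_def)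
  have rev: "good (rev s)" if "good s" for s
    using that settled_rev[of s] length_ranking[of s] by (simp add: good_def)
  have inv: "good (inverse_ranking s)" if "good s" for s
    using that settled_inverse[of s] ranking_inverse[of s] by (simp add: good_def)
  have rot: "good (rotate n s)" if "good s" for n s
    using that settled_rotate[of s n] length_ranking[of s] by (simp add: good_def)
  have s: "s \<in> {rotate n u, rev (rotate n u), inverse_ranking (rev (inverse_ranking (rotate n u))),
      rev (inverse_ranking (rev (inverse_ranking (rotate n u))))}"
    using assms(3) by (simp add: reflections_def Let_def)
  have "good u" using assms(2) base inv by blast
  with s have "good s" using rev inv rot by blast
  then show "ranking s" "settled s \<Longrightarrow> settled r" by (auto simp: good_def)
qed

lemma hd_normal_ranking:
  assumes "ranking r"
  shows "hd (normal_ranking r) = 0"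
proof -
  let ?s = "inverse_ranking r"
  have s: "ranking ?s" by (rule ranking_inverse[OF assms])
  have r: "r ! 0 < 6" using nth_mem[of 0 r] assms length_ranking[OF assms] by auto
  then have "r ! (?s ! (r ! 0)) = r ! 0" "?s ! (r ! 0) < 6" using inverse_ranking_nth[OF assms] by simp_all
  then have "?s ! (r ! 0) = 0" using assms length_ranking[OF assms] by (simp add: nth_eq_iff_index_eq)
  moreover have "hd r = r ! 0" "?s \<noteq> []" using length_ranking[OF assms] length_ranking[OF s]
    by (cases r; force)+
  ultimately have "hd (rotate (hd r) ?s) = 0"
    using r length_ranking[OF s] by (simp add: hd_rotate_conv_nth)
  moreover obtain x xs where "rotate (hd r) ?s = x # xs"
    using length_ranking[OF s] by (cases "rotate (hd r) ?s") auto
  ultimately show ?thesis by (simp add: normal_ranking_def inverse_ranking_def hd_map upt_rec[of 0 6])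
qed

lemma ranking_normal: "ranking r \<Longrightarrow> ranking (normal_ranking r)"
  unfolding normal_ranking_def by (metis ranking_inverse distinct_rotate set_rotate)

definition representatives :: "nat list list" where
  "representatives = [[0, 1, 2, 3, 4, 5], [0, 1, 2, 3, 5, 4], [0, 1, 2, 4, 5, 3], [0, 1, 2, 5, 4, 3],
     [0, 1, 3, 2, 5, 4], [0, 1, 3, 5, 4, 2], [0, 1, 5, 3, 4, 2], [0, 1, 3, 5, 2, 4], [0, 1, 4, 5, 2, 3],
     [0, 2, 4, 1, 5, 3]]"

definition covered :: "nat list \<Rightarrow> bool" where
  "covered r \<longleftrightarrow> any (\<lambda>u. any (\<lambda>n. any (\<lambda>s. normal_ranking s \<in> set representatives)
     (reflections (rotate n u))) [0..<6]) [r, inverse_ranking r]"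

text \<open>The conditionals discard repeated entries before \<open>covered\<close> is evaluated, so
  that exactly the 120 rankings beginning with 0 are tested. Those suffice because a normalised
  ranking begins with 0.\<close>

lemma all_covered:
  "list_all (\<lambda>a. list_all (\<lambda>b. if b = a then True else list_all (\<lambda>c. if c = a \<or> c = b then True else
     list_all (\<lambda>d. if d = a \<or> d = b \<or> d = c then True else
       list_all (\<lambda>e. if e = a \<or> e = b \<or> e = c \<or> e = d then True else covered [0, a, b, c, d, e])
     [1..<6]) [1..<6]) [1..<6]) [1..<6]) [1..<6]"
  by code_simp

lemma settled_all:
  assumes reps: "\<And>s. s \<in> set representatives \<Longrightarrow> settled s" and "ranking r"
  shows "settled r"
proof -
  have zero: "settled s" if s: "ranking s" "hd s = 0" for s
  proof -
    from length_ranking[OF s(1)] s(2) obtain a b c d e where abcde: "s = [0, a, b, c, d, e]"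
      by (auto simp: numeral_eq_Suc length_Suc_conv)
    have "set s \<subseteq> {..<6}" "distinct s" using s(1) by simp_all
    then have mem: "a \<in> set [1..<6]" "b \<in> set [1..<6]" "c \<in> set [1..<6]" "d \<in> set [1..<6]" "e \<in> set [1..<6]"
      and ne: "b \<noteq> a" "\<not> (c = a \<or> c = b)" "\<not> (d = a \<or> d = b \<or> d = c)" "\<not> (e = a \<or> e = b \<or> e = c \<or> e = d)"
      by (auto simp: abcde)
    have "covered s" unfolding abcde
      using all_covered[unfolded list_all_iff, THEN bspec, OF mem(1), THEN bspec, OF mem(2), unfolded if_not_P[OF ne(1)],
        THEN bspec, OF mem(3), unfolded if_not_P[OF ne(2)], THEN bspec, OF mem(4), unfolded if_not_P[OF ne(3)],
        THEN bspec, OF mem(5), unfolded if_not_P[OF ne(4)]] .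
    then obtain u n t where t: "u \<in> {s, inverse_ranking s}" "t \<in> set (reflections (rotate n u))"
      "normal_ranking t \<in> set representatives"
      unfolding covered_def any_iff by auto
    note variant[OF s(1) t(1,2)]
    with settled_normal[of t] reps[OF t(3)] show ?thesis by blast
  qed
  show ?thesis
    using settled_normal[OF assms(2)] zero ranking_normal[OF assms(2)] hd_normal_ranking[OF assms(2)] by blast
qed

section \<open>Boxes around the optimal configuration\<close>

lemma far_if_packing:
  assumes "packing (pts X (\<lambda>i. Y (r ! i)))"
  shows "far r X Y"
  unfolding far_def
proof (intro allI impI)
  have "0.40040554\<^sup>2 \<le> opt_dist\<^sup>2" using opt_dist_bounds by (intro power_mono) simp_all
  then have opt: "40402 \<le> 502\<^sup>2 * opt_dist\<^sup>2" by (simp add: power2_eq_square)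
  fix q assume q: "valid_quad q"
  have cyc_gap: "\<exists>m. cyc_gap Z i j = Z j - Z i + real_of_int m" for Z i j
    by (auto simp: cyc_gap_def intro: exI[of _ 0] exI[of _ 1])
  have *: "40402 \<le> 502\<^sup>2 * ((cyc_gap X i j)\<^sup>2 + t\<^sup>2)"
    if ij: "i < 6" "j < 6" "i \<noteq> j" and t: "t = cyc_gap Y (r ! i) (r ! j) \<or> t = cyc_gap Y (r ! j) (r ! i)" for i j t
  proof -
    obtain m where m: "cyc_gap X i j = X j - X i + real_of_int m" using cyc_gap by blast
    obtain n where n: "t\<^sup>2 = (Y (r ! j) - Y (r ! i) + real_of_int n)\<^sup>2"
    proof -
      from t obtain n where "t = Y (r ! j) - Y (r ! i) + of_int n \<or> t = Y (r ! i) - Y (r ! j) + of_int n"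
        using cyc_gap by metis
      then have "t = Y (r ! j) - Y (r ! i) + of_int n \<or> t = - (Y (r ! j) - Y (r ! i) + of_int (- n))"
        by auto
      then show ?thesis using that by (metis power2_minus)
    qed
    have "opt_dist\<^sup>2 \<le> (cyc_gap X i j)\<^sup>2 + t\<^sup>2"
      unfolding m n using assms ij unfolding packing_pts_iff by metis
    then show ?thesis using opt by simp
  qed
  show "case arcs r X Y q of (s, t) \<Rightarrow> 40402 \<le> 502\<^sup>2 * (s\<^sup>2 + t\<^sup>2)"
    using q * by (cases q) simp_all
qed

lemma settled_if_proved:
  assumes "ranking r" "proves r quadrant t"
    and "\<And>X Y cs. cs \<in> set (hits t) \<Longrightarrow> near X Y cs \<Longrightarrow> packing (pts X (\<lambda>i. Y (r ! i))) \<Longrightarrow>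
      optimal (pts X (\<lambda>i. Y (r ! i)))"
  shows "settled r"
  unfolding settled_def
proof (intro allI impI)
  fix X Y assume XY: "cyc_sorted X" "cyc_sorted Y" and P: "packing (pts X (\<lambda>i. Y (r ! i)))"
  interpret config r X Y
    using XY assms(1) length_ranking far_if_packing[OF P] by unfold_locales simp_all
  from proves_sound[OF state_valid_quadrant assms(2)] assms(3) P
  show "optimal (pts X (\<lambda>i. Y (r ! i)))" by blast
qed

text \<open>\<open>p\<close> assigns to each point of the optimal configuration its index in the
  sorted sequence, \<open>m\<close> and \<open>n\<close> choose the lift, and (a, b) is the
  translation. With these data a box becomes an instance of \<open>rigidity\<close>.\<close>

lemma near_optimal:
  assumes "packing (pts x y)" "ranking p"
    and "\<And>k. k < 6 \<Longrightarrow> \<bar>x (p ! k) + of_int (m ! k) - a - opt_x k\<bar> \<le> 7 / 1000"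
    and "\<And>k. k < 6 \<Longrightarrow> \<bar>y (p ! k) + of_int (n ! k) - b - opt_y k\<bar> \<le> 7 / 1000"
  shows "optimal (pts x y)"
proof -
  have eq: "pts (\<lambda>k. x (p ! k) + of_int (m ! k)) (\<lambda>k. y (p ! k) + of_int (n ! k)) = pts x y"
  proof (rule pts_reindex)
    show "(\<lambda>k. p ! k) ` {..<6} = {..<6}"
      using assms(2) length_ranking[OF assms(2)] by (auto simp: set_conv_nth image_iff)
  qed simp_all
  have "optimal (pts (\<lambda>k. x (p ! k) + of_int (m ! k)) (\<lambda>k. y (p ! k) + of_int (n ! k)))"
    by (rule rigidity[of _ _ a b]) (simp_all only: eq assms)
  then show ?thesis by (simp only: eq)
qed

text \<open>Centres are relative to point 0, whose own centre is the prepended 0. The first five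
  entries of \<open>cs\<close> belong to X, the last five to Y.\<close>

lemma near_position:
  assumes "near X Y cs" "length cs = 10" "i < 6"
  shows "\<bar>X i - X 0 - of_int ((0 # cs) ! i) / 502\<bar> \<le> 3 / 502"
    "\<bar>Y i - Y 0 - of_int ((0 # drop 5 cs) ! i) / 502\<bar> \<le> 3 / 502"
proof -
  have "\<bar>X i - X 0 - of_int ((0 # cs) ! i) / 502\<bar> \<le> 3 / 502 \<and>
    \<bar>Y i - Y 0 - of_int ((0 # drop 5 cs) ! i) / 502\<bar> \<le> 3 / 502"
  proof (cases i)
    case (Suc k)
    have "\<bar>502 * coord X Y k - of_int (cs ! k)\<bar> \<le> 3" "\<bar>502 * coord X Y (5 + k) - of_int (cs ! (5 + k))\<bar> \<le> 3"
      using assms Suc by (simp_all add: near_def)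
    then have "\<bar>502 * (X i - X 0) - of_int (cs ! k)\<bar> \<le> 3" "\<bar>502 * (Y i - Y 0) - of_int (cs ! (5 + k))\<bar> \<le> 3"
      using assms(3) Suc by (simp_all add: coord_def)
    then show ?thesis using assms Suc by (simp add: abs_le_iff field_simps)
  qed simp
  then show "\<bar>X i - X 0 - of_int ((0 # cs) ! i) / 502\<bar> \<le> 3 / 502"
    "\<bar>Y i - Y 0 - of_int ((0 # drop 5 cs) ! i) / 502\<bar> \<le> 3 / 502" by simp_all
qed

text \<open>3/502 is the half width of a box, and 1/1000 allows for rounding its centre to the grid
  of spacing 1/502. The sum stays below the 7/1000 that \<open>rigidity\<close> tolerates.\<close>

lemma combine_tolerance:
  fixes z z0 c m \<alpha> t :: real
  assumes "\<bar>z - z0 - c\<bar> \<le> 3 / 502" "\<bar>c + m - \<alpha> - t\<bar> \<le> 1 / 1000"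
  shows "\<bar>z + m - (z0 + \<alpha>) - t\<bar> \<le> 7 / 1000"
  using assms by linarith

lemma near_straight:
  assumes "near X Y cs" "length cs = 10" "ranking p" "ranking r" "packing (pts X (\<lambda>i. Y (r ! i)))"
    and "\<And>k. k < 6 \<Longrightarrow> \<bar>of_int ((0 # cs) ! (p ! k)) / 502 + of_int (m ! k) - \<alpha> - opt_x k\<bar> \<le> 1 / 1000"
    and "\<And>k. k < 6 \<Longrightarrow> \<bar>of_int ((0 # drop 5 cs) ! (r ! (p ! k))) / 502 + of_int (n ! k) - \<beta> - opt_y k\<bar> \<le> 1 / 1000"
  shows "optimal (pts X (\<lambda>i. Y (r ! i)))"
proof (rule near_optimal[OF assms(5,3)])
  fix k :: nat assume k: "k < 6"
  have "p ! k < 6" using assms(3) k length_ranking nth_mem[of k p] by auto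
  moreover from this have "r ! (p ! k) < 6" using assms(4) length_ranking nth_mem[of "p ! k" r] by auto
  ultimately show "\<bar>X (p ! k) + of_int (m ! k) - (X 0 + \<alpha>) - opt_x k\<bar> \<le> 7 / 1000"
    "\<bar>Y (r ! (p ! k)) + of_int (n ! k) - (Y 0 + \<beta>) - opt_y k\<bar> \<le> 7 / 1000"
    using near_position[OF assms(1,2)] assms(6,7)[OF k] combine_tolerance by blast+
qed

lemma near_transposed:
  assumes "near X Y cs" "length cs = 10" "ranking p" "ranking r" "packing (pts X (\<lambda>i. Y (r ! i)))"
    and "\<And>k. k < 6 \<Longrightarrow> \<bar>of_int ((0 # drop 5 cs) ! (r ! (p ! k))) / 502 + of_int (m ! k) - \<alpha> - opt_x k\<bar> \<le> 1 / 1000"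
    and "\<And>k. k < 6 \<Longrightarrow> \<bar>of_int ((0 # cs) ! (p ! k)) / 502 + of_int (n ! k) - \<beta> - opt_y k\<bar> \<le> 1 / 1000"
  shows "optimal (pts X (\<lambda>i. Y (r ! i)))"
proof -
  have "optimal (pts (\<lambda>i. Y (r ! i)) X)"
  proof (rule near_optimal[OF packing_isometric[OF isometric_swap assms(5)] assms(3)])
    fix k :: nat assume k: "k < 6"
    have "p ! k < 6" using assms(3) k length_ranking nth_mem[of k p] by auto
    moreover from this have "r ! (p ! k) < 6" using assms(4) length_ranking nth_mem[of "p ! k" r] by auto
    ultimately show "\<bar>Y (r ! (p ! k)) + of_int (m ! k) - (Y 0 + \<alpha>) - opt_x k\<bar> \<le> 7 / 1000"
      "\<bar>X (p ! k) + of_int (n ! k) - (X 0 + \<beta>) - opt_y k\<bar> \<le> 7 / 1000"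
      using near_position[OF assms(1,2)] assms(6,7)[OF k] combine_tolerance by blast+
  qed
  then show ?thesis using isometric_swap isometric_trans by blast
qed

lemma less_6_cases:
  assumes "k < 6" "P 0" "P 1" "P 2" "P 3" "P 4" "P 5"
  shows "P (k :: nat)"
proof -
  from assms(1) have "k \<in> {0, 1, 2, 3, 4, 5}" by auto
  with assms(2-) show ?thesis by (elim insertE emptyE) (simp_all only:)
qed

lemmas near_simps = lessThan_nat_numeral lessThan_Suc abs_le_iff field_simps

text \<open>The optimal points 1, 2 and 4, 5 have equal heights; here these pairs appear as the
  horizontal ties 0, 502 and 195, 195, so the axes are exchanged. The pair (\<alpha>, \<beta>) is
  the approximate position of the optimal point 0 relative to the first sorted point, after the
  exchange.\<close>

lemma optimal_near_013524:
  assumes "near X Y [195, 195, 328, 369, 502, 50, 150, 251, 301, 401]"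
    "packing (pts X (\<lambda>i. Y ([0, 1, 3, 5, 2, 4] ! i)))"
  shows "optimal (pts X (\<lambda>i. Y ([0, 1, 3, 5, 2, 4] ! i)))"
  by (rule near_transposed[where p = "[3, 0, 5, 4, 1, 2]" and m = "[0, 1, 1, 1, 1, 1]" and n = "[0, 1, 0, 0, 1, 1]"
        and \<alpha> = "7993 / 10000" and \<beta> = "6536 / 10000", OF assms(1) _ _ _ assms(2)];
      (elim less_6_cases)?; use opt_bounds in \<open>force simp: near_simps\<close>)

text \<open>Four placements of the optimal configuration share this ranking. The first sorted point
  is the optimal point 0, 1, 3 and 4 respectively, and the last two placements have their axes
  exchanged.\<close>

lemma optimal_near_024153:
  assumes "packing (pts X (\<lambda>i. Y ([0, 2, 4, 1, 5, 3] ! i)))"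
  shows "near X Y [101, 150, 251, 352, 401, 41, 174, 174, 369, 369] \<Longrightarrow>
      optimal (pts X (\<lambda>i. Y ([0, 2, 4, 1, 5, 3] ! i)))"
    "near X Y [50, 150, 251, 301, 401, 195, 195, 328, 369, 502] \<Longrightarrow>
      optimal (pts X (\<lambda>i. Y ([0, 2, 4, 1, 5, 3] ! i)))"
    "near X Y [133, 133, 328, 328, 461, 101, 150, 251, 352, 401] \<Longrightarrow>
      optimal (pts X (\<lambda>i. Y ([0, 2, 4, 1, 5, 3] ! i)))"
    "near X Y [0, 133, 174, 307, 307, 101, 201, 251, 352, 452] \<Longrightarrow>
      optimal (pts X (\<lambda>i. Y ([0, 2, 4, 1, 5, 3] ! i)))"
  subgoal
    by (rule near_straight[where p = "[0, 1, 5, 3, 2, 4]" and m = "[0, 0, 0, 0, 0, 0]" and n = "[0, 0, 0, 0, 0, 0]"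
        and \<alpha> = 0 and \<beta> = "2 / 10000", OF _ _ _ _ assms], assumption;
      (elim less_6_cases)?; use opt_bounds in \<open>force simp: near_simps\<close>)
  subgoal
    by (rule near_straight[where p = "[5, 0, 4, 2, 1, 3]" and m = "[0, 1, 1, 1, 1, 1]" and n = "[0, 1, 0, 0, 1, 1]"
        and \<alpha> = "7993 / 10000" and \<beta> = "6536 / 10000", OF _ _ _ _ assms], assumption;
      (elim less_6_cases)?; use opt_bounds in \<open>force simp: near_simps\<close>)
  subgoal
    by (rule near_transposed[where p = "[5, 2, 1, 0, 4, 3]" and m = "[0, 0, 1, 1, 0, 1]" and n = "[0, 1, 1, 1, 1, 1]"
        and \<alpha> = "1 / 2" and \<beta> = "9185 / 10000", OF _ _ _ _ assms], assumption;
      (elim less_6_cases)?; use opt_bounds in \<open>force simp: near_simps\<close>)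
  subgoal
    by (rule near_transposed[where p = "[2, 4, 5, 3, 0, 1]" and m = "[0, 0, 1, 1, 1, 1]" and n = "[0, 0, 0, 0, 1, 1]"
        and \<alpha> = "7007 / 10000" and \<beta> = "2651 / 10000", OF _ _ _ _ assms], assumption;
      (elim less_6_cases)?; use opt_bounds in \<open>force simp: near_simps\<close>)
  done

section \<open>The certificates\<close>

text \<open>The trees were found by branch and bound, solving floating-point linear programs and rounding
  their dual solutions.\<close>

abbreviation U :: "nat \<Rightarrow> nat \<Rightarrow> int \<Rightarrow> int \<Rightarrow> entry" where "U i j a b \<equiv> (Up i j, a, b)"

abbreviation D :: "nat \<Rightarrow> nat \<Rightarrow> int \<Rightarrow> int \<Rightarrow> entry" where "D i j a b \<equiv> (Dn i j, a, b)"

text \<open>Disjoint arcs on one axis have total length at most 1. Here five vectors use disjoint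
  arcs on both axes, so their coordinates add up to at most 2, while the chord of the quadrant gives
  each at least 201/502, in total 1005/502 > 2. The next two rankings fall in the same way, along a
  closed chain of five points that winds once around each axis.\<close>

definition tree_012345 :: tree where
  "tree_012345 =
End [U 5 0 2 2,U 1 2 2 2,U 2 3 2 2,U 3 4 2 2,U 4 5 2 2]"

lemma proves_012345: "proves [0, 1, 2, 3, 4, 5] quadrant tree_012345"
  by code_simp

lemma hits_012345: "hits tree_012345 = []"
  by code_simp

definition tree_012354 :: tree where
  "tree_012354 =
End [U 0 1 2 2,U 4 0 2 2,U 1 2 2 2,U 2 3 2 2,U 3 4 2 2]"

lemma proves_012354: "proves [0, 1, 2, 3, 5, 4] quadrant tree_012354"
  by code_simp

lemma hits_012354: "hits tree_012354 = []"
  by code_simp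

definition tree_012453 :: tree where
  "tree_012453 =
End [U 0 1 2 2,U 4 0 2 2,U 1 2 2 2,U 2 3 2 2,U 3 4 2 2]"

lemma proves_012453: "proves [0, 1, 2, 4, 5, 3] quadrant tree_012453"
  by code_simp

lemma hits_012453: "hits tree_012453 = []"
  by code_simp

text \<open>The first leaf shows how flat vectors are excluded. In height point 5 lies between 2 and
  4, horizontally it lies outside. The chords for the pairs 52 and 45 then give
  \<open>x - y \<le> 100 / 502\<close> for the vector (x, y) of \<open>U 2 4\<close>, but beyond the
  chord from (201, 0) to (186, 76) one has \<open>x - y \<ge> 110 / 502\<close>. All cut directions
  are integer vectors just inside the circle of squared radius 40402, so that the chords between
  them lose little.\<close>

definition tree_012543 :: tree where
  "tree_012543 =
Cut (U 2 4 186 76)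
(End [U 2 4 13 7,D 5 2 5 5,D 4 5 5 5])
(Cut (U 4 0 186 76)
(End [D 0 3 5 5,U 4 0 13 7,D 3 4 5 5])
(Cut (U 2 4 56 193)
(Cut (D 1 3 186 76)
(End [U 0 1 5 5,U 3 0 5 5,D 1 3 13 7])
(Cut (D 5 1 186 76)
(End [U 1 2 5 5,D 5 1 13 7,U 2 5 5 5])
(Cut (D 1 3 56 193)
(Cut (D 5 1 56 193)
(Cut (U 4 0 56 193)
(Cut (U 0 1 142 142)
(Cut (D 3 4 186 76)
(End [U 0 1 39 39,U 4 0 18 18,U 1 2 20 20,D 1 3 13 13,U 2 3 3 3,D 3 4 72 72,D 4 5 17 17])
(Cut (D 4 5 120 161)
(End [U 0 1 41 41,U 1 2 21 21,D 1 3 54 54,D 5 1 40 40,D 2 3 1 1,U 2 4 34 34,D 3 4 52 52,D 4 5 65 65])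
(End [U 0 1 59 59,U 3 0 9 9,U 4 0 33 33,D 5 0 13 13,U 1 2 30 30,D 1 3 106 106,D 5 1 86 86,U 2 5 30 30,D 3 4 84 84,D 4 5 166 166])))
(Cut (U 1 2 142 142)
(Cut (D 3 4 186 76)
(End [U 0 1 14 14,U 4 0 11 11,U 1 2 14 14,D 5 1 9 9,U 2 3 4 4,D 3 4 32 28,D 4 5 6 6])
(End [U 0 1 26 26,U 3 0 2 2,U 4 0 8 8,U 1 2 25 25,D 5 1 17 17,U 2 4 11 11,D 3 4 14 14,D 4 5 11 11]))
(End [U 0 1 11 11,D 0 3 2 2,U 4 0 9 9,U 1 2 11 11,U 2 4 9 9,D 5 2 2 2,D 3 4 2 2,D 4 5 2 2])))
(End [U 4 0 7 11,D 5 0 3 3,D 4 5 3 3]))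
(End [U 0 1 3 3,U 5 0 3 3,D 5 1 7 11]))
(End [U 1 2 3 3,D 1 3 7 11,U 2 3 3 3]))))
(End [D 2 3 3 3,U 2 4 7 11,D 3 4 3 3])))"

lemma proves_012543: "proves [0, 1, 2, 5, 4, 3] quadrant tree_012543"
  by code_simp

lemma hits_012543: "hits tree_012543 = []"
  by code_simp

definition tree_013254 :: tree where
  "tree_013254 =
Cut (U 3 5 186 76)
(End [D 2 3 5 5,D 5 2 5 5,U 3 5 13 7])
(Cut (U 3 5 56 193)
(Cut (U 1 3 76 186)
(Cut (U 4 0 76 186)
(Cut (U 2 4 186 76)
(End [U 2 4 13 7,D 5 2 5 5,D 4 5 5 5])
(Cut (U 1 2 186 76)
(End [U 1 2 13 7,D 3 1 5 5,D 2 3 5 5])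
(Cut (U 5 0 186 76)
(End [D 0 4 5 5,U 5 0 13 7,D 4 5 5 5])
(Cut (U 2 4 56 193)
(Cut (U 0 1 76 186)
(Cut (D 2 3 76 186)
(Cut (D 4 5 76 186)
(Cut (D 2 3 193 56)
(End [U 0 1 46 46,U 4 0 9 9,U 5 0 25 25,U 1 2 31 31,D 2 3 152 117,U 3 5 44 44,D 4 5 9 9])
(Cut (D 4 5 193 56)
(End [U 0 1 25 25,U 5 0 17 17,U 1 2 13 13,U 1 3 6 6,D 2 3 6 6,U 2 4 24 24,D 4 5 84 65])
(Cut (D 5 2 142 142)
(Cut (U 2 4 166 113)
(End [U 2 4 20 11,D 5 2 10 10,D 4 5 11 11])
(Cut (U 3 5 104 172)
(Cut (D 1 4 186 76)
(End [U 0 1 2 2,U 4 0 2 2,D 1 4 5 3])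
(Cut (D 3 0 186 76)
(End [U 0 1 2 2,D 3 0 5 3,U 1 3 2 2])
(Cut (D 3 0 113 166)
(Cut (U 4 0 129 154)
(Cut (U 5 0 113 166)
(End [U 0 1 21 21,U 5 0 41 39,U 1 3 21 21,D 3 4 2 2,U 3 5 36 36,D 4 5 3 3])
(Cut (U 1 3 129 154)
(Cut (U 1 2 113 166)
(End [U 0 1 44 44,U 4 0 49 49,U 5 0 17 17,U 1 2 87 82,D 2 3 27 27,U 2 4 59 59,D 3 4 16 16,U 3 5 2 2,D 4 5 3 3])
(Cut (U 0 1 129 154)
(Cut (D 2 3 176 97)
(End [U 0 1 13 13,U 4 0 13 13,U 1 2 8 8,D 2 3 73 65,D 5 2 10 10,U 3 5 4 4,D 4 5 8 8])
(Cut (U 1 3 197 39)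
(End [U 0 1 16 16,U 4 0 16 16,U 1 2 10 10,U 1 3 54 53,U 2 4 8 8,D 5 2 2 2,D 4 5 2 2])
(Cut (U 4 0 183 83)
(End [U 0 1 240 240,U 4 0 408 408,U 5 0 88 88,U 1 3 254 254,D 2 3 97 97,U 2 4 65 65,D 5 2 43 43,U 3 5 93 93,D 4 5 2 2])
(Cut (D 4 5 161 120)
(End [U 0 1 158 158,U 4 0 211 211,U 1 3 167 167,D 2 3 114 114,U 2 4 65 65,D 5 2 72 72,D 4 5 284 259])
(Cut (U 1 3 172 104)
(End [U 0 1 18 18,U 4 0 24 24,U 1 2 2 2,U 1 3 41 41,D 2 3 6 6,D 5 2 3 3,U 3 5 5 5,D 4 5 15 15])
(End [U 0 1 263 263,U 4 0 570 570,U 1 3 716 716,D 2 3 308 308,U 2 4 7 7,D 5 2 164 164,D 4 5 353 353]))))))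
(End [U 0 1 60 60,U 4 0 7 7,U 5 0 24 24,U 1 2 24 24,U 1 3 7 7,D 2 3 1 1,U 2 4 8 8,D 3 4 2 2,U 3 5 9 9])))
(End [U 0 1 254 254,U 4 0 284 284,U 5 0 100 100,U 1 3 49 467,D 1 4 133 133,D 2 3 483 483,U 2 4 382 382,D 4 5 27 27])))
(End [U 0 1 70 70,D 3 0 2557 2557,U 4 0 170 1615,U 1 3 70 70,D 2 3 1670 1670,D 5 2 1529 1529,D 4 5 1670 1670]))
(End [D 3 0 0 17,U 4 0 2 2,U 5 0 9 9,U 3 5 24 24]))))
(End [D 3 4 4 4,U 3 5 3 9,D 4 5 7 7])))
(End [U 0 1 2 2,U 5 0 2 2,U 1 2 2 2,D 5 2 0 3]))))
(End [U 0 1 6 6,U 4 0 6 6,U 1 3 6 6,D 3 4 1 1,U 3 5 7 7,D 4 5 7 12]))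
(End [U 0 1 6 6,U 4 0 6 6,U 1 3 6 6,D 2 3 7 12,U 2 4 7 7,D 3 4 1 1]))
(Cut (D 4 5 186 76)
(End [U 0 1 18 18,U 5 0 7 7,U 1 2 7 7,U 2 4 9 9,D 5 2 1 1,D 4 5 14 7])
(Cut (D 2 3 76 186)
(Cut (D 4 5 56 193)
(Cut (D 5 1 76 186)
(Cut (D 5 1 166 113)
(End [U 1 2 3 3,U 1 3 9 9,D 5 1 18 0,D 2 3 2 2,U 3 5 17 17])
(Cut (U 2 4 104 172)
(Cut (U 1 2 56 193)
(Cut (U 1 2 166 113)
(End [U 0 1 16 16,U 4 0 1 1,U 5 0 1 1,U 1 2 44 29,D 5 1 34 34,D 2 3 15 15,D 3 4 9 9,D 4 5 22 22])
(Cut (U 5 0 104 172)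
(Cut (D 4 5 104 172)
(Cut (U 1 2 129 154)
(Cut (D 2 3 129 154)
(End [U 0 1 38 38,U 5 0 16 16,U 1 2 45 45,D 5 1 4 4,D 2 3 12 12,D 4 5 19 19])
(End [U 0 1 43 43,U 5 0 20 20,U 1 2 30 24,D 2 3 60 60,D 4 5 20 20]))
(End [U 0 1 81 81,U 5 0 25 25,U 1 2 77 81,U 2 4 25 25,D 4 5 25 25]))
(End [U 0 1 4814 4814,U 5 0 752 752,U 1 2 1295 1295,D 5 1 430 430,D 2 3 557 557,U 3 5 885 885,D 4 5 5011 5623]))
(End [U 0 1 4253 4253,U 5 0 2977 3108,U 1 2 1144 1144,D 5 1 380 380,D 2 3 492 492,U 3 5 782 782])))
(End [U 0 1 434 443,D 0 2 19 19,U 5 0 69 69,U 1 2 601 601,U 2 4 90 90,D 4 5 74 74]))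
(End [D 2 3 8 8,U 2 4 2 11,D 3 4 5 5])))
(End [U 0 1 5 5,U 5 0 2 2,D 5 1 3 5]))
(End [U 0 1 16 16,U 4 0 2 2,U 1 2 3 3,D 2 3 2 2,U 3 5 3 3,D 4 5 19 22]))
(End [U 0 1 40 40,U 5 0 6 6,U 1 3 4 4,D 2 3 33 40,U 2 4 6 6,D 4 5 6 6]))))
(End [D 2 3 3 3,U 2 4 7 11,D 3 4 3 3])))))
(End [U 4 0 7 13,D 5 0 5 5,D 4 5 5 5]))
(End [D 1 2 5 5,U 1 3 7 13,D 2 3 5 5]))
(End [D 3 4 3 3,U 3 5 7 11,D 4 5 3 3]))"

lemma proves_013254: "proves [0, 1, 3, 2, 5, 4] quadrant tree_013254"
  by code_simp

lemma hits_013254: "hits tree_013254 = []"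
  by code_simp

definition tree_013542 :: tree where
  "tree_013542 =
Cut (D 1 3 186 76)
(End [U 0 1 5 5,U 3 0 5 5,D 1 3 13 7])
(Cut (D 1 3 56 193)
(Cut (D 5 1 76 186)
(Cut (U 2 4 76 186)
(Cut (U 2 3 186 76)
(End [U 2 3 13 7,D 4 2 5 5,D 3 4 5 5])
(Cut (U 1 2 186 76)
(End [U 1 2 22 12,D 5 1 9 9,D 2 5 8 8])
(Cut (U 3 5 76 186)
(Cut (U 4 0 186 76)
(End [D 0 3 5 5,U 4 0 13 7,D 3 4 5 5])
(Cut (D 5 0 186 76)
(End [U 0 1 5 5,D 5 0 13 7,U 1 5 5 5])
(Cut (D 0 2 186 76)
(End [D 0 2 6 0,U 4 0 4 4,U 2 3 1 1,U 2 4 2 2])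
(Cut (U 4 0 56 193)
(Cut (D 0 2 56 193)
(Cut (D 4 5 186 76)
(End [U 2 4 9 9,U 5 2 8 8,D 4 5 22 12])
(Cut (U 0 1 142 142)
(Cut (U 4 0 104 172)
(Cut (D 3 4 186 76)
(End [U 0 1 4 4,U 4 0 5 4,U 1 2 3 3,D 1 3 2 2,U 2 3 3 3,D 3 4 8 6])
(Cut (D 3 4 56 193)
(Cut (D 1 3 104 172)
(Cut (D 4 5 113 166)
(End [U 0 1 3 2,D 5 0 3 3,U 1 2 2 2,D 1 3 22 22,D 5 1 11 11,U 2 4 2 2,D 3 4 18 18,D 4 5 27 27])
(Cut (D 5 0 113 166)
(Cut (U 3 5 129 154)
(End [U 0 1 13 2,D 5 0 20 20,D 1 3 19 19,U 3 5 12 0])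
(End [U 0 1 90 12,D 5 0 142 142,D 1 3 133 133,D 3 4 99 99,U 3 5 37 37,D 4 5 114 114]))
(End [U 0 1 12 1,U 4 0 9 9,D 5 0 24 24,D 1 3 18 18,D 3 4 15 15,D 4 5 24 24])))
(End [U 1 2 19 19,D 1 3 34 52,U 2 3 19 19]))
(End [U 0 1 258 258,U 3 0 139 139,D 5 0 69 69,U 1 2 172 172,D 1 3 129 129,U 2 4 116 116,D 3 4 704 800,D 4 5 69 69])))
(End [U 4 0 34 52,D 5 0 19 19,D 4 5 19 19]))
(Cut (D 3 4 76 186)
(Cut (U 4 0 104 172)
(Cut (D 3 4 193 56)
(End [U 0 1 8 8,D 0 3 2 2,U 4 0 9 9,U 1 2 5 5,U 2 3 5 5,D 3 4 18 14,D 4 5 1 1])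
(Cut (U 2 3 154 129)
(End [U 0 1 33 33,D 0 2 13 13,U 4 0 36 36,U 1 2 20 20,D 5 1 3 3,U 2 3 39 13,D 3 4 31 31,D 4 5 5 5])
(Cut (D 5 0 154 129)
(End [U 0 1 59 59,D 5 0 27 0,U 1 2 21 21,D 1 3 7 7,U 2 3 20 20,U 2 4 6 6,D 3 4 18 18,D 4 5 7 7])
(Cut (U 0 1 39 197)
(Cut (U 1 2 113 166)
(End [U 0 1 104 104,U 4 0 60 60,U 1 2 93 93,D 5 1 14 14,U 2 3 20 20,U 2 4 29 29,D 3 4 23 23,D 4 5 21 21])
(Cut (U 2 3 83 183)
(Cut (D 3 4 148 136)
(End [U 0 1 10 10,D 0 2 1 1,U 4 0 7 7,U 1 2 9 9,U 2 3 12 12,D 3 4 5 1])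
(Cut (D 4 5 154 129)
(End [U 0 1 4 4,U 1 2 9 9,D 1 3 12 12,D 5 1 8 8,U 2 4 2 2,D 3 4 28 28,D 4 5 32 32])
(Cut (D 5 0 83 183)
(End [U 0 1 70 70,U 4 0 8 8,D 5 0 57 57,U 1 2 45 45,U 2 3 71 71,D 3 4 77 77,D 4 5 40 40])
(End [U 0 1 156 174,U 4 0 28 28,D 5 0 181 181,U 1 2 133 133,D 5 1 29 29,U 2 3 211 211,D 3 4 228 228,D 4 5 121 121]))))
(End [U 0 1 94 107,U 4 0 34 34,D 5 0 2 2,U 1 2 101 101,U 2 3 99 109,U 2 4 19 19,D 4 5 2 2])))
(End [U 0 1 93 118,D 0 3 23 23,U 1 2 2 2,D 5 1 26 26,U 2 3 2 2,D 3 4 37 37,D 4 5 23 23])))))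
(End [U 4 0 34 52,D 5 0 19 19,D 4 5 19 19]))
(End [U 0 1 123 123,D 5 0 58 58,U 1 2 76 76,D 5 1 12 12,U 2 4 51 51,D 3 4 344 372,D 4 5 76 76]))))
(End [U 0 1 3 3,D 0 2 7 11,U 1 2 3 3]))
(End [U 4 0 7 11,D 5 0 3 3,D 4 5 3 3])))))
(End [D 3 4 5 5,U 3 5 7 13,D 4 5 5 5]))))
(End [D 2 3 5 5,U 2 4 7 13,D 3 4 5 5]))
(End [U 0 1 5 5,U 5 0 5 5,D 5 1 7 13]))
(End [U 1 2 3 3,D 1 3 7 11,U 2 3 3 3]))"

lemma proves_013542: "proves [0, 1, 3, 5, 4, 2] quadrant tree_013542"
  by code_simp

lemma hits_013542: "hits tree_013542 = []"
  by code_simp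

definition tree_015342 :: tree where
  "tree_015342 =
Cut (U 4 0 186 76)
(End [D 0 2 5 5,U 4 0 13 7,D 2 4 5 5])
(Cut (U 1 3 186 76)
(End [U 1 3 13 7,D 5 1 5 5,D 3 5 5 5])
(Cut (U 4 0 56 193)
(Cut (U 1 3 56 193)
(Cut (D 1 2 186 76)
(End [U 0 1 5 5,U 2 0 5 5,D 1 2 13 7])
(Cut (D 2 3 186 76)
(End [D 2 3 13 7,U 4 2 5 5,U 3 4 5 5])
(Cut (U 1 3 104 172)
(Cut (D 5 1 76 186)
(Cut (D 3 5 76 186)
(Cut (D 4 5 186 76)
(End [U 3 4 5 5,U 5 3 5 5,D 4 5 13 7])
(Cut (D 5 0 186 76)
(End [U 0 1 5 5,D 5 0 13 7,U 1 5 5 5])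
(Cut (U 4 0 104 172)
(Cut (D 2 4 76 186)
(Cut (D 0 2 76 186)
(Cut (U 0 1 166 113)
(Cut (U 3 4 142 142)
(End [U 0 1 4 4,U 4 0 4 3,U 1 3 4 3,U 3 4 3 3])
(End [U 0 1 6 6,U 4 0 5 5,D 5 0 1 1,D 1 2 1 1,U 1 3 5 5,D 2 4 1 1,U 3 4 4 4,D 3 5 1 1]))
(Cut (U 3 4 161 120)
(End [U 0 1 16 16,D 0 2 3 3,U 4 0 21 21,U 1 3 22 22,D 5 1 4 4,D 2 3 5 5,U 3 4 23 23,D 4 5 4 4])
(End [U 0 1 18 18,D 0 2 6 6,U 4 0 28 28,U 1 3 28 28,D 5 1 6 6,D 2 4 6 6,U 3 4 19 19,D 3 5 6 6])))
(End [U 0 1 5 5,D 0 2 7 13,U 1 2 5 5]))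
(End [U 2 3 5 5,D 2 4 7 13,U 3 4 5 5]))
(End [U 4 0 34 52,D 5 0 19 19,D 4 5 19 19]))))
(End [U 3 4 5 5,D 3 5 7 13,U 4 5 5 5]))
(End [U 0 1 5 5,U 5 0 5 5,D 5 1 7 13]))
(End [D 1 2 19 19,U 1 3 34 52,D 2 3 19 19]))))
(End [D 1 2 3 3,U 1 3 7 11,D 2 3 3 3]))
(End [U 4 0 7 11,D 5 0 3 3,D 4 5 3 3])))"

lemma proves_015342: "proves [0, 1, 5, 3, 4, 2] quadrant tree_015342"
  by code_simp

lemma hits_015342: "hits tree_015342 = []"
  by code_simp

text \<open>The single \<open>Near\<close> leaf is the box treated in
  \<open>optimal_near_013524\<close>. For its centre 502 the upper refutation has no entries:
  \<open>502 * z \<ge> 505\<close> already contradicts \<open>z \<le> 1\<close>.\<close>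

definition tree_013524 :: tree where
  "tree_013524 =
Cut (D 4 0 186 76)
(End [U 0 1 5 5,D 4 0 13 7,U 1 4 5 5])
(Cut (U 2 3 186 76)
(End [U 2 3 13 7,D 5 2 5 5,D 3 5 5 5])
(Cut (U 1 2 186 76)
(End [U 1 2 13 7,D 4 1 5 5,D 2 4 5 5])
(Cut (D 1 3 186 76)
(End [U 0 1 5 5,U 3 0 5 5,D 1 3 13 7])
(Cut (U 3 0 76 186)
(Cut (D 2 4 76 186)
(Cut (U 4 5 186 76)
(End [U 0 1 2 2,U 5 0 2 2,U 1 2 2 2,D 2 4 11 11,D 5 2 8 8,U 4 5 26 17])
(Cut (U 5 0 186 76)
(End [D 0 3 5 5,U 5 0 13 7,D 3 5 5 5])
(Cut (U 3 4 186 76)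
(End [D 4 0 2 2,D 1 3 5 5,D 4 1 2 2,U 3 4 8 0])
(Cut (D 1 3 56 193)
(Cut (D 4 0 56 193)
(Cut (U 1 4 76 186)
(Cut (D 2 4 193 56)
(Cut (U 4 5 120 161)
(End [U 0 1 23 23,U 5 0 25 25,U 1 2 25 25,D 2 4 93 69,D 5 2 3 3,U 4 5 61 61])
(Cut (U 5 0 154 129)
(End [U 0 1 9 9,D 0 3 2 2,U 5 0 42 42,U 1 2 12 12,D 1 3 3 3,D 2 4 26 14,D 3 5 4 4,U 4 5 18 18])
(End [U 0 1 26 26,D 4 0 14 14,U 5 0 50 50,U 1 2 36 36,D 1 3 6 6,D 2 4 79 43,D 3 5 4 4,U 4 5 70 70])))
(Cut (U 1 4 129 154)
(Cut (U 4 5 154 129)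
(Cut (D 2 4 148 136)
(Cut (D 5 2 194 52)
(End [D 2 4 15 15,D 5 2 23 23,U 4 5 14 8])
(End [U 0 1 1 1,U 5 0 1 1,D 2 4 71 85,D 5 2 31 31,U 4 5 38 0]))
(End [U 2 3 8 8,D 2 4 213 213,D 5 2 58 58,U 3 4 8 8,U 4 5 90 0]))
(Cut (D 3 5 76 186)
(Cut (D 3 5 193 56)
(Cut (U 2 3 120 161)
(End [U 0 1 23 23,U 5 0 25 25,U 1 2 25 25,U 2 3 61 61,D 5 2 3 3,D 3 5 93 69])
(Cut (U 0 1 186 76)
(End [U 0 1 39 39,D 4 0 7 7,U 5 0 17 17,U 1 2 17 17,D 1 3 7 7,U 2 3 34 34,D 2 4 6 7,D 3 5 39 21])
(End [U 0 1 2 2,U 5 0 2 2,U 1 2 2 2,U 2 3 3 3,D 3 5 4 2])))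
(Cut (U 3 4 154 129)
(Cut (D 4 0 136 148)
(End [U 0 1 5 5,D 0 3 28 28,D 4 0 93 93,D 1 3 9 9,U 3 4 59 12])
(End [D 0 3 421 421,D 4 0 1544 1544,U 5 0 121 121,U 3 4 656 0,U 4 5 146 146]))
(Cut (U 0 1 186 76)
(Cut (D 4 0 104 172)
(Cut (U 1 4 197 39)
(End [U 0 1 5 3,D 4 0 4 4,U 1 4 9 7])
(Cut (D 1 3 104 172)
(Cut (U 4 5 83 183)
(Cut (U 1 4 189 68)
(End [U 0 1 183 110,D 4 0 145 145,U 1 4 378 302])
(Cut (D 3 5 120 161)
(Cut (D 4 0 172 104)
(End [U 0 1 5 5,D 4 0 8 6,U 1 4 4 4])
(Cut (D 4 0 129 154)
(Cut (U 2 3 56 193)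
(Cut (D 1 3 172 104)
(End [U 0 1 28 28,U 3 0 6 6,D 4 0 7 7,D 1 3 57 50,D 3 5 4 4,U 4 5 4 4])
(Cut (U 2 3 166 113)
(End [U 0 1 6 5,U 2 3 23 15,D 5 2 5 5,D 3 5 14 14])
(Cut (D 2 4 120 161)
(Cut (U 1 4 148 136)
(Cut (D 2 4 183 83)
(End [U 0 1 49 49,D 4 0 43 28,U 1 2 4 4,D 2 4 117 107])
(Cut (U 2 3 97 176)
(Cut (D 3 5 183 83)
(End [U 0 1 102 102,D 4 0 72 71,U 5 0 24 24,U 1 2 8 8,U 2 3 65 65,D 2 4 47 47,D 3 5 93 65])
(Cut (D 3 5 142 142)
(Cut (U 4 5 113 166)
(Cut (U 0 1 200 20)
(End [U 0 1 455 445,D 4 0 36 36,D 1 3 56 56,U 1 4 55 55,U 2 3 10 10,D 2 4 11 11,D 3 5 76 76,U 4 5 76 76])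
(Cut (U 1 4 183 83)
(End [U 0 1 2956 2956,D 4 0 1443 1443,U 5 0 556 556,U 1 4 10514 10399,U 4 5 2523 2523])
(Cut (D 1 3 161 120)
(End [U 0 1 202 202,U 3 0 27 27,D 4 0 13 13,D 1 3 350 322,U 1 4 53 53,D 3 5 59 59,U 4 5 59 59])
(Cut (U 0 1 199 28)
(End [U 0 1 1787 1765,D 4 0 61 61,D 1 3 113 113,U 1 4 109 109,U 2 3 21 21,D 2 4 23 23,D 3 5 122 122,U 4 5 122 122])
(Cut (D 1 3 120 161)
(Cut (U 1 4 161 120)
(Cut (U 4 5 148 136)
(End [U 0 1 153 153,U 5 0 11 11,U 1 4 176 166,U 4 5 751 735])
(Cut (U 2 3 154 129)
(End [U 0 1 486 486,D 4 0 60 60,U 5 0 48 48,U 1 4 287 287,U 2 3 908 668,D 5 2 144 144,D 3 5 706 706,U 4 5 254 254])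
(Cut (D 2 4 142 142)
(Cut (U 2 3 113 166)
(Cut (U 3 0 193 56)
(End [U 0 1 3 2,U 3 0 3 2,D 1 3 4 4])
(Cut (D 3 5 154 129)
(Cut (U 0 1 197 39)
(End [U 0 1 6105 5973,D 4 0 326 326,D 1 3 712 712,U 1 4 690 690,U 2 3 168 168,D 2 4 168 168,D 3 5 770 770,U 4 5 638 638])
(Cut (U 1 4 166 113)
(Cut (U 4 5 142 142)
(End [U 0 1 441 441,U 5 0 26 26,D 1 3 57 57,U 1 4 423 423,U 2 3 13 13,D 2 4 13 13,D 3 5 62 62,U 4 5 1702 1678])
(Cut (D 4 0 142 142)
(End [U 0 1 42 44,D 4 0 17 9,U 1 4 49 49])
(Cut (U 4 5 120 161)
(Cut (D 2 4 176 97)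
(End [U 0 1 289 289,D 4 0 342 342,U 5 0 41 41,U 1 2 17 17,D 2 4 539 501,U 4 5 347 347])
(Cut (D 3 5 176 97)
(End [U 0 1 11007 11007,D 4 0 12606 12606,U 5 0 1532 1532,U 1 2 651 651,U 2 3 6218 6218,D 2 4 3937 3937,D 3 5 6663 5015,U 4 5 1364 1364])
(Cut (U 0 1 189 68)
(Cut (D 1 3 154 129)
(End [U 0 1 40 43,U 3 0 8 8,D 1 3 24 17])
(Cut (D 1 3 148 136)
(End [U 0 1 159 159,U 3 0 14 14,D 4 0 27 27,D 1 3 240 227,U 1 4 42 42,D 3 5 48 48,U 4 5 48 48])
(Cut (D 1 3 129 154)
(Cut (D 5 2 194 52)
(Cut (D 2 4 161 120)
(Cut (U 2 3 148 136)
(End [U 2 3 126 105,D 2 4 11 0,D 5 2 94 94,D 3 5 112 112,U 4 5 76 77])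
(Cut (U 3 0 172 104)
(Cut (U 2 3 136 148)
(End [U 0 1 247 247,U 3 0 133 133,D 4 0 63 63,U 1 2 2 2,U 1 4 96 96,U 2 3 469 427,D 5 2 136 136,D 3 5 155 155,U 4 5 112 112])
(Cut (U 3 0 183 83)
(End [U 0 1 101 76,U 3 0 90 64,D 1 3 216 216])
(Cut (D 1 3 136 148)
(End [U 0 1 123 123,U 3 0 154 150,D 1 3 115 99])
(Cut (D 4 0 136 148)
(End [U 0 1 106 106,U 3 0 25 25,D 4 0 164 153,D 1 3 27 27,U 1 4 61 61,U 2 3 20 20,D 2 4 31 31])
(Cut (D 3 5 172 104)
(Cut (D 5 2 199 28)
(End [U 2 3 39 40,D 5 2 22 16,D 3 5 6 0])
(Cut (D 2 4 172 104)
(Cut (U 4 5 136 148)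
(End [D 2 4 455 449,D 5 2 157 157,U 4 5 248 232])
(Cut (U 2 3 129 154)
(Cut (U 3 0 176 97)
(End [U 0 1 2489 2489,U 3 0 4729 4657,U 1 2 280 280,D 1 3 4593 4593,U 2 3 7438 7438])
(Cut (U 0 1 194 52)
(Near [(195,(1820,[U 3 0 130 130,D 4 0 74 74,U 1 2 3 3,D 1 3 78 78,U 2 3 126 126,D 2 4 85 85,D 3 5 45 45,U 4 5 11 11]),(829,[U 0 1 61 60])),
(195,(2628,[U 0 1 17 15,U 3 0 166 166,D 4 0 221 221,U 5 0 3 3,D 1 3 49 49,U 2 3 144 144,D 2 4 252 252,U 4 5 34 34]),(829,[U 0 1 61 60])),
(328,(1179,[U 3 0 114 114,D 4 0 65 65,U 2 3 23 23,D 2 4 74 74,D 5 2 27 27,D 3 5 74 74,U 4 5 10 10]),(2556,[U 0 1 188 185,U 1 2 8 8,D 1 3 213 213,U 2 3 213 213])),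
(369,(619,[D 4 0 53 53,U 5 0 2 2,U 4 5 23 23]),(1674,[U 0 1 168 167,U 3 0 78 78,D 1 3 23 23,U 1 4 28 28,U 2 3 68 68,D 2 4 119 119])),
(502,(17881032,[]),(4592,[U 0 1 369 360,D 4 0 93 93,U 1 2 5 5,D 1 3 389 389,U 1 4 67 67,U 2 3 133 133,D 3 5 448 448,U 4 5 112 112])),
(50,(5601,[U 0 1 25 0,U 3 0 186 186,U 1 2 6 6,D 1 3 55 55,U 2 3 162 162]),(616,[U 0 1 89 89,U 3 0 39 39,D 4 0 72 72,D 1 3 50 50,U 2 3 47 47,D 2 4 82 82,D 3 5 44 44,U 4 5 11 11])),
(150,(6901,[U 0 1 404 394,U 3 0 340 340,U 5 0 26 26,D 1 3 101 101,U 2 3 295 295,D 2 4 547 547,D 5 2 24 24,U 4 5 295 295]),(926,[D 4 0 74 77])),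
(251,(2372,[U 0 1 189 182,U 3 0 390 390,D 1 3 116 116,U 2 3 339 339]),(2790,[U 0 1 181 181,D 4 0 321 321,U 1 2 3 3,D 2 4 366 366,D 5 2 4 0,U 4 5 49 49])),
(301,(7770,[U 0 1 246 231,U 5 0 30 30,U 1 2 6 6,D 1 3 468 468,U 2 3 160 160,D 3 5 539 539]),(2342,[U 0 1 213 213,U 3 0 125 125,D 4 0 315 315,D 1 3 37 37,U 1 4 53 53,U 2 3 109 109,D 2 4 276 276,D 5 2 68 68,U 4 5 125 125])),
(401,(2034,[U 0 1 66 58,U 3 0 167 167,D 1 3 195 195]),(732,[U 0 1 62 62,D 4 0 78 78,U 1 2 1 1,U 2 3 70 70,D 2 4 89 89,D 5 2 10 10,D 3 5 60 60,U 4 5 12 12]))])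
(End [U 0 1 1680 1711,U 3 0 3608 3608,U 1 2 118 118,D 1 3 1074 1074,U 2 3 3136 3136])))
(End [U 0 1 468 468,U 3 0 500 500,D 4 0 385 385,U 5 0 5 5,U 1 2 59 59,D 1 3 1032 1032,U 2 3 626 647,D 2 4 439 439,U 4 5 59 59])))
(End [U 0 1 1626 1626,U 3 0 1916 1916,D 4 0 1152 1152,U 1 2 93 93,D 1 3 2068 2068,U 1 4 598 598,U 2 3 1546 1546,D 2 4 0 106])))
(End [U 0 1 12217 12217,U 3 0 13548 13548,D 4 0 7327 7327,U 1 2 637 637,D 1 3 16964 16964,U 1 4 5762 5762,U 2 3 5084 5084,D 5 2 228 228,D 3 5 0 877,U 4 5 6784 6784]))))))
(End [U 0 1 263 263,U 3 0 0 43,D 4 0 408 408,U 1 4 124 124,U 2 3 78 78,D 2 4 211 211,D 5 2 63 63,D 3 5 213 213,U 4 5 193 193])))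
(End [U 0 1 160 160,U 3 0 22 22,D 4 0 99 99,D 1 3 46 46,U 1 4 127 127,U 2 3 73 73,D 2 4 0 19,D 5 2 8 8,D 3 5 21 21,U 4 5 18 18]))
(End [U 0 1 5448 5448,D 4 0 6206 6206,U 5 0 668 668,U 1 2 399 399,D 1 3 1612 1612,U 2 3 161 161,D 2 4 1938 1938,D 5 2 0 688,D 3 5 1093 1093,U 4 5 671 671]))
(End [U 1 2 13 13,D 1 3 40 56,U 2 3 59 59]))))
(End [U 0 1 290 292,D 4 0 48 48,U 5 0 10 10,U 1 4 73 73,U 4 5 85 85]))))
(End [U 0 1 94 94,D 4 0 134 134,U 5 0 15 15,U 1 2 1 1,D 1 3 16 16,U 1 4 89 89,U 2 3 4 4,D 3 5 17 17,U 4 5 379 384]))))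
(End [U 0 1 677 677,U 5 0 40 40,D 1 3 244 244,U 1 4 2059 2102,U 2 3 57 57,D 2 4 57 57,D 3 5 263 263,U 4 5 431 431])))
(End [U 0 1 34 35,U 3 0 9 9,D 4 0 8 8,D 1 3 4 4,U 1 4 39 39,D 3 5 0 8,U 4 5 35 35])))
(End [U 0 1 65 65,D 4 0 28 28,U 5 0 11 11,U 1 2 5 5,D 1 3 110 110,U 1 4 0 24,U 2 3 63 94,D 2 4 87 87,U 4 5 58 58]))
(End [U 0 1 42 42,U 3 0 8 8,D 4 0 11 11,D 1 3 9 10,U 1 4 48 48,U 2 3 27 27,D 2 4 6 16]))))
(End [U 0 1 1385 1385,U 5 0 97 97,D 1 3 643 643,U 1 4 2437 2516,U 2 3 71 71,D 2 4 78 78,D 3 5 523 523,U 4 5 963 963]))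
(End [U 1 2 4 4,D 1 3 9 14,U 2 3 11 11]))))))
(End [U 0 1 5493 5493,D 4 0 4589 4589,U 5 0 1504 1504,U 1 2 112 112,D 1 3 1639 1639,U 1 4 4221 4221,U 2 3 302 302,D 3 5 2211 2211,U 4 5 9852 10514]))
(End [U 0 1 192 192,U 3 0 54 54,D 4 0 90 90,D 1 3 54 54,U 1 4 160 160,D 3 5 61 125,U 4 5 147 147])))
(End [U 0 1 28 17,D 4 0 42 42,U 1 2 1 1,D 1 3 29 29,U 2 3 18 31,D 2 4 27 27])))
(End [U 0 1 60 60,U 5 0 5 5,D 1 3 152 152,U 1 4 0 76,U 2 3 19 19,D 2 4 29 29,D 3 5 113 113,U 4 5 3 61]))
(End [U 0 1 21 21,U 3 0 6 6,D 4 0 9 9,D 1 3 7 7,U 1 4 13 13,U 2 3 11 11,D 2 4 9 16]))))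
(End [U 0 1 16 9,D 4 0 23 23,D 1 3 13 13,U 2 3 12 19,D 2 4 9 9]))
(End [D 4 0 44 73,U 5 0 26 26,U 4 5 68 68])))
(End [U 3 4 8 8,D 3 5 8 15,U 4 5 17 17])))
(End [U 0 1 77 46,D 4 0 61 61,D 1 3 61 61,U 3 4 1 1,D 3 5 44 44,U 4 5 28 62]))
(End [U 1 2 19 19,D 1 3 34 52,U 2 3 19 19])))
(End [U 0 1 6 3,D 4 0 40 54,U 5 0 16 16,D 1 3 3 3,D 3 5 3 3,U 4 5 22 22]))
(Cut (D 3 5 120 161)
(Cut (D 1 3 104 172)
(Cut (D 4 0 104 172)
(Cut (D 2 4 176 97)
(Cut (U 5 0 154 129)
(End [U 0 1 10 10,D 0 3 3 3,U 5 0 35 35,U 1 2 10 10,U 2 3 1 1,D 2 4 14 4,D 3 5 7 7,U 4 5 11 11])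
(End [U 0 1 8 8,D 4 0 2 2,U 5 0 11 11,U 1 2 8 8,D 2 4 12 3,U 4 5 11 11]))
(Cut (U 1 2 154 129)
(Cut (D 2 4 148 136)
(End [U 0 1 78 78,U 5 0 78 78,U 1 2 921 430,D 4 1 380 380,D 2 4 2208 2208,U 4 5 94 94])
(End [U 0 1 2 2,U 5 0 2 2,U 1 2 117 0,D 4 1 74 74,U 2 3 9 9,D 2 4 280 280,U 3 4 12 12,D 3 5 2 2]))
(Cut (U 2 3 154 129)
(Cut (D 3 5 166 113)
(End [U 0 1 42 42,U 5 0 42 42,U 1 2 51 51,U 2 3 302 187,D 5 2 97 97,D 3 5 434 434])
(End [U 2 3 44 9,D 5 2 25 25,D 3 5 107 108]))
(Cut (U 3 0 166 113)
(Cut (U 5 0 154 129)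
(Cut (U 0 1 154 129)
(End [U 0 1 3 1,U 5 0 3 1,D 1 3 3 3,D 3 5 3 3])
(End [U 0 1 15 15,U 5 0 12 6,U 1 2 15 15,U 2 3 15 15,D 3 5 10 10]))
(Cut (D 2 4 113 166)
(Cut (U 0 1 154 129)
(Cut (D 1 3 154 129)
(End [U 0 1 18 18,U 3 0 7 7,U 5 0 2 2,D 1 3 11 6,U 3 4 2 2,U 4 5 2 2])
(Cut (U 1 2 129 154)
(End [U 0 1 3 1,D 4 0 3 3,U 1 2 2 0,D 2 4 4 4])
(Cut (U 5 0 129 154)
(End [U 0 1 7 3,U 5 0 6 2,D 1 3 12 11,D 3 5 6 6])
(Cut (U 5 0 104 172)
(End [U 0 1 18 10,U 5 0 9 0,U 1 2 5 5,D 1 3 31 31,U 2 3 3 3,D 3 5 15 15])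
(Cut (D 4 0 154 129)
(End [U 0 1 51 51,D 4 0 31 17,U 1 2 4 4,U 1 4 16 16,U 2 3 3 3,U 3 4 3 3])
(Cut (U 4 5 52 194)
(Cut (U 2 3 52 194)
(Cut (U 1 4 183 83)
(Cut (U 1 2 68 189)
(End [U 0 1 1730 1730,U 3 0 723 723,U 5 0 289 289,U 1 2 1593 1593,D 1 3 836 836,U 2 3 829 829,D 2 4 27 27,U 3 4 113 113,U 4 5 154 154])
(Cut (U 4 5 83 183)
(Cut (U 3 0 183 83)
(Cut (U 2 3 83 183)
(Cut (U 5 0 56 193)
(End [U 0 1 71 71,D 4 0 35 35,U 5 0 87 85,U 1 2 22 22,U 1 4 42 42,U 2 3 5 5,U 3 4 2 2,U 4 5 40 40])
(Cut (U 4 5 113 166)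
(Cut (U 0 1 166 113)
(Cut (U 2 3 113 166)
(Cut (U 3 0 197 39)
(End [U 0 1 953 953,U 3 0 676 589,D 4 0 81 81,U 5 0 676 676,U 1 2 583 583,D 1 3 450 450,U 1 4 107 107,U 2 3 189 189,U 4 5 146 146])
(Cut (D 5 2 200 20)
(Cut (U 1 4 200 20)
(End [U 0 1 9 3,D 4 0 18 18,U 1 4 39 34])
(End [U 0 1 1049 1049,U 3 0 593 593,D 4 0 218 218,U 5 0 421 421,U 1 2 363 363,D 1 3 211 211,U 1 4 403 403,U 2 3 460 460,D 5 2 632 632,U 4 5 433 433]))
(End [U 0 1 324 330,U 3 0 169 169,D 4 0 67 67,U 5 0 153 153,U 1 2 132 132,D 1 3 60 60,U 1 4 89 89,U 2 3 131 131,D 5 2 18 18,U 4 5 121 121])))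
(End [U 0 1 343 343,U 3 0 145 145,U 5 0 76 76,U 1 2 258 258,D 1 3 215 215,U 1 4 4 4,U 2 3 387 408,U 3 4 4 4,U 4 5 16 16]))
(End [U 0 1 276 296,U 3 0 15 15,U 5 0 114 114,U 1 2 103 103,D 1 3 9 9,U 1 4 6 6,U 2 3 23 23,U 3 4 6 6,U 4 5 25 25]))
(End [U 0 1 472 472,U 3 0 9 9,D 4 0 441 441,U 5 0 660 660,U 1 2 148 148,U 1 4 280 280,U 2 3 33 33,U 3 4 14 14,U 4 5 790 839])))
(End [U 0 1 83 83,U 3 0 47 47,U 5 0 17 17,U 1 2 95 95,D 1 3 76 76,U 2 3 164 168,U 3 4 5 5,U 4 5 9 9]))
(End [U 0 1 507 592,U 3 0 927 1016,U 1 2 471 471,U 2 3 314 314]))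
(End [U 0 1 287 287,D 4 0 222 222,U 5 0 195 195,U 1 2 90 90,U 1 4 170 170,U 2 3 17 17,U 3 4 12 12,D 3 5 2 2,U 4 5 514 515])))
(End [U 0 1 507 592,U 5 0 308 308,U 1 4 366 433,U 4 5 314 314]))
(End [U 0 1 754 234,D 4 0 1679 1679,U 5 0 110 110,U 1 2 108 108,D 1 3 1730 1730,U 2 3 1235 1663,D 2 4 1152 1152,U 4 5 112 112]))
(End [U 0 1 102 102,D 4 0 79 79,U 5 0 69 69,U 1 2 52 52,D 1 3 69 69,U 2 3 34 34,U 3 4 27 27,D 3 5 33 33,U 4 5 143 156])))))))
(Cut (D 4 0 172 104)
(End [U 0 1 7 7,D 4 0 6 0,U 1 4 4 4])
(Cut (U 3 0 193 56)
(Cut (D 4 0 161 120)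
(Cut (U 1 2 83 183)
(End [U 0 1 20 20,D 4 0 19 0,U 1 2 42 42,U 2 3 23 23,D 2 4 9 9,U 3 4 23 23])
(End [U 0 1 176 176,D 0 2 18 18,D 4 0 132 0,U 5 0 6 6,U 1 2 284 284,U 1 4 49 49,U 2 3 121 121,U 3 4 115 115,D 3 5 4 4]))
(Cut (U 5 0 20 200)
(Cut (U 2 5 186 76)
(Cut (D 1 3 172 104)
(End [U 0 1 7 7,U 3 0 11 11,D 1 3 6 0])
(Cut (D 1 3 161 120)
(Cut (U 5 0 129 154)
(End [U 0 1 7 7,U 5 0 8 3,D 1 3 7 0,D 3 5 8 8])
(End [U 0 1 50 50,U 3 0 7 7,U 5 0 70 70,U 1 2 3 3,D 1 3 28 0,D 2 4 4 4,U 3 4 29 29,U 4 5 45 45]))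
(Cut (U 2 3 129 154)
(Cut (U 5 0 97 176)
(Cut (D 3 5 148 136)
(End [U 0 1 9 9,U 5 0 14 14,U 1 2 9 9,U 2 3 26 26,D 3 5 7 5])
(Cut (U 5 0 113 166)
(Cut (U 5 0 136 148)
(End [U 0 1 20 20,U 5 0 43 38,U 1 2 20 20,U 2 3 58 58,D 3 5 58 58])
(Cut (D 0 2 120 161)
(End [U 0 1 192 192,D 0 2 24 24,U 5 0 984 984,U 1 2 192 192,U 2 3 115 0,D 3 5 708 708])
(End [U 0 1 18 18,D 0 2 12 23,U 1 2 18 18])))
(End [U 0 1 37 37,U 5 0 326 330,U 1 2 37 37,U 2 3 17 0,U 3 4 3 3,D 3 5 96 96,U 4 5 3 3])))
(End [U 0 1 45 45,U 3 0 20 20,U 5 0 88 88,U 1 2 45 45,U 2 3 47 31,D 3 5 20 20]))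
(Cut (D 2 4 166 113)
(End [U 0 1 24 24,D 4 0 5 5,U 5 0 21 21,U 1 2 24 24,U 2 3 7 9,D 2 4 15 0,U 4 5 18 18])
(Cut (U 1 2 129 154)
(Cut (U 4 5 83 183)
(End [U 0 1 199 199,U 5 0 202 202,U 1 2 574 574,U 2 3 116 117,D 2 4 169 169,U 3 4 75 75,U 4 5 266 266])
(End [U 0 1 33 33,U 5 0 33 33,U 1 2 47 38,U 2 3 4 4,D 2 4 18 18,U 2 5 16 16,D 3 5 2 2,U 4 5 52 52]))
(Cut (U 0 1 83 183)
(Cut (U 3 4 83 183)
(End [U 0 1 434 434,D 4 0 107 107,U 5 0 252 252,U 1 2 313 313,D 1 3 168 168,U 2 3 313 313,U 3 4 405 405,D 3 5 15 15,U 4 5 226 226])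
(Cut (U 4 5 129 154)
(End [U 0 1 55 58,U 3 0 6 6,U 5 0 32 32,U 1 2 29 29,U 1 4 8 8,U 2 3 18 18,D 2 4 10 10,U 3 4 27 27,U 4 5 91 91])
(End [U 0 1 50 54,U 5 0 31 31,U 1 2 30 30,U 1 4 5 5,U 2 3 30 30,U 3 4 50 50,D 3 5 5 5,U 4 5 35 35])))
(End [U 0 1 47 47,U 5 0 12 12,U 1 2 27 30,U 2 3 18 18,U 3 4 3 3,D 3 5 6 6,U 4 5 3 3])))))))
(End [U 0 1 7 7,U 5 0 8 8,U 1 2 7 7,U 2 5 5 6]))
(Cut (U 1 2 83 183)
(Cut (U 0 1 129 154)
(End [U 0 1 415 425,D 4 0 165 165,U 5 0 1063 1066,U 1 2 168 168,D 2 4 132 132,U 4 5 7 7])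
(End [U 0 1 31 31,D 4 0 14 14,U 5 0 240 240,U 1 2 27 27,D 2 4 21 21,U 4 5 10 10]))
(End [U 0 1 9 14,U 5 0 106 107,U 1 2 23 26]))))
(End [U 0 1 4 4,U 3 0 7 9,U 1 2 4 4,U 2 3 4 4]))))
(End [U 2 3 3 3,D 2 4 6 8,U 3 4 3 3])))
(End [U 0 1 8 10,U 3 0 15 18,U 1 2 12 12,U 2 3 12 12])))))
(End [D 4 0 42 64,U 5 0 23 23,U 4 5 28 28]))
(End [U 1 2 19 19,D 1 3 34 52,U 2 3 19 19]))
(End [U 3 4 7 7,D 3 5 11 16,U 4 5 7 7])))))
(End [U 3 4 3 3,D 3 5 5 8,U 4 5 4 4])))
(Cut (D 3 5 166 113)
(End [U 0 1 9 9,U 5 0 10 10,D 1 3 35 35,U 1 4 0 50,U 2 3 15 15,D 2 4 55 55,D 5 2 18 18,D 3 5 48 48])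
(End [D 1 3 25 25,U 1 4 0 25,D 2 4 23 23,D 5 2 10 10,D 3 5 19 19,U 4 5 3 3]))))
(End [D 1 3 2 2,U 1 4 0 3,U 2 3 1 1,D 2 4 1 1]))
(End [D 4 0 2 3,U 5 0 1 1,U 4 5 1 1]))
(End [U 1 2 1 1,D 1 3 2 3,U 2 3 1 1])))))
(End [U 2 3 9 9,D 2 4 12 22,U 3 4 8 8]))
(End [U 3 0 0 3,D 4 0 1 1,D 3 5 1 1,U 4 5 1 1])))))"

lemma proves_013524: "proves [0, 1, 3, 5, 2, 4] quadrant tree_013524"
  by code_simp

lemma hits_013524: "hits tree_013524 = [[195, 195, 328, 369, 502, 50, 150, 251, 301, 401]]"
  by code_simp

definition tree_014523 :: tree where
  "tree_014523 =
Cut (D 4 0 186 76)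
(End [U 0 1 5 5,D 4 0 13 7,U 1 4 5 5])
(Cut (U 1 4 76 186)
(Cut (U 1 2 186 76)
(End [U 1 2 5 0,D 5 1 2 2,D 2 4 1 1,D 2 5 1 1,U 4 5 1 1])
(Cut (D 0 2 186 76)
(End [D 0 2 13 7,U 3 0 5 5,U 2 3 5 5])
(Cut (D 1 3 186 76)
(End [U 0 1 5 5,U 3 0 5 5,D 1 3 13 7])
(Cut (D 5 1 186 76)
(End [U 1 4 9 9,D 5 1 22 12,U 4 5 8 8])
(Cut (U 5 2 76 186)
(Cut (U 5 0 186 76)
(End [D 0 2 3 3,U 5 0 5 0,U 2 3 1 1,D 2 5 1 1,D 3 5 1 1])
(Cut (U 3 0 76 186)
(Cut (U 3 4 186 76)
(End [D 0 3 2 2,D 4 0 5 5,D 1 3 2 2,U 3 4 8 0])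
(Cut (U 0 1 142 142)
(Cut (D 1 3 56 193)
(Cut (D 3 5 186 76)
(End [U 2 3 8 8,U 5 2 9 9,D 3 5 22 12])
(Cut (D 4 0 56 193)
(Cut (D 2 4 186 76)
(End [D 2 4 22 12,U 5 2 9 9,U 4 5 8 8])
(Cut (U 4 5 148 136)
(Cut (D 2 4 56 193)
(Cut (D 0 2 56 193)
(Cut (U 1 4 129 154)
(Cut (D 0 2 104 172)
(Cut (U 5 2 129 154)
(Cut (D 2 4 166 113)
(End [D 2 4 19 14,U 5 2 7 7,U 4 5 8 8])
(Cut (U 3 0 129 154)
(Cut (D 1 3 166 113)
(End [U 0 1 8 8,U 3 0 7 7,D 1 3 20 15])
(Cut (U 2 3 142 142)
(Cut (D 5 1 161 120)
(End [D 1 3 1 1,U 1 4 22 22,D 5 1 59 43,U 2 3 2 2,D 2 4 1 1,U 4 5 28 28])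
(Cut (D 5 1 97 176)
(Cut (D 2 4 97 176)
(Cut (U 5 2 161 120)
(Cut (U 2 3 166 113)
(End [U 0 1 54 54,U 3 0 48 48,D 4 0 2 2,U 1 4 44 44,U 2 3 99 99,U 5 2 86 86,U 4 5 76 73])
(Cut (U 1 4 166 113)
(Cut (U 3 0 197 39)
(End [U 0 1 47 43,U 3 0 170 170,U 1 4 59 59,U 2 3 183 170,U 5 2 56 56,U 3 4 1 1,U 4 5 50 48])
(End [U 0 1 57 57,U 3 0 49 49,U 1 2 6 6,U 1 4 65 65,U 2 3 176 171,U 5 2 41 41,U 4 5 54 51]))
(End [U 0 1 50 50,U 3 0 41 41,D 1 3 19 19,U 1 4 136 136,U 2 3 210 210,D 2 4 25 25,U 5 2 64 64,U 4 5 62 62])))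
(Cut (U 0 1 161 120)
(End [U 0 1 66 64,U 3 0 31 31,U 1 4 31 31,U 2 3 38 38,U 5 2 66 66,U 4 5 40 40])
(Cut (U 1 4 197 39)
(End [U 0 1 244 244,D 0 2 21 21,U 3 0 40 40,U 1 4 175 175,D 5 1 26 26,U 2 3 49 49,U 5 2 145 145,U 4 5 56 56])
(End [U 0 1 138 138,D 0 2 7 7,U 3 0 24 24,U 1 4 22 22,D 5 1 18 18,U 2 3 35 35,U 5 2 82 82,U 4 5 28 28]))))
(End [U 2 3 5 5,D 2 4 0 4,U 3 4 2 2]))
(End [U 0 1 5 5,U 5 0 2 2,D 5 1 0 4])))
(Cut (U 1 4 161 120)
(Cut (U 3 4 154 129)
(End [U 0 1 4 3,D 1 3 7 7,U 3 4 5 0,U 4 5 4 3])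
(Cut (U 1 2 113 166)
(End [U 0 1 30 21,U 1 2 35 22,U 2 3 26 26,D 2 4 32 32,U 3 4 23 23,U 4 5 31 23])
(Cut (U 4 5 189 68)
(End [U 0 1 97 91,U 3 0 12 12,U 1 4 114 114,U 2 3 32 32,D 2 4 25 25,U 5 2 25 25,U 4 5 231 226])
(Cut (U 0 1 186 76)
(End [U 0 1 102 99,U 3 0 12 12,D 1 3 12 12,U 1 4 56 56,U 2 3 16 16,U 5 2 6 6,U 4 5 92 84])
(Cut (U 1 4 193 56)
(Cut (U 3 4 83 183)
(End [U 0 1 351 347,U 5 0 79 79,U 1 2 291 291,D 1 3 165 165,U 2 3 246 246,U 5 2 28 28,U 3 4 368 307,U 4 5 408 408])
(Cut (U 2 3 76 186)
(Cut (U 1 2 28 199)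
(Cut (U 5 2 197 39)
(Cut (U 2 3 97 176)
(Cut (U 3 4 39 197)
(End [U 0 1 364 364,U 5 0 86 86,U 1 2 157 157,U 1 4 337 337,U 2 3 309 309,U 5 2 136 136,U 3 4 370 341,U 4 5 427 422])
(End [U 0 1 866 866,U 3 0 150 150,U 5 0 147 147,U 1 2 373 373,U 1 4 801 801,U 2 3 748 748,D 2 4 5 5,U 5 2 347 347,U 3 4 586 586,U 4 5 700 700]))
(End [U 0 1 668 668,U 5 0 143 143,U 1 2 288 288,U 1 4 618 618,U 2 3 1235 1272,D 2 4 46 46,U 3 4 322 322,U 4 5 649 649]))
(End [U 0 1 155 129,U 3 0 27 27,U 1 2 3 3,U 1 4 216 216,U 2 3 127 127,U 5 2 55 77,U 3 4 77 77,U 4 5 198 198]))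
(End [U 0 1 60 60,U 3 0 21 21,U 5 0 6 6,U 1 2 0 37,U 1 4 201 201,U 2 3 97 97,U 5 2 75 75,U 3 4 59 59,U 4 5 177 173]))
(End [U 0 1 29 29,U 5 0 6 6,U 1 2 24 24,D 1 3 13 13,U 2 3 52 59,D 2 4 16 16,U 3 4 35 35,U 4 5 28 28])))
(End [U 0 1 283 278,U 5 0 62 62,U 1 4 306 315,U 4 5 281 281]))))))
(End [D 1 3 19 19,U 1 4 1 14,U 2 3 3 15,D 2 4 19 19]))))
(End [U 0 1 25 25,U 3 0 0 13,U 1 4 23 23,D 3 5 9 9,U 4 5 32 32])))
(End [U 0 1 31 31,D 0 2 22 22,U 1 4 27 27,U 5 2 0 15,U 4 5 31 31]))
(End [U 0 1 6 6,D 0 2 0 5,U 1 2 3 3]))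
(Cut (U 2 3 172 104)
(End [U 0 1 7 7,U 5 0 2 2,U 1 4 0 3,U 2 3 14 12,U 4 5 7 7])
(End [U 0 1 19 19,U 3 0 1 1,U 5 0 5 5,D 1 3 25 25,U 1 4 0 34,U 2 3 20 20,D 2 4 26 26,U 4 5 18 18])))
(End [U 0 1 7 6,D 0 2 0 5]))
(End [U 2 3 3 3,D 2 4 7 11,U 3 4 3 3]))
(Cut (D 4 0 104 172)
(Cut (U 1 4 129 154)
(Cut (U 5 0 154 129)
(End [U 0 1 15 1,U 5 0 17 0,D 1 3 16 16,U 1 4 2 2,D 3 5 15 15,U 4 5 1 1])
(Cut (D 3 5 56 193)
(Cut (D 3 5 104 172)
(Cut (D 1 3 166 113)
(Cut (U 3 0 193 56)
(End [U 0 1 3 3,U 3 0 8 8,D 1 3 8 6])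
(End [U 0 1 10 10,U 3 0 11 11,D 1 3 20 11]))
(Cut (U 1 4 161 120)
(Cut (U 5 0 129 154)
(Cut (U 2 3 186 76)
(End [D 0 2 3 3,U 5 0 5 0,U 2 3 10 6,D 3 5 8 8])
(End [U 0 1 76 9,U 5 0 70 0,U 1 2 16 16,D 1 3 110 110,U 2 3 16 16,D 3 5 112 112,U 4 5 1 1]))
(Cut (D 4 0 154 129)
(End [U 0 1 168 168,D 4 0 300 195,U 1 4 199 199])
(Cut (U 3 4 154 129)
(End [U 0 1 7 0,D 4 0 20 20,D 1 3 11 10,U 3 4 7 0])
(Cut (U 3 0 129 154)
(Cut (D 0 2 113 166)
(Cut (U 3 4 129 154)
(End [U 0 1 185 17,D 4 0 565 565,U 5 0 42 42,U 1 2 31 31,D 1 3 260 260,U 2 3 30 30,U 5 2 3 3,U 3 4 174 0,U 4 5 39 39])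
(Cut (U 5 2 129 154)
(Cut (U 2 3 76 186)
(Cut (U 1 2 113 166)
(End [U 0 1 10 10,U 3 0 9 9,U 1 2 14 12,U 2 3 7 6])
(Cut (U 2 3 166 113)
(Cut (U 3 0 161 120)
(Cut (U 3 0 193 56)
(End [U 0 1 265 214,U 3 0 672 672,U 1 2 48 48,U 2 3 333 302])
(Cut (U 2 3 183 83)
(End [U 0 1 66 66,U 3 0 164 164,D 4 0 0 9,U 1 2 6 6,U 1 4 7 7,U 2 3 160 160,U 5 2 31 31,D 3 5 29 29,U 4 5 31 31])
(Cut (U 0 1 197 39)
(End [U 0 1 30 29,U 3 0 16 13,U 2 3 31 28])
(End [U 0 1 53 53,U 3 0 86 87,U 1 2 26 26,U 2 3 180 179]))))
(End [U 0 1 70 70,U 3 0 559 565,D 4 0 48 128,U 2 3 262 262,U 5 2 127 127,D 3 5 118 118,U 4 5 127 127]))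
(Cut (U 4 5 52 194)
(Cut (U 0 1 197 39)
(End [U 0 1 372 361,U 3 0 64 64,D 4 0 107 107,D 1 3 36 36,U 1 4 82 82,U 2 3 96 96,U 5 2 34 34,U 4 5 90 90])
(Cut (U 3 0 161 120)
(Cut (U 3 4 104 172)
(End [U 0 1 36 36,D 4 0 49 49,U 5 0 34 34,U 1 2 35 35,D 1 3 18 18,U 2 3 52 52,U 5 2 10 10,U 3 4 176 163,U 4 5 54 54])
(Cut (U 5 0 104 172)
(End [U 0 1 12 12,U 5 0 42 39,U 1 2 4 4,U 1 4 4 4,U 2 3 10 10,U 3 4 12 12,D 3 5 4 4,U 4 5 15 15])
(Cut (U 4 5 76 186)
(Cut (U 1 4 183 83)
(Cut (U 0 1 189 68)
(End [U 0 1 130 121,U 3 0 23 23,D 4 0 32 32,D 1 3 12 12,U 1 4 35 35,U 2 3 25 25,U 5 2 10 10,U 4 5 31 31])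
(Cut (U 3 0 183 83)
(Cut (U 3 4 83 183)
(End [U 0 1 19 19,D 4 0 20 20,U 5 0 18 18,U 1 2 8 8,U 2 3 148 148,U 5 2 61 61,U 3 4 716 699,U 4 5 198 198])
(Cut (U 0 1 183 83)
(End [U 0 1 491 465,U 3 0 75 75,D 4 0 67 67,D 1 3 30 30,U 1 4 74 74,U 2 3 52 52,U 5 2 21 21,U 4 5 65 65])
(Cut (U 1 2 56 193)
(End [U 0 1 57 57,U 3 0 31 31,U 5 0 17 17,U 1 2 61 51,U 2 3 46 46,U 3 4 43 43,U 4 5 35 42])
(Cut (U 3 0 200 20)
(End [U 0 1 273 273,U 3 0 171 0,U 5 0 437 437,U 1 2 182 182,D 1 3 17 17,U 1 4 160 160,U 2 3 170 170,U 5 2 71 71,U 3 4 574 574,U 4 5 603 651])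
(Cut (U 3 4 28 199)
(Cut (U 2 3 104 172)
(Cut (U 5 0 56 193)
(End [U 0 1 112 112,U 5 0 142 121,U 1 2 71 71,U 1 4 34 34,U 2 3 64 64,U 3 4 105 105,D 3 5 22 22,U 4 5 89 89])
(Cut (U 4 5 104 172)
(Cut (U 2 3 142 142)
(End [U 0 1 637 637,U 3 0 506 506,D 4 0 64 64,U 5 0 370 370,U 1 2 383 383,U 1 4 259 259,U 2 3 1335 1335,U 5 2 147 147,U 3 4 426 426,U 4 5 711 711])
(End [U 0 1 425 425,U 3 0 373 373,U 5 0 198 198,U 1 2 230 230,D 1 3 4 4,U 1 4 276 276,U 2 3 1119 1119,U 5 2 206 206,U 3 4 650 650,U 4 5 925 925]))
(End [U 0 1 283 283,U 3 0 114 114,D 4 0 161 161,U 5 0 316 316,U 1 2 179 179,U 1 4 86 86,U 2 3 162 162,U 3 4 147 147,U 4 5 528 556])))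
(End [U 0 1 878 878,U 3 0 717 717,U 5 0 229 229,U 1 2 1287 1287,D 1 3 354 354,U 1 4 159 159,U 2 3 2577 2642,U 5 2 95 95,U 3 4 505 505,U 4 5 426 426]))
(End [U 0 1 284 269,U 3 0 266 266,U 5 0 42 42,U 1 2 92 92,U 1 4 208 208,U 2 3 58 65,U 5 2 17 17,U 3 4 0 67,U 4 5 78 78]))))))
(End [U 0 1 21 21,U 3 0 38 41,D 4 0 9 9,U 1 2 7 7,U 1 4 10 10,U 2 3 16 16,U 5 2 3 3,U 4 5 9 9])))
(End [U 0 1 99 99,U 3 0 79 79,U 5 0 22 22,D 1 3 41 41,U 1 4 243 268,U 2 3 85 85,U 5 2 40 40,U 4 5 138 138]))
(End [U 0 1 60 60,D 4 0 93 93,U 5 0 76 76,U 1 2 29 29,U 2 3 85 85,U 3 4 100 100,D 3 5 34 34,U 4 5 536 565]))))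
(End [U 0 1 9 9,U 3 0 21 23,D 4 0 9 9,U 1 2 2 2,U 1 4 7 7,U 2 3 9 9,U 5 2 4 4,D 3 5 2 2,U 4 5 8 8])))
(End [U 0 1 42 42,D 4 0 82 82,U 5 0 51 51,U 1 2 22 22,U 2 3 81 81,U 3 4 73 73,D 3 5 26 26,U 4 5 250 260]))))
(Cut (U 1 2 113 166)
(End [U 0 1 39 28,U 1 2 39 39,D 1 3 25 25,U 2 3 237 237,U 3 4 118 118,U 4 5 97 103])
(Cut (U 3 4 104 172)
(End [U 0 1 9 9,D 4 0 10 10,U 5 0 8 8,U 1 2 14 14,D 1 3 10 10,U 2 3 33 33,U 3 4 62 61,U 4 5 13 13])
(End [U 0 1 20 20,U 5 0 9 9,U 1 2 32 32,D 1 3 22 22,U 2 3 159 166,U 3 4 98 98,U 4 5 61 69]))))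
(End [D 0 2 7 7,D 4 0 9 9,U 5 2 0 4,U 4 5 0 3])))
(End [U 0 1 7 7,D 0 2 0 7,D 4 0 2 4,U 1 2 2 2,U 5 2 1 1,U 4 5 3 3]))
(End [U 3 0 0 3,D 4 0 9 9,D 3 5 5 5,U 4 5 0 3])))))
(Cut (U 2 3 142 142)
(Cut (U 3 0 176 97)
(End [U 0 1 18 18,U 3 0 24 24,U 5 0 3 3,D 1 3 3 3,U 1 4 27 30,U 2 3 15 15,U 5 2 2 2,U 4 5 9 9])
(End [U 0 1 1024 1024,U 3 0 906 906,D 4 0 368 368,D 1 3 159 159,U 1 4 2435 2435,U 2 3 921 921,U 5 2 435 435,D 3 5 655 655,U 4 5 730 730]))
(End [D 1 3 27 27,U 1 4 1 19,U 2 3 15 21,U 4 5 14 20]))))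
(End [U 0 1 4 4,D 4 0 6 6,D 1 3 5 5,U 3 4 26 26,D 3 5 75 100,U 4 5 42 42]))
(End [U 3 4 2 2,D 3 5 6 8,U 4 5 3 3])))
(End [D 1 3 7 7,U 1 4 3 9,D 3 5 5 5,U 4 5 1 6]))
(End [D 4 0 42 64,U 5 0 23 23,U 4 5 29 29]))))
(End [D 4 0 7 11,U 5 0 3 3,U 4 5 3 3])))
(End [U 1 2 3 3,D 1 3 7 11,U 2 3 3 3]))
(Cut (D 2 4 76 186)
(Cut (D 3 5 76 186)
(Cut (U 4 5 142 142)
(Cut (D 5 1 56 193)
(Cut (D 5 1 104 172)
(Cut (D 2 4 193 56)
(End [D 2 4 7 5,U 5 2 2 2,U 4 5 3 3])
(Cut (D 0 2 56 193)
(Cut (D 2 4 176 97)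
(End [D 2 4 42 30,U 5 2 13 13,U 4 5 17 17])
(Cut (U 1 4 129 154)
(Cut (U 5 0 154 129)
(End [D 0 2 6 6,U 5 0 6 1,D 2 4 8 8,U 4 5 5 0])
(Cut (D 5 1 172 104)
(End [U 1 4 3 3,D 5 1 11 9,U 4 5 3 3])
(Cut (D 0 2 104 172)
(Cut (U 5 0 129 154)
(End [U 0 1 1 1,D 0 2 150 150,U 5 0 94 0,U 2 3 9 9,D 2 4 141 141,U 3 4 10 10,U 4 5 102 12])
(Cut (U 1 4 161 120)
(Cut (U 3 0 129 154)
(Cut (U 3 4 154 129)
(End [D 1 3 31 31,D 5 1 61 61,U 5 2 2 2,U 3 4 35 0,U 4 5 31 3])
(Cut (U 1 2 154 129)
(End [U 1 2 2 0,D 5 1 4 4,D 2 4 3 3,U 4 5 2 0])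
(Cut (U 1 2 129 154)
(End [U 0 1 6 6,U 5 0 6 6,U 1 2 47 0,D 5 1 101 101,U 2 3 5 5,D 2 4 70 70,U 3 4 6 6,U 4 5 50 5])
(Cut (U 2 3 76 186)
(Cut (U 5 2 129 154)
(Cut (U 3 4 83 183)
(End [U 0 1 15 16,U 1 2 17 17,U 2 3 48 48,U 5 2 53 53,U 3 4 106 81,U 4 5 63 63])
(Cut (U 2 3 166 113)
(Cut (U 5 2 161 120)
(Cut (U 5 2 193 56)
(End [U 2 3 333 302,U 5 2 672 672,U 3 4 65 65,U 4 5 265 214])
(Cut (U 2 3 183 83)
(End [U 0 1 17 17,D 0 2 15 15,U 3 0 16 16,U 1 4 11 11,D 5 1 5 5,U 2 3 84 84,U 5 2 86 86,U 3 4 4 4,U 4 5 41 41])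
(Cut (U 4 5 197 39)
(End [U 2 3 31 28,U 5 2 16 13,U 4 5 30 29])
(End [U 2 3 189 188,U 5 2 90 91,U 3 4 37 37,U 4 5 56 56]))))
(End [U 0 1 17 163,D 0 2 255 255,U 3 0 31 31,U 1 4 14 14,D 5 1 315 315,U 2 3 64 64,U 5 2 0 144,U 4 5 29 29]))
(Cut (U 0 1 39 197)
(Cut (U 4 5 197 39)
(End [U 0 1 1251 1251,U 3 0 447 447,U 1 4 1235 1235,D 5 1 1168 1168,U 2 3 1432 1432,D 2 4 565 565,U 5 2 1005 1005,U 4 5 6005 5850])
(Cut (D 5 1 129 154)
(Cut (U 5 2 161 120)
(Cut (U 1 2 104 172)
(End [U 0 1 54 54,U 3 0 7 7,U 5 0 39 39,U 1 2 198 183,D 5 1 58 58,U 2 3 56 56,D 2 4 20 20,U 3 4 54 54,U 4 5 46 46])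
(Cut (U 0 1 68 189)
(Cut (U 1 4 183 83)
(Cut (U 4 5 189 68)
(End [U 0 1 34 34,U 3 0 10 10,U 1 4 43 43,D 5 1 40 40,U 2 3 28 28,D 2 4 14 14,U 5 2 27 27,U 4 5 168 158])
(Cut (U 5 0 68 189)
(End [U 0 1 92 92,D 0 2 16 16,U 5 0 115 103,U 1 2 47 47,U 1 4 50 50,D 5 1 24 24,U 2 3 40 40,U 3 4 43 43,U 4 5 95 95])
(Cut (U 5 2 183 83)
(Cut (U 1 2 28 199)
(Cut (U 2 3 104 172)
(Cut (U 4 5 183 83)
(End [U 0 1 23 23,U 3 0 7 7,U 1 4 29 29,D 5 1 27 27,U 2 3 27 27,D 2 4 11 11,U 5 2 31 31,U 4 5 216 206])
(Cut (U 0 1 97 176)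
(Cut (U 1 4 193 56)
(Cut (U 2 3 129 154)
(Cut (U 4 5 161 120)
(Cut (U 3 0 200 13)
(End [U 0 1 207 207,U 3 0 434 434,U 5 0 117 117,U 1 2 65 65,U 1 4 159 159,D 5 1 72 72,U 2 3 162 162,U 5 2 59 59,U 3 4 56 56,U 4 5 268 268])
(End [U 0 1 162 162,U 3 0 41 63,U 1 2 90 90,U 1 4 55 55,U 2 3 225 225,U 5 2 82 82,U 3 4 12 12,U 4 5 159 148]))
(End [U 0 1 965 965,U 3 0 178 178,U 5 0 450 450,U 1 2 537 537,U 1 4 327 327,U 2 3 1334 1335,U 5 2 483 483,U 3 4 442 442,U 4 5 2068 2068]))
(End [U 0 1 2109 2120,U 3 0 431 431,U 5 0 315 315,U 1 2 1198 1198,U 1 4 675 675,U 2 3 3983 3983,U 5 2 474 474,U 3 4 296 296,U 4 5 731 731]))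
(End [U 0 1 300 300,U 3 0 61 61,U 5 0 53 53,U 1 2 112 112,U 1 4 288 299,U 2 3 160 160,U 5 2 77 77,U 4 5 122 122]))
(End [U 0 1 1222 1272,U 5 0 592 592,U 1 2 278 278,U 1 4 210 210,D 5 1 357 357,U 2 3 397 397,U 5 2 192 192,U 3 4 296 296,U 4 5 692 692])))
(End [U 0 1 102 113,U 3 0 21 21,U 1 2 120 120,U 2 3 304 310]))
(End [U 0 1 92 92,U 3 0 22 22,U 5 0 77 77,U 1 2 0 83,U 1 4 250 250,U 2 3 69 73,U 5 2 253 253,U 3 4 64 64,U 4 5 280 262]))
(End [U 0 1 14 14,U 3 0 4 4,U 1 4 18 18,D 5 1 17 17,U 2 3 29 29,U 5 2 70 76,U 3 4 19 19,U 4 5 40 40]))))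
(End [U 0 1 325 325,U 3 0 85 85,U 5 0 46 46,U 1 4 557 621,U 2 3 201 201,D 2 4 102 102,U 5 2 198 198,U 4 5 252 252]))
(End [U 0 1 405 427,D 0 2 33 33,U 5 0 49 49,U 1 2 97 97,D 5 1 73 73,U 2 3 82 82,U 3 4 38 38,U 4 5 58 58])))
(End [U 0 1 8 8,D 0 2 2 2,U 3 0 4 4,U 1 4 8 8,D 5 1 11 11,U 2 3 10 10,U 5 2 22 24,U 3 4 3 3,U 4 5 10 10]))
(End [U 0 1 40 40,U 5 0 32 32,D 5 1 56 77])))
(End [U 0 1 158 162,D 0 2 12 12,U 5 0 23 23,U 1 2 35 35,D 5 1 26 26,U 2 3 39 39,U 3 4 14 14,U 4 5 20 20]))))
(End [U 0 1 0 2,D 0 2 3 3,D 5 1 4 4,U 5 2 0 2]))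
(Cut (U 3 4 83 183)
(End [U 0 1 29 30,U 5 0 5 5,U 1 2 33 33,U 2 3 64 64,D 2 4 6 6,U 3 4 18 18,U 4 5 11 11])
(End [U 0 1 77 80,U 5 0 13 13,U 1 2 88 88,U 2 3 186 195,D 2 4 34 34,U 3 4 62 62,U 4 5 29 29]))))))
(End [U 0 1 5 60,U 3 0 0 66,D 5 1 117 117,U 2 3 5 5,D 3 5 60 60]))
(Cut (D 2 4 113 166)
(Cut (D 2 4 136 148)
(Cut (U 5 2 176 97)
(End [U 0 1 12 67,D 0 2 84 84,U 5 0 20 20,U 1 4 0 59,D 2 4 204 204,U 5 2 24 15,U 4 5 23 23])
(End [U 0 1 49 272,D 0 2 423 423,U 5 0 30 30,U 1 4 0 240,D 2 4 826 826,U 5 2 17 17,U 4 5 94 94]))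
(End [U 0 1 166 922,D 0 2 1295 1295,U 3 0 124 124,U 5 0 12 12,U 1 4 0 813,U 2 3 115 115,D 2 4 5623 5623,U 4 5 26 26]))
(End [U 0 1 12 17,U 1 4 30 39,U 2 3 12 12,D 2 4 15 31]))))
(End [U 0 1 40 40,D 0 2 70 92,U 1 2 23 23,D 5 1 8 8,D 2 4 6 6,U 4 5 4 4]))))
(End [U 0 1 0 6,D 0 2 7 7,U 1 4 3 9,D 2 4 9 9])))
(End [U 0 1 3 3,D 0 2 5 7,U 1 2 2 2])))
(End [U 0 1 29 29,U 5 0 22 22,D 5 1 40 61]))
(End [U 0 1 3 3,U 5 0 2 2,D 5 1 5 7]))
(Cut (D 0 2 56 193)
(Cut (D 0 2 104 172)
(Cut (D 3 5 193 56)
(End [U 2 3 3 3,U 5 2 3 3,D 3 5 11 7])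
(Cut (D 1 3 56 193)
(Cut (U 5 0 154 129)
(Cut (U 2 3 142 142)
(End [D 0 2 4 4,U 5 0 3 0,U 2 3 3 1,D 3 5 3 3])
(End [U 0 1 12 12,D 0 2 9 9,U 5 0 13 0,U 1 4 4 4,U 2 3 15 15,D 3 5 7 7,U 4 5 12 12]))
(Cut (U 3 4 154 129)
(End [U 0 1 51 51,D 0 3 1 1,U 5 0 44 44,D 1 3 26 26,U 3 4 25 0,U 4 5 48 48])
(Cut (D 3 5 120 161)
(Cut (D 1 3 166 113)
(End [U 0 1 46 46,U 5 0 42 42,D 1 3 27 0,U 3 4 30 30,U 4 5 47 47])
(Cut (U 1 2 154 129)
(End [U 0 1 52 52,U 5 0 48 48,U 1 2 29 0,D 5 1 2 2,D 2 4 20 20,U 4 5 63 63])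
(Cut (U 2 3 142 142)
(Cut (U 5 0 129 154)
(End [D 0 2 13 13,U 5 0 8 0,U 2 3 9 2,D 3 5 12 12])
(Cut (U 5 2 129 154)
(Cut (U 3 0 166 113)
(Cut (U 5 2 161 120)
(Cut (U 2 3 197 39)
(End [U 0 1 6 6,D 0 2 7 7,U 3 0 9 9,U 1 4 2 2,U 2 3 45 43,U 5 2 9 9,D 3 5 7 7,U 4 5 6 6])
(Cut (U 2 3 189 68)
(End [U 0 1 149 149,D 0 2 165 165,U 3 0 218 218,U 1 4 47 47,U 2 3 1357 1278,U 5 2 221 221,D 3 5 169 169,U 4 5 149 149])
(Cut (U 5 2 183 83)
(Cut (U 4 5 39 197)
(Cut (U 0 1 39 197)
(Cut (U 5 0 104 172)
(End [U 0 1 53 53,D 0 2 25 25,U 5 0 195 183,U 1 2 33 33,U 1 4 3 3,U 2 3 65 65,U 3 4 31 31,D 3 5 24 24,U 4 5 50 50])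
(Cut (U 5 0 83 183)
(End [U 0 1 213 213,U 5 0 1049 1048,U 1 4 63 63,U 4 5 213 213])
(Cut (U 3 0 183 83)
(Cut (U 5 0 28 199)
(Cut (U 2 3 183 83)
(End [U 0 1 35 35,D 0 2 31 31,U 3 0 59 59,U 1 4 10 10,U 2 3 462 440,U 5 2 65 65,D 3 5 33 33,U 4 5 35 35])
(Cut (U 3 4 52 194)
(End [U 0 1 94 107,U 5 0 210 210,U 1 2 25 25,U 2 3 111 111,U 5 2 38 38,U 3 4 69 53,U 4 5 119 119])
(Cut (U 0 1 97 176)
(Cut (U 4 5 97 176)
(Cut (U 1 2 39 197)
(End [U 0 1 55 55,U 3 0 15 15,U 5 0 40 40,U 1 2 18 13,U 2 3 32 32,U 3 4 20 20,U 4 5 36 40])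
(Cut (U 5 2 197 39)
(End [U 0 1 353 353,U 3 0 95 95,U 5 0 258 258,U 1 2 157 157,U 1 4 61 61,U 2 3 174 174,U 5 2 246 246,U 3 4 124 124,D 3 5 14 14,U 4 5 360 360])
(End [U 0 1 491 491,U 3 0 132 132,U 5 0 358 358,U 1 2 125 125,U 1 4 87 87,U 2 3 213 213,U 5 2 274 274,U 3 4 122 122,U 4 5 523 523])))
(End [U 0 1 36 40,U 5 0 40 40,U 1 2 3 3,U 2 3 11 11,U 3 4 16 16,D 3 5 5 5,U 4 5 38 42]))
(End [U 0 1 43 44,U 5 0 47 47,U 1 4 4 4,U 4 5 21 24]))))
(End [U 0 1 23 24,U 3 0 90 90,U 5 0 0 32,U 1 2 16 16,U 2 3 111 105,U 5 2 90 90,U 3 4 16 16,U 4 5 23 24]))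
(End [U 0 1 26 26,U 3 0 69 77,U 1 2 8 8,U 1 4 4 4,U 2 3 37 37,U 5 2 26 26,D 3 5 13 13,U 4 5 14 14]))))
(End [U 0 1 194 195,D 0 2 17 17,U 5 0 48 48,U 1 2 9 9,U 2 3 25 19,U 4 5 54 59]))
(End [U 0 1 27 28,U 5 0 31 31,U 2 3 16 12,U 3 4 5 5,D 3 5 10 10,U 4 5 121 122]))
(End [U 0 1 17 17,D 0 2 19 19,U 3 0 25 25,U 1 4 5 5,U 2 3 46 46,U 5 2 68 80,U 3 4 8 8,U 4 5 26 26]))))
(End [U 0 1 5 7,D 0 2 9 9,U 3 0 8 8,U 2 3 7 7,U 5 2 16 20,U 3 4 1 1,U 4 5 6 8]))
(End [U 0 1 44 62,U 3 0 45 72,U 2 3 55 55,U 5 2 49 49,D 3 5 72 72,U 4 5 44 62]))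
(End [U 0 1 2 3,D 0 2 5 5,U 5 2 0 3,U 4 5 2 3])))
(Cut (D 2 4 193 56)
(End [D 2 4 5 0,U 4 5 6 7])
(Cut (D 2 4 176 97)
(End [D 2 4 4 0,U 5 2 2 2,U 4 5 5 5])
(Cut (D 1 3 120 161)
(Cut (D 2 4 113 166)
(Cut (D 2 4 166 113)
(End [U 0 1 47 47,U 5 0 42 42,U 1 2 30 30,D 2 4 27 0,U 4 5 46 46])
(Cut (U 5 0 129 154)
(Cut (U 2 3 129 154)
(End [U 0 1 84 84,D 0 2 35 35,U 5 0 333 333,U 1 2 69 69,U 2 3 694 694,U 3 4 69 69,D 3 5 32 32,U 4 5 84 84])
(End [U 0 1 105 105,U 5 0 248 248,U 1 2 86 86,U 2 3 161 170,U 3 4 86 86,U 4 5 105 105]))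
(Cut (U 4 5 39 197)
(Cut (D 5 1 129 154)
(Cut (U 1 2 129 154)
(End [U 0 1 388 388,U 5 0 424 424,U 1 2 178 0,D 5 1 58 58,U 2 3 22 22,D 2 4 493 493,U 3 4 18 18,U 4 5 499 499])
(Cut (U 3 4 104 172)
(End [U 0 1 41 41,U 5 0 45 45,U 1 2 40 40,D 1 3 27 27,D 5 1 5 0,U 2 3 38 38,U 5 2 2 2,U 3 4 83 83,U 4 5 65 65])
(Cut (U 1 2 104 172)
(End [U 0 1 19 19,U 3 0 1 1,U 5 0 20 20,U 1 2 93 93,D 5 1 7 7,U 2 3 20 20,D 2 4 9 9,U 3 4 27 27,D 3 5 2 2,U 4 5 23 23])
(End [U 0 1 299 310,U 5 0 341 341,U 1 2 393 393,U 1 4 25 25,U 2 3 260 288,U 3 4 393 393,U 4 5 380 414]))))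
(End [U 0 1 29 29,U 5 0 32 32,D 5 1 16 32]))
(End [U 0 1 191 198,U 5 0 218 218,U 1 2 52 52,D 1 3 136 136,U 2 3 63 63,U 3 4 48 48,D 3 5 64 64,U 4 5 866 866]))))
(End [U 2 3 8 8,D 2 4 15 20,U 3 4 7 7]))
(End [U 1 2 19 19,D 1 3 22 35,U 2 3 21 21])))))))
(End [U 3 4 10 10,D 3 5 16 23,U 4 5 11 11]))))
(End [U 1 2 3 3,D 1 3 7 11,U 2 3 3 3])))
(End [U 0 1 27 27,D 0 2 47 62,U 1 2 13 13,U 4 5 7 10]))
(End [U 0 1 3 3,D 0 2 5 7,U 1 2 2 2])))
(End [U 3 4 9 9,D 3 5 12 22,U 4 5 8 8]))
(End [U 2 3 8 8,D 2 4 12 22,U 3 4 9 9]))))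
(End [U 3 0 0 3,D 4 0 1 1,D 3 5 1 1,U 4 5 1 1])))
(End [U 0 1 1 1,D 0 2 1 1,D 5 1 1 1,U 5 2 0 3]))))))
(End [D 1 2 1 1,D 1 3 1 1,U 1 4 0 5,U 2 3 1 1,D 2 4 2 2]))"

lemma proves_014523: "proves [0, 1, 4, 5, 2, 3] quadrant tree_014523"
  by code_simp

lemma hits_014523: "hits tree_014523 = []"
  by code_simp

text \<open>Its four \<open>Near\<close> leaves are the boxes of \<open>optimal_near_024153\<close>.
  The lower refutation at centre 0 and the upper one at centre 502 are empty, since they leave the
  range [0, 1] of a sorted coordinate.\<close>

definition tree_024153 :: tree where
  "tree_024153 =
Cut (U 0 1 186 76)
(End [U 0 1 13 7,D 3 0 5 5,D 1 3 5 5])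
(Cut (U 1 2 186 76)
(End [U 1 2 13 7,D 5 1 5 5,D 2 5 5 5])
(Cut (D 0 2 186 76)
(End [D 0 2 13 7,U 4 0 5 5,U 2 4 5 5])
(Cut (U 4 0 76 186)
(Cut (U 2 4 76 186)
(Cut (D 0 2 56 193)
(Cut (D 3 4 186 76)
(End [U 0 3 8 8,U 4 0 9 9,D 3 4 22 12])
(Cut (D 4 5 186 76)
(End [U 2 4 9 9,U 5 2 8 8,D 4 5 22 12])
(Cut (D 1 3 76 186)
(Cut (D 5 1 76 186)
(Cut (D 5 0 186 76)
(End [U 0 1 7 7,D 5 0 12 0,D 1 3 3 3,U 3 5 3 3])
(Cut (U 2 3 186 76)
(End [D 0 2 2 2,U 4 0 1 1,U 2 3 3 0,D 3 4 1 1])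
(Cut (U 2 3 154 129)
(Cut (D 0 2 136 148)
(End [D 0 2 46 46,D 3 0 13 13,U 4 0 4 4,U 2 3 26 0,D 3 4 6 6])
(End [U 0 1 108 108,D 0 2 1379 1379,D 3 0 376 376,U 1 2 108 108,U 2 3 586 0]))
(Cut (U 4 0 129 154)
(Cut (U 2 4 129 154)
(Cut (D 0 2 104 172)
(Cut (U 0 1 154 129)
(Cut (U 5 2 76 186)
(Cut (D 3 4 113 166)
(End [U 0 1 34 17,U 4 0 20 3,D 1 3 17 17,D 3 4 33 31])
(Cut (D 1 3 166 113)
(Cut (D 3 0 142 142)
(End [U 0 1 180 117,D 3 0 101 101,D 1 3 127 127])
(End [U 0 1 47 0,D 3 0 51 51,U 4 0 20 13,D 1 3 54 54]))
(End [U 0 1 106 27,D 3 0 47 47,U 4 0 14 0,U 1 2 9 9,D 1 3 144 144,U 2 4 7 7,D 3 4 31 31])))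
(End [D 0 2 4 4,D 5 0 1 1,D 5 1 1 1,U 5 2 0 4]))
(Cut (U 1 2 154 129)
(Cut (U 4 0 161 120)
(Cut (D 4 5 113 166)
(End [U 1 2 34 17,D 5 1 17 17,U 2 4 20 3,D 4 5 33 31])
(Cut (D 1 3 129 154)
(Cut (D 5 1 161 120)
(Cut (D 2 5 142 142)
(End [U 1 2 300 195,D 5 1 199 199,D 2 5 168 168])
(End [U 1 2 26 0,D 5 1 28 28,U 2 4 11 7,D 2 5 28 28]))
(End [U 0 1 18 18,U 4 0 11 11,U 1 2 29 11,D 5 1 42 52,U 2 4 19 0,D 4 5 46 46]))
(End [U 1 2 89 89,D 1 3 0 26,D 5 1 4 4,U 2 3 18 18,U 2 4 2 2,D 3 4 3 3,D 4 5 4 4])))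
(End [U 0 1 8 8,U 4 0 26 28,U 1 2 25 24,D 5 1 4 4,U 2 4 9 9,D 4 5 3 3]))
(Cut (U 5 2 76 186)
(Cut (U 5 2 129 154)
(Cut (D 1 3 129 154)
(Cut (D 4 5 154 129)
(Cut (U 2 4 183 83)
(Cut (U 5 2 183 83)
(End [U 2 4 7 7,U 5 2 7 7,D 4 5 8 6])
(End [U 2 4 88 88,U 5 2 103 103,D 4 5 76 33]))
(End [U 2 4 93 93,U 5 2 43 43,D 4 5 69 30]))
(Cut (D 5 0 154 129)
(Cut (U 3 5 142 142)
(End [U 0 1 5 5,U 0 3 4 4,D 5 0 10 0,D 1 3 3 3,U 3 5 9 9])
(End [U 0 1 111 111,D 0 2 38 38,D 5 0 91 0,U 1 2 41 41,D 1 3 33 1,U 2 4 43 43,D 3 4 17 17,U 3 5 51 51]))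
(Cut (D 3 4 154 129)
(Cut (U 0 3 142 142)
(Cut (U 4 0 183 83)
(End [U 0 3 128 128,U 4 0 219 219,D 3 4 228 148])
(End [U 0 1 10 10,U 0 3 20 20,U 4 0 50 50,U 1 2 10 10,U 2 3 10 10,D 3 4 37 16]))
(End [D 0 2 9 9,U 0 3 0 13,U 4 0 6 6,U 1 2 5 5,D 1 3 10 10,D 3 4 7 0]))
(Cut (D 3 0 76 186)
(Cut (D 3 0 129 154)
(Cut (D 5 1 129 154)
(Cut (D 3 4 129 154)
(Cut (D 1 3 197 39)
(End [U 0 1 3 3,U 4 0 4 4,D 1 3 15 12,D 3 4 4 0])
(Cut (D 0 2 172 104)
(End [D 0 2 10 8,U 4 0 3 3,U 2 4 3 3])
(Cut (U 0 1 129 154)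
(End [U 0 1 24 12,U 4 0 14 14,D 1 3 19 19,D 3 4 29 18])
(Cut (U 3 5 186 76)
(End [D 1 3 4 4,D 5 1 3 3,U 3 5 6 4])
(Cut (U 3 5 113 166)
(Cut (U 2 3 129 154)
(End [U 0 1 54 54,D 0 2 58 58,U 4 0 42 42,U 1 2 40 40,U 2 3 189 173,D 3 4 107 75,D 4 5 5 5])
(Cut (U 0 3 142 142)
(Cut (U 4 0 183 83)
(Cut (D 5 1 183 83)
(Cut (U 0 3 197 39)
(End [U 0 3 6 3,U 4 0 3 0,D 3 4 15 16])
(Cut (D 1 3 189 68)
(End [U 0 1 3 3,U 4 0 19 19,D 1 3 49 45,D 3 4 28 21])
(Cut (U 2 4 197 39)
(End [D 0 2 5 5,U 4 0 4 2,U 2 4 9 7])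
(Cut (U 1 2 83 183)
(Cut (D 1 3 148 136)
(Cut (U 3 5 154 129)
(End [D 1 3 17 17,D 5 1 14 14,U 3 5 13 7])
(Cut (U 0 3 189 68)
(End [U 0 3 256 196,U 4 0 117 58,D 3 4 390 390])
(Cut (D 1 3 183 83)
(End [U 0 1 6 6,U 4 0 42 42,D 1 3 186 176,D 3 4 62 47])
(Cut (D 0 2 129 154)
(Cut (U 2 4 189 68)
(End [D 0 2 153 153,U 4 0 92 51,U 2 4 207 165])
(Cut (D 5 1 200 20)
(End [D 0 2 118 118,U 0 3 206 206,U 4 0 255 255,U 1 2 277 277,D 1 3 147 147,D 5 1 1137 1059,U 2 4 243 243,D 3 4 399 399,U 3 5 353 353])
(Cut (U 1 2 113 166)
(Cut (U 2 4 183 83)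
(End [U 0 1 39 39,D 0 2 86 86,U 4 0 74 74,U 1 2 108 108,D 5 1 34 34,U 2 4 499 487,D 4 5 4 4])
(Cut (D 1 3 161 120)
(Cut (D 5 1 189 68)
(Cut (D 5 1 199 28)
(End [D 0 2 22 22,U 0 3 38 38,U 4 0 47 47,U 1 2 138 138,D 1 3 108 108,D 5 1 1083 1061,U 2 4 87 87,D 3 4 155 155,U 3 5 80 80])
(Cut (U 2 4 148 136)
(Cut (U 3 5 129 154)
(Cut (U 4 0 200 20)
(End [D 0 2 9 9,U 4 0 234 231,U 1 2 40 40,D 1 3 75 75,U 2 4 36 36,D 3 4 90 86])
(Cut (D 1 3 166 113)
(Cut (D 5 1 193 56)
(Cut (U 4 0 189 68)
(Cut (D 0 2 142 142)
(End [D 0 2 77 46,U 4 0 272 272,U 1 2 63 63,D 1 3 153 153,U 2 4 160 160,D 3 4 147 140])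
(Cut (U 0 1 39 197)
(End [U 0 1 7 0,U 4 0 28 25,D 1 3 40 38,D 3 4 35 31])
(Cut (U 1 2 129 154)
(Cut (U 2 4 176 97)
(End [U 0 1 1095 1095,D 0 2 2648 2648,U 4 0 753 753,U 1 2 1438 1438,D 5 1 1127 1127,U 2 4 3983 3839,D 4 5 44 44])
(Cut (D 1 3 176 97)
(End [U 0 1 132 132,U 4 0 468 468,D 1 3 5179 5026,D 5 1 2240 2240,D 3 4 1870 1870,U 3 5 1538 1538,D 4 5 337 337])
(Cut (D 3 4 142 142)
(End [D 0 2 15 15,U 0 3 31 31,U 4 0 114 114,U 1 2 46 46,D 1 3 115 115,U 2 4 34 34,D 3 4 168 153])
(Cut (D 5 1 197 39)
(End [U 1 2 99 99,D 1 3 182 182,D 5 1 469 461,U 2 4 70 73,D 3 4 190 190,U 3 5 26 26])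
(Cut (U 3 5 136 148)
(End [U 1 2 103 103,D 1 3 510 510,D 5 1 631 631,U 2 4 73 76,D 3 4 198 198,U 3 5 108 79])
(Cut (U 2 4 166 113)
(Cut (U 4 0 194 52)
(Cut (D 3 4 136 148)
(Cut (U 0 3 183 83)
(End [U 0 3 3 0,U 4 0 6 3,D 3 4 63 64])
(End [D 0 2 141 141,U 0 3 198 198,U 4 0 1045 1045,U 1 2 309 309,D 1 3 772 772,U 2 4 589 589,D 3 4 1970 1884]))
(Cut (U 1 2 136 148)
(End [U 0 1 915 915,U 4 0 5950 5950,U 1 2 6051 5893,D 1 3 5764 5764,D 5 1 2187 2187,U 2 4 8459 8459,D 3 4 11802 11802,U 3 5 3568 3568,D 4 5 219 219])
(Cut (D 1 3 172 104)
(Cut (U 2 4 172 104)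
(Near [(0,(3622,[U 0 1 48 48,D 0 2 76 76,U 4 0 148 148,U 1 2 421 421,D 1 3 330 330,D 5 1 60 60,U 2 4 491 491,D 3 4 287 287,U 3 5 98 98,D 4 5 6 6]),(64062128,[])),
(133,(7114,[U 0 1 41 41,U 4 0 265 265,U 1 2 227 227,U 2 4 1016 1002]),(349,[U 0 1 5 5,D 0 2 15 15,U 1 2 28 28])),
(174,(4092,[U 0 1 44 44,D 0 2 60 60,U 4 0 156 156,U 1 2 333 333,D 1 3 444 444,D 5 1 290 290,U 2 4 388 388,D 3 4 727 727,U 3 5 473 473,D 4 5 29 29]),(405,[D 1 3 44 43])),
(307,(978,[U 4 0 30 29]),(1199,[U 0 1 6 6,D 0 2 18 18,U 1 2 99 99,D 1 3 70 71,U 2 4 115 115,D 3 4 66 66])),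
(307,(4512,[U 0 1 54 54,D 0 2 80 80,U 4 0 178 178,U 1 2 444 444,D 1 3 672 672,D 5 1 421 421,U 2 4 518 518,D 3 4 584 584,U 3 5 200 200,D 4 5 20 20]),(1050,[U 0 1 4 4,D 0 2 12 12,U 1 2 64 64,D 1 3 75 75,U 2 4 75 75,D 3 4 65 65,U 3 5 22 22,D 4 5 1 1])),
(101,(8731,[D 0 2 318 318,U 4 0 766 766,U 1 2 1769 1769,D 1 3 4253 4253,D 5 1 1158 1158,U 2 4 2061 2061,D 3 4 3072 3072,U 3 5 1889 1889,D 4 5 116 116]),(24695,[U 0 1 1159 1159,D 0 2 1288 1288,U 4 0 628 628,U 1 2 7162 7162,D 1 3 5927 5927,D 5 1 4695 4695,U 2 4 8347 8347,D 3 4 6915 6915,D 4 5 122 122])),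
(201,(5006,[D 0 2 203 203,U 4 0 395 395,U 1 2 1127 1127,D 1 3 883 883,D 5 1 161 161,U 2 4 1314 1314,D 3 4 767 767,U 3 5 263 263,D 4 5 16 16]),(4624,[U 0 1 112 112,U 4 0 13 11,D 1 3 64 64,D 3 4 53 52])),
(251,(12232,[D 0 2 434 434,U 4 0 1099 1099,U 1 2 2411 2411,D 1 3 5623 5623,D 5 1 1404 1404,U 2 4 2810 2810,D 3 4 4887 4887,U 3 5 1674 1674,D 4 5 192 192]),(3194,[U 0 1 144 144,D 0 2 152 152,U 4 0 75 75,U 1 2 844 844,D 1 3 573 573,D 5 1 500 500,U 2 4 984 984,D 3 4 498 498,U 3 5 171 171])),
(352,(1548,[D 0 2 101 101,U 4 0 38 38,U 2 4 146 144]),(12972,[U 0 1 396 396,U 4 0 414 414,U 1 2 2208 2208,U 2 4 1588 1566])),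
(452,(7645,[D 0 2 253 253,U 4 0 726 726,U 1 2 1407 1407,D 1 3 3012 3012,D 5 1 549 549,U 2 4 1640 1640,D 3 4 2618 2618,U 3 5 896 896,D 4 5 55 55]),(3132,[U 0 1 16 16,D 0 2 16 16,U 4 0 14 0,U 1 2 89 89,U 2 4 104 104]))])
(End [U 0 1 86 86,U 4 0 560 560,U 1 2 1528 1528,D 1 3 2244 2244,D 5 1 409 409,U 2 4 1238 1257,D 3 4 1950 1950,U 3 5 668 668,D 4 5 41 41]))
(End [U 0 1 203 203,D 0 2 508 508,U 4 0 216 216,U 1 2 3206 3206,D 1 3 2737 2779,D 5 1 2276 2276,U 2 4 1584 1584,D 3 4 3378 3378,D 4 5 59 59]))))
(End [U 0 1 853 853,D 0 2 504 504,U 4 0 959 1072,U 1 2 1103 1103,D 5 1 1422 1422,U 2 4 2102 2102,D 4 5 37 37]))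
(End [U 1 2 753 753,D 1 3 3729 3729,D 5 1 4617 4617,U 2 4 897 913,D 3 4 3959 3959,U 3 5 2026 2026,D 4 5 212 212])))))))
(End [U 0 1 336 336,D 0 2 813 813,U 4 0 231 231,U 1 2 506 562,D 1 3 130 130,U 2 4 136 136,D 3 4 125 119]))))
(End [U 0 1 26 26,U 4 0 143 156,U 1 2 74 74,D 5 1 54 54,U 2 4 60 65,D 4 5 2 2]))
(End [U 0 1 60 60,U 4 0 455 455,D 1 3 2582 2582,D 5 1 4845 5012,D 3 4 2427 2427,U 3 5 671 671,D 4 5 444 444]))
(End [D 0 2 33 33,U 0 3 85 85,U 4 0 151 151,U 1 2 152 152,D 1 3 19 56,U 2 4 137 137,D 3 4 90 90])))
(End [D 3 4 63 63,U 3 5 9 20,D 4 5 10 10]))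
(End [U 4 0 6 6,U 1 2 0 23,D 1 3 107 113,U 2 4 8 31,D 3 4 138 138])))
(End [U 0 1 4 4,U 4 0 28 28,D 1 3 96 96,D 5 1 126 136,D 3 4 116 111,D 4 5 17 17]))
(End [D 0 2 16 16,U 0 3 45 45,U 4 0 79 79,U 1 2 101 101,D 1 3 70 90,U 2 4 64 64,D 3 4 81 81])))
(End [U 0 1 29 29,D 0 2 64 64,U 4 0 55 55,U 1 2 111 124,D 1 3 30 30,U 2 4 34 34,D 3 4 54 52]))))
(End [U 0 1 44 44,D 0 2 51 85,U 1 2 80 80])))))
(End [D 0 2 10 10,U 0 3 22 22,U 4 0 36 35,U 1 2 28 28,D 1 3 9 21,U 2 4 19 19,D 3 4 31 31]))
(End [U 0 1 2 2,D 0 2 17 17,U 4 0 15 9,U 1 2 7 14,D 1 3 14 14,D 3 4 43 42])))))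
(End [U 0 1 14 14,U 4 0 99 99,D 1 3 109 109,D 5 1 89 113,D 3 4 408 390,D 4 5 60 60]))
(Cut (U 1 2 52 194)
(Cut (U 2 4 183 83)
(Cut (U 0 1 104 172)
(End [U 0 1 81 77,U 4 0 29 29,U 1 2 19 19,D 1 3 8 8,U 2 3 14 14,U 2 4 7 7,D 3 4 10 0,D 4 5 1 1])
(Cut (U 0 1 83 183)
(End [U 0 1 408 386,U 4 0 116 116,U 1 2 77 77,D 1 3 31 31,D 5 1 2 2,U 2 3 57 57,U 2 4 28 28,D 3 4 40 0,D 4 5 4 4])
(Cut (U 1 2 136 148)
(End [U 0 1 11 11,U 4 0 7 10,U 1 2 52 48,D 5 1 8 8,U 2 4 18 18,D 4 5 4 4])
(Cut (U 1 2 76 186)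
(Cut (D 0 2 129 154)
(Cut (U 4 0 166 113)
(End [U 0 1 359 359,D 0 2 366 366,U 4 0 826 826,U 1 2 381 381,D 5 1 52 52,U 2 4 395 395,D 4 5 45 45])
(End [U 0 1 808 808,D 0 2 612 612,U 4 0 1101 1101,U 1 2 681 681,D 1 3 11 11,D 5 1 82 82,U 2 3 19 19,U 2 4 670 670,D 3 4 14 0,D 4 5 175 175]))
(End [U 0 1 37 37,D 0 2 41 52,U 4 0 0 3,U 1 2 43 43,D 5 1 6 6,U 2 4 8 8,D 4 5 3 3]))
(End [U 0 1 269 269,D 0 2 156 156,U 4 0 218 218,U 1 2 943 999,D 1 3 67 67,U 2 3 123 123,U 2 4 23 23,D 3 4 88 0])))))
(End [U 0 1 34 34,U 4 0 37 50,U 1 2 38 38,D 5 1 6 6,U 2 4 45 53,D 4 5 3 3]))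
(End [U 0 1 58 58,D 0 2 45 45,U 4 0 82 82,U 1 2 173 183,D 1 3 30 30,U 2 3 50 50,D 3 4 45 9])))
(End [D 0 2 39 39,U 0 3 0 26,U 4 0 9 9,U 1 2 0 18,D 1 3 41 41,U 2 4 2 2,D 3 4 7 0])))
(End [D 3 4 21 20,U 3 5 0 4,D 4 5 3 3]))))))
(Cut (U 3 5 186 76)
(End [D 1 3 2 2,D 5 1 2 2,U 3 5 4 3])
(Cut (U 3 5 113 166)
(Cut (D 5 1 161 120)
(Cut (D 4 5 52 194)
(Cut (D 1 3 183 83)
(Cut (U 3 5 154 129)
(End [D 1 3 17 17,D 5 1 12 11,U 3 5 20 15])
(Cut (D 0 2 172 104)
(End [D 0 2 10 8,U 4 0 3 3,U 2 4 3 3])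
(Cut (D 0 2 161 120)
(End [D 0 2 19 16,U 4 0 4 4,U 2 4 4 4])
(Cut (D 3 0 197 39)
(End [U 0 1 6 6,D 3 0 11 6,D 1 3 5 0])
(Cut (D 4 5 136 148)
(Cut (D 1 3 200 20)
(End [D 1 3 300 265,D 5 1 50 7,U 3 5 162 162])
(Cut (U 2 4 183 83)
(Cut (U 4 0 197 39)
(End [D 0 2 8 8,U 4 0 11 8,U 2 4 5 2])
(Cut (U 5 2 183 83)
(End [U 2 4 17 17,U 5 2 17 17,D 4 5 33 27])
(Cut (U 4 0 154 129)
(Cut (D 5 1 183 83)
(End [U 1 2 2 2,D 5 1 17 14,U 2 4 17 17,D 4 5 33 27])
(Cut (U 0 1 83 183)
(Cut (U 2 4 194 52)
(Cut (U 5 2 172 104)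
(End [U 2 4 167 167,U 5 2 355 340,D 4 5 226 192])
(Cut (U 4 0 183 83)
(End [D 0 2 22 22,U 4 0 19 11,U 2 4 22 15])
(Cut (U 0 1 136 148)
(End [U 0 1 6174 6016,U 4 0 2993 2993,D 5 1 3946 3946,U 2 4 6468 6468,U 5 2 1053 1053,D 4 5 6850 6319])
(Cut (D 0 2 148 136)
(End [U 0 1 0 3,D 0 2 55 49,U 4 0 24 24,D 5 1 20 20,U 2 4 36 36,D 4 5 33 32])
(End [U 0 1 52 163,D 0 2 406 406,D 5 1 812 812,U 2 4 1159 1159,U 5 2 604 604,D 4 5 1569 1333])))))
(End [U 2 4 412 434,U 5 2 164 164,D 4 5 124 52]))
(End [U 0 1 4 7,D 0 2 10 10,U 1 2 1 1,D 5 1 17 17,U 2 4 5 5,U 5 2 0 3,D 4 5 9 7])))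
(End [U 0 1 8 8,D 3 0 29 29,U 4 0 0 21,U 1 2 3 3,D 1 3 65 65,D 5 1 48 48,U 2 4 27 27,U 3 5 21 21,D 4 5 213 206]))))
(End [U 1 2 121 121,D 1 3 142 142,D 5 1 147 37,U 2 4 179 228,D 3 4 19 19,D 4 5 119 0])))
(Cut (D 1 3 200 20)
(End [D 1 3 300 265,D 5 1 50 7,U 3 5 162 162])
(Cut (U 2 4 161 120)
(Cut (U 0 1 52 194)
(Cut (D 3 0 189 68)
(Cut (D 5 1 189 68)
(End [U 1 2 4 4,D 1 3 177 176,D 5 1 189 189,U 2 4 14 14,D 3 4 84 84,U 3 5 195 195,D 4 5 122 122])
(End [U 0 1 69 69,D 3 0 101 61,U 1 2 8 8,D 1 3 364 364,D 5 1 427 427,U 2 4 31 31,D 3 4 186 186,U 3 5 263 263,D 4 5 271 271]))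
(Cut (D 3 0 148 136)
(Cut (U 0 1 142 142)
(Cut (U 4 0 183 83)
(End [U 0 1 38 33,U 4 0 14 11,D 1 3 18 18,D 3 4 2 2])
(End [U 0 1 225 196,D 3 0 74 74,U 4 0 23 23,D 1 3 106 106,U 3 5 30 30,D 4 5 2 10]))
(Cut (D 0 2 120 161)
(Cut (U 4 0 183 83)
(Cut (U 1 2 83 183)
(End [U 0 1 30 28,D 0 2 40 40,U 4 0 42 42,U 1 2 34 34,U 2 4 29 27])
(Cut (U 2 4 189 68)
(End [U 0 1 158 158,D 0 2 310 310,U 4 0 252 237,U 1 2 187 187,D 1 3 77 77,U 2 4 236 236,D 3 4 10 10])
(Cut (U 0 1 129 154)
(End [U 0 1 70 59,U 4 0 29 23,D 1 3 38 38,D 3 4 5 5])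
(End [U 0 1 55 55,D 0 2 75 75,U 4 0 64 64,U 1 2 65 65,D 1 3 18 22,U 2 4 82 82,D 3 4 9 9]))))
(Cut (D 5 1 193 56)
(End [D 1 3 6 3,D 5 1 8 5,U 3 5 12 12])
(Cut (U 2 4 183 83)
(Cut (U 3 5 129 154)
(Cut (D 5 1 183 83)
(End [U 1 2 3 3,D 1 3 191 191,D 5 1 491 480,U 2 4 22 22,D 3 4 87 87,U 3 5 318 318,D 4 5 128 128])
(Cut (U 0 1 104 172)
(Cut (D 1 3 189 68)
(Cut (U 4 0 161 120)
(Cut (D 1 3 199 28)
(End [U 0 1 35 35,U 4 0 35 38,D 1 3 136 129,D 5 1 5 5,U 3 5 49 49,D 4 5 3 11])
(Cut (D 5 1 166 113)
(Cut (U 2 4 200 20)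
(End [U 0 1 18 18,D 0 2 31 31,D 3 0 20 20,U 4 0 12 12,D 1 3 44 44,D 5 1 46 48,U 2 4 63 56,U 3 5 16 16,D 4 5 18 18])
(Cut (U 0 1 120 161)
(Cut (U 2 4 189 68)
(Cut (D 1 3 197 39)
(End [U 0 1 2816 2816,D 0 2 461 461,U 4 0 1957 1957,U 1 2 169 169,D 1 3 3216 3003,U 2 4 647 647,U 3 5 1437 1437,D 4 5 23 273])
(Cut (D 0 2 142 142)
(End [U 0 1 28 28,D 0 2 117 96,D 3 0 19 19,U 4 0 117 117,D 1 3 57 57,D 5 1 42 44,U 2 4 106 106,U 3 5 13 13,D 4 5 17 17])
(Cut (D 4 5 120 161)
(Cut (U 4 0 166 113)
(Cut (U 2 4 197 39)
(End [U 0 1 73 73,D 0 2 232 232,D 3 0 85 85,D 1 3 279 279,D 5 1 226 226,U 2 4 206 177,D 3 4 6 6,U 3 5 81 81,D 4 5 366 366])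
(Cut (D 5 1 176 97)
(End [U 1 2 22 22,D 1 3 1232 1232,D 5 1 2963 2885,U 2 4 422 422,D 3 4 259 259,U 3 5 942 942,D 4 5 1877 1877])
(Cut (D 1 3 194 52)
(Cut (U 3 5 136 148)
(End [U 0 1 488 488,D 0 2 167 167,U 4 0 415 415,U 1 2 34 34,D 1 3 1907 1907,D 5 1 1123 1123,U 2 4 194 194,U 3 5 255 188,D 4 5 344 344])
(Cut (D 0 2 136 148)
(End [U 0 1 42 42,D 0 2 716 662,D 3 0 37 37,U 4 0 342 342,D 1 3 245 245,D 5 1 165 165,U 2 4 422 422,U 3 5 111 111,D 4 5 152 152])
(Cut (U 1 2 52 194)
(End [U 0 1 26 26,D 0 2 0 4,U 1 2 7 6])
(Cut (U 4 0 176 97)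
(End [U 0 1 398 398,D 0 2 501 501,U 4 0 839 811,U 1 2 196 196,D 1 3 476 476,U 2 4 272 272,D 3 4 11 11])
(Cut (U 5 2 197 39)
(End [U 2 4 6 0,U 5 2 7 0,D 4 5 52 54])
(Cut (U 5 2 189 68)
(End [U 2 4 3 0,U 5 2 3 0,D 4 5 25 26])
(Cut (U 5 2 183 83)
(End [U 0 1 41 41,U 4 0 59 61,U 1 2 20 20,D 1 3 49 49,U 2 4 28 28,U 5 2 22 17,D 3 4 1 1,D 4 5 52 52])
(Cut (U 5 2 161 120)
(Cut (D 5 1 172 104)
(Cut (U 5 2 176 97)
(End [U 0 1 932 932,D 0 2 391 391,U 4 0 1424 1424,U 1 2 458 458,D 1 3 1115 1115,U 2 4 636 636,U 5 2 261 183,D 3 4 26 26,D 4 5 781 781])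
(Cut (U 5 2 172 104)
(Cut (U 2 4 194 52)
(Cut (U 0 1 136 148)
(End [U 0 1 3378 3345,U 4 0 1559 1559,U 1 2 152 152,D 1 3 535 535,D 5 1 2323 2323,U 2 4 2635 2635,D 3 4 53 53,U 3 5 745 745,D 4 5 907 907])
(Cut (D 4 5 129 154)
(Cut (U 4 0 172 104)
(Near [(133,(4386,[U 0 1 78 78,U 4 0 661 653,U 1 2 24 24,U 2 4 415 415]),(2914,[U 0 1 210 210,D 0 2 148 148,U 4 0 248 248,U 1 2 56 56,D 1 3 29 29,D 5 1 136 136,U 2 4 178 178,D 3 4 3 3,U 3 5 41 41,D 4 5 119 119])),
(133,(4386,[U 0 1 78 78,U 4 0 661 653,U 1 2 24 24,U 2 4 415 415]),(338,[U 0 1 13 13,D 0 2 13 13,U 1 2 4 4])),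
(328,(405,[U 4 0 44 43]),(3252,[U 0 1 203 203,D 0 2 153 153,U 4 0 197 197,U 1 2 58 58,D 1 3 340 340,D 5 1 313 313,U 2 4 185 185,D 3 4 13 13,U 3 5 93 93,D 4 5 272 272])),
(328,(405,[U 4 0 44 43]),(3853,[U 0 1 148 148,D 0 2 148 148,U 1 2 53 53,D 1 3 120 120,U 2 4 174 173,D 3 4 3 3])),
(461,(1080,[U 0 1 72 72,U 4 0 288 288,U 1 2 8 8,D 5 1 184 184,U 2 4 193 193,U 5 2 41 41,D 4 5 82 82]),(1877,[U 0 1 99 99,D 0 2 82 82,U 4 0 68 68,U 1 2 31 31,D 1 3 132 132,D 5 1 93 93,U 2 4 99 99,D 3 4 13 13,U 3 5 184 184,D 4 5 237 237])),
(101,(1650,[U 0 1 84 84,D 0 2 101 101,U 4 0 345 345,U 1 2 28 28,D 1 3 91 91,D 5 1 40 40,U 2 4 231 231,U 5 2 213 213,U 3 5 197 197,D 4 5 98 98]),(10151,[U 0 1 1184 1184,U 4 0 2199 2199,U 1 2 125 125,D 1 3 1162 1162,D 5 1 3983 3983,U 2 4 2167 2167,D 3 4 170 170,U 3 5 1185 1185,D 4 5 3461 3461])),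
(150,(3028,[D 0 2 129 129,U 4 0 240 240,U 1 2 49 49,D 1 3 8 7,D 5 1 79 79,U 2 4 161 161,U 3 5 23 23,D 4 5 68 68]),(951,[U 0 1 34 37])),
(251,(657,[D 0 2 28 28,U 4 0 52 52,U 2 4 51 49,U 5 2 54 54,D 4 5 63 63]),(6591,[U 0 1 769 769,U 4 0 1428 1428,U 1 2 77 77,D 1 3 931 931,D 5 1 2775 2775,U 2 4 1332 1332,D 3 4 92 92,U 3 5 1297 1297,D 4 5 1941 1941])),
(352,(1221,[U 0 1 3 3,D 0 2 53 53,U 4 0 104 104,D 5 1 11 11,U 2 4 70 70,U 5 2 1 0,D 4 5 30 30]),(2025,[U 0 1 156 156,U 4 0 248 245,U 1 2 48 48,U 2 4 156 156])),
(401,(2271,[D 0 2 97 97,U 4 0 180 180,U 2 4 70 61]),(23074,[U 0 1 615 615,U 4 0 77 0,U 1 2 70 70,D 1 3 395 395,D 5 1 1846 1846,U 2 4 1215 1215,D 3 4 39 39,U 3 5 549 549,D 4 5 1604 1604]))])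
(End [U 0 1 1183 1183,U 4 0 2124 2160,U 1 2 135 135,D 1 3 758 758,D 5 1 3549 3549,U 2 4 2335 2335,D 3 4 75 75,U 3 5 1056 1056,D 4 5 3084 3084]))
(End [U 0 1 329 329,D 0 2 107 107,U 4 0 354 354,U 1 2 40 40,D 1 3 248 228,U 2 4 129 129,D 3 4 8 8,U 3 5 601 601,D 4 5 80 107])))
(End [U 0 1 6315 6315,D 0 2 2650 2650,U 4 0 9652 9652,U 1 2 3108 3108,D 1 3 7556 7556,U 2 4 10669 11256,U 5 2 11998 11998,D 3 4 747 747,U 3 5 10522 10522,D 4 5 1604 1604]))
(End [U 0 1 1259 1259,D 0 2 529 529,U 4 0 1925 1925,D 1 3 2267 2267,D 5 1 8627 8627,U 2 4 1673 1673,U 5 2 0 127,D 3 4 224 224,U 3 5 3156 3156,D 4 5 2173 2173])))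
(End [U 0 1 809 809,D 0 2 291 291,U 4 0 1227 1232,D 1 3 311 311,D 5 1 0 109,U 2 4 748 748,U 5 2 484 484,D 3 4 7 7,D 4 5 506 506]))
(End [U 0 1 42 42,D 0 2 7 13,D 5 1 56 58,U 5 2 0 6])))))))))
(End [U 1 2 190 190,D 1 3 13869 14596,D 5 1 18122 18122,U 2 4 3650 3650,D 3 4 2242 2242,U 3 5 3149 3149,D 4 5 16247 16247]))))
(End [U 0 1 68 68,D 3 0 57 57,U 4 0 0 23,D 1 3 169 169,D 5 1 140 142,U 2 4 9 9,U 3 5 40 40,D 4 5 234 234]))
(End [U 0 1 24 23,U 4 0 17 17,D 1 3 86 86,D 5 1 62 62,D 3 4 18 18,U 3 5 66 66,D 4 5 31 36]))))
(End [U 0 1 135 135,U 4 0 83 89,U 1 2 21 21,D 1 3 26 26,U 2 4 156 168,D 3 4 2 2]))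
(End [U 0 1 872 908,D 0 2 245 245,U 4 0 374 374,U 1 2 95 95,D 1 3 154 154,D 5 1 306 306,U 2 4 268 268,D 3 4 44 44,U 3 5 164 164,D 4 5 111 111])))
(End [U 0 1 242 242,U 4 0 243 264,D 1 3 21 21,D 5 1 0 57,D 3 4 2 2,D 4 5 28 80])))
(End [U 0 1 11 11,D 3 0 12 12,U 4 0 3 8,D 1 3 22 22,D 5 1 22 23,U 3 5 10 10,D 4 5 11 11]))
(End [U 1 2 1 1,D 1 3 258 264,D 5 1 114 114,U 2 4 9 9,D 3 4 35 35,U 3 5 73 73,D 4 5 52 52]))
(End [U 0 1 91 98,D 0 2 67 67,U 4 0 50 50,U 1 2 24 24,D 5 1 37 42,U 2 4 54 54,D 4 5 21 21])))
(End [D 3 4 15 15,U 3 5 40 50,D 4 5 23 23]))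
(End [U 0 1 25 25,U 4 0 24 29,U 1 2 15 15,D 1 3 3 3,U 2 4 45 52]))))
(End [U 0 1 10 10,D 0 2 20 25,U 1 2 6 6])))
(End [D 0 2 92 92,D 3 0 0 89,U 4 0 110 110,U 1 2 53 53,D 1 3 13 23,D 5 1 37 0,U 2 4 72 72,U 3 5 268 268,D 4 5 0 37])))
(Cut (D 3 4 68 189)
(End [U 0 1 4 4,U 4 0 1 1,D 1 3 100 101,D 5 1 52 52,D 3 4 89 89,U 3 5 86 86,D 4 5 67 67])
(End [U 0 1 92 126,D 0 2 115 115,U 1 2 21 21,D 1 3 209 209,D 5 1 172 172,U 2 4 62 33,D 3 4 224 224,U 3 5 284 284,D 4 5 221 221])))
(Cut (D 3 4 39 197)
(End [D 1 3 107 109,D 5 1 56 56,D 3 4 70 68,U 3 5 92 92,D 4 5 72 72])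
(End [U 1 2 64 64,D 1 3 287 287,D 5 1 189 127,U 2 4 206 226,D 3 4 574 574,U 3 5 427 427,D 4 5 150 150])))))))))
(Cut (U 3 5 154 129)
(End [D 1 3 86 86,D 5 1 51 51,U 3 5 64 28])
(Cut (U 1 2 129 154)
(End [U 1 2 46 43,D 1 3 12 16,D 5 1 17 17,U 2 4 10 10,D 3 4 11 11,D 4 5 17 10])
(Cut (U 1 2 104 172)
(End [U 1 2 69 63,D 1 3 56 56,D 5 1 51 51,U 2 4 14 14,D 3 4 41 41,U 3 5 55 55,D 4 5 51 45])
(Cut (D 4 5 136 148)
(End [U 1 2 37 37,D 1 3 64 86,D 5 1 91 91,U 2 4 53 53,D 3 4 58 58,D 4 5 408 384])
(Cut (D 5 0 129 154)
(End [U 0 1 57 57,D 0 2 33 33,D 5 0 47 0,U 1 2 46 46,D 1 3 39 39,U 2 4 29 29,D 3 4 29 29,U 3 5 39 39,D 4 5 55 33])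
(Cut (U 4 0 197 39)
(End [D 0 2 35 35,U 4 0 87 71,U 1 2 25 37,D 1 3 33 44,U 2 4 13 13,D 3 4 30 30])
(Cut (D 3 4 68 189)
(Cut (D 1 3 161 120)
(End [D 1 3 216 206,D 5 1 73 73,D 3 4 127 127,U 3 5 118 118,D 4 5 94 93])
(Cut (D 3 4 104 172)
(End [D 1 3 498 498,D 5 1 141 141,D 3 4 751 729,D 4 5 249 212])
(Cut (D 1 3 148 136)
(Cut (D 3 4 83 183)
(Cut (U 3 5 148 136)
(Cut (U 1 2 56 193)
(End [U 1 2 49 39,D 1 3 288 288,D 5 1 61 61,U 2 4 18 18,D 3 4 253 253,U 3 5 261 261,D 4 5 72 57])
(Cut (U 1 2 52 194)
(End [U 1 2 683 667,D 1 3 404 404,D 5 1 86 86,U 2 4 25 25,D 3 4 355 355,U 3 5 366 366,D 4 5 101 80])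
(End [U 1 2 1032 1032,D 1 3 7317 7317,D 5 1 1036 1036,U 2 4 47 47,D 3 4 6424 6424,U 3 5 6630 6630,D 4 5 1210 1060])))
(End [D 3 4 80 80,U 3 5 10 19,D 4 5 20 20]))
(End [U 1 2 42 42,D 1 3 629 629,D 5 1 94 94,U 2 4 8 8,D 3 4 931 938,U 3 5 155 155,D 4 5 121 121]))
(End [U 1 2 16 16,D 1 3 708 739,D 5 1 75 75,U 2 4 3 3,D 3 4 501 501,D 4 5 195 195]))))
(Cut (D 5 1 197 39)
(End [U 1 2 93 93,D 1 3 215 215,D 5 1 483 483,U 2 4 23 23,D 3 4 351 351,U 3 5 299 299,D 4 5 169 169])
(Cut (U 2 4 200 20)
(End [U 1 2 2 2,D 1 3 86 86,D 5 1 118 119,U 2 4 172 172,D 3 4 140 140,U 3 5 119 119,D 4 5 111 111])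
(End [U 1 2 16 16,D 1 3 94 98,D 5 1 116 116,U 2 4 23 23,D 3 4 158 158,U 3 5 120 120,D 4 5 108 108])))))))))))
(Cut (U 3 5 136 148)
(Cut (D 1 3 197 39)
(End [U 0 1 22 22,U 4 0 14 14,D 1 3 462 462,D 5 1 132 132,D 3 4 89 89,U 3 5 192 192,D 4 5 286 286])
(Cut (D 1 3 154 129)
(Cut (D 0 2 172 104)
(End [D 0 2 10 8,U 4 0 3 3,U 2 4 3 3])
(Cut (U 0 1 129 154)
(End [U 0 1 111 104,U 4 0 24 24,D 1 3 34 18,D 3 4 5 5,U 3 5 48 48,D 4 5 27 46])
(Cut (D 0 2 161 120)
(End [D 0 2 19 16,U 4 0 4 4,U 2 4 4 4])
(Cut (U 2 3 129 154)
(Cut (D 5 0 129 154)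
(End [U 0 1 8 8,D 0 2 7 7,D 5 0 5 0,D 1 3 3 0,U 2 3 3 0,U 3 5 9 7])
(End [U 0 1 12 12,D 0 2 160 160,U 4 0 34 34,D 5 0 77 77,U 1 2 10 10,D 5 1 1 1,U 2 3 59 0,D 3 4 86 86,U 3 5 70 70,D 4 5 245 260]))
(Cut (U 0 1 104 172)
(Cut (U 4 0 154 129)
(End [U 0 1 751 676,U 4 0 194 194,D 1 3 236 138,D 3 4 51 51,U 3 5 314 314,D 4 5 179 302])
(End [U 0 1 1293 1261,U 4 0 1128 1128,D 1 3 320 121,D 5 1 70 70,U 3 5 508 508,D 4 5 383 542]))
(Cut (U 4 0 161 120)
(Cut (U 1 2 104 172)
(Cut (U 2 4 193 56)
(End [U 0 1 762 762,D 0 2 967 967,U 4 0 603 603,U 1 2 1355 1355,D 1 3 42 42,D 5 1 333 333,U 2 4 1938 1924,D 3 4 0 202,U 3 5 485 485,D 4 5 722 722])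
(Cut (D 5 1 199 28)
(End [U 0 1 61 61,D 0 2 77 77,U 4 0 48 48,U 1 2 322 322,D 1 3 16 16,D 5 1 483 433,U 2 4 182 182,D 3 4 0 78,U 3 5 187 187,D 4 5 6 6])
(Cut (D 1 3 183 83)
(End [U 0 1 13 13,U 4 0 33 33,D 1 3 716 716,D 5 1 299 299,D 3 4 141 141,U 3 5 305 267,D 4 5 376 376])
(Cut (D 5 1 194 52)
(Cut (U 2 4 189 68)
(End [U 0 1 233 233,D 0 2 295 295,U 4 0 184 184,U 1 2 443 443,D 1 3 25 25,D 5 1 561 561,U 2 4 2730 2701,D 3 4 0 70,U 3 5 166 166,D 4 5 214 214])
(Cut (D 1 3 172 104)
(End [D 1 3 244 236,D 5 1 241 241,U 3 5 57 35])
(Cut (U 4 0 193 56)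
(End [D 0 2 46 46,U 4 0 43 28,U 1 2 216 216,D 1 3 996 996,D 5 1 1424 1424,U 2 4 136 136,D 3 4 18 84,U 3 5 338 209])
(Cut (D 0 2 148 136)
(End [D 0 2 9 6,U 4 0 8 8,U 2 4 6 6])
(End [U 0 1 317 317,D 0 2 457 457,U 4 0 401 401,U 1 2 1580 1580,D 1 3 4559 4559,D 5 1 7198 7198,U 2 4 982 982,D 3 4 0 379,U 3 5 1718 1078,D 4 5 55 55])))))
(End [D 1 3 43 43,D 5 1 30 31,U 3 5 16 5])))))
(Cut (U 2 4 161 120)
(Cut (D 0 2 142 142)
(Cut (U 2 4 193 56)
(End [U 0 1 92 92,D 0 2 414 414,U 4 0 98 87,U 1 2 92 92,U 2 4 210 210])
(End [U 0 1 355 355,D 0 2 1272 1272,U 4 0 319 319,U 1 2 367 395,D 1 3 203 203,D 5 1 115 115,U 2 4 528 528,D 3 4 133 133,U 3 5 167 167,D 4 5 249 249]))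
(End [U 0 1 23 23,D 0 2 25 35,U 1 2 23 23]))
(End [U 1 2 8 17,D 1 3 17 22,U 2 4 0 11,D 3 4 15 15,U 3 5 7 6,D 4 5 0 3])))
(Cut (D 3 4 68 189)
(Cut (U 3 5 154 129)
(End [D 1 3 12 12,D 5 1 9 9,U 3 5 13 8])
(Cut (U 0 1 83 183)
(Cut (D 3 4 104 172)
(End [U 0 1 775 744,U 4 0 408 408,D 1 3 156 62,D 5 1 32 32,D 3 4 84 0,U 3 5 169 169,D 4 5 83 83])
(End [U 0 1 2237 2237,U 4 0 1031 1118,D 1 3 1476 1122,D 5 1 1017 1017,D 3 4 2545 2545,U 3 5 5441 5441,D 4 5 2666 2666]))
(End [U 0 1 188 220,U 4 0 193 268,D 1 3 112 22,D 5 1 134 134,U 3 5 716 716,D 4 5 351 351])))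
(End [D 3 4 0 3,U 3 5 7 6,D 4 5 1 4]))))))))
(Cut (U 4 0 197 39)
(End [D 0 2 18 18,U 4 0 44 36,U 1 2 19 19,D 1 3 23 38,U 2 4 20 20,D 3 4 10 22])
(Cut (U 0 1 129 154)
(End [U 0 1 126 0,U 4 0 80 80,D 5 0 141 141,D 1 3 775 775,D 3 4 203 203,U 3 5 137 137,D 4 5 589 609])
(Cut (D 0 2 172 104)
(End [D 0 2 13 10,U 4 0 5 5,U 2 4 4 4])
(Cut (U 2 4 183 83)
(Cut (U 1 2 129 154)
(End [U 1 2 37 33,D 1 3 0 4,D 5 1 8 8,U 2 4 17 17,D 3 4 0 4,U 3 5 1 0,D 4 5 4 4])
(Cut (U 1 2 104 172)
(End [U 1 2 631 549,D 1 3 0 67,D 5 1 128 128,U 2 4 289 289,D 3 4 0 144,U 3 5 183 178,D 4 5 257 257])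
(Cut (U 0 1 39 197)
(Cut (U 4 0 172 104)
(End [U 0 1 73 73,D 0 2 98 98,U 4 0 140 122,U 1 2 83 83,D 1 3 53 58,U 2 4 109 109,D 3 4 16 16])
(Cut (D 3 4 68 189)
(Cut (U 0 1 68 189)
(Cut (D 3 4 83 183)
(Cut (U 1 2 28 199)
(Cut (D 0 2 142 142)
(Cut (U 0 1 83 183)
(Cut (U 3 5 154 129)
(End [D 1 3 52 52,D 5 1 11 11,U 3 5 12 3])
(Cut (U 4 0 166 113)
(End [U 0 1 7 0,D 0 2 22 22,U 4 0 106 95,U 1 2 12 12,D 1 3 47 49,U 2 4 14 14,D 3 4 32 32])
(Cut (U 4 0 161 120)
(End [U 0 1 53 53,D 0 2 75 75,U 4 0 434 422,U 1 2 41 41,D 1 3 22 23,U 2 4 48 48,D 3 4 15 15])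
(Cut (U 1 2 68 189)
(End [U 0 1 28 26,U 4 0 33 33,U 1 2 22 17,D 5 1 1 1,U 2 4 15 15,D 4 5 15 15])
(Cut (U 0 1 120 161)
(End [U 0 1 727 681,U 4 0 255 255,D 5 0 49 49,U 1 2 256 256,D 1 3 385 385,U 2 4 31 31,D 3 4 255 255,U 3 5 117 117,D 4 5 186 186])
(Cut (U 4 0 154 129)
(Cut (D 3 4 120 161)
(End [U 0 1 108 108,D 0 2 126 126,U 4 0 515 494,U 1 2 127 127,D 1 3 44 44,U 2 4 73 73,D 3 4 136 135])
(End [U 0 1 1465 1465,D 0 2 1792 1792,U 4 0 7080 6775,U 1 2 1812 1812,D 1 3 814 814,D 5 1 52 52,U 2 4 1039 1039,D 3 4 685 685,U 3 5 278 278,D 4 5 136 136]))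
(Cut (D 3 4 120 161)
(End [U 0 1 595 595,D 0 2 131 131,U 4 0 723 723,U 1 2 133 133,D 1 3 648 648,D 5 1 37 37,U 2 4 76 76,D 3 4 2002 1988,D 4 5 633 633])
(Cut (D 3 4 97 176)
(Cut (D 4 5 39 197)
(Cut (D 1 3 142 142)
(Cut (U 0 1 113 166)
(End [U 0 1 2516 2498,U 4 0 619 619,U 1 2 604 604,D 1 3 725 725,U 2 4 73 73,D 3 4 474 474,U 3 5 122 122,D 4 5 114 128])
(Cut (D 0 2 154 129)
(End [D 0 2 6 2,U 4 0 23 23,U 2 4 7 7])
(Cut (U 1 2 56 193)
(End [U 0 1 176 176,D 0 2 91 91,U 4 0 167 167,U 1 2 260 246,D 5 1 6 6,U 2 4 59 59,D 4 5 240 240])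
(Cut (U 4 0 142 142)
(Cut (D 3 4 113 166)
(End [U 0 1 225 225,D 0 2 134 134,U 4 0 428 428,U 1 2 74 74,D 1 3 435 435,D 5 1 19 19,U 2 4 26 26,D 3 4 880 872,D 4 5 760 760])
(Cut (U 3 5 148 136)
(Cut (D 0 2 148 136)
(Cut (U 2 3 129 154)
(End [D 0 2 25 16,U 4 0 99 99,D 1 3 0 3,U 2 3 11 0,D 3 4 92 92,U 3 5 3 0,D 4 5 0 2])
(Cut (U 2 3 68 189)
(Cut (D 1 3 148 136)
(Cut (U 2 3 104 172)
(End [U 0 1 3963 3963,D 0 2 4550 4550,U 4 0 7632 7632,U 1 2 6589 6589,D 1 3 15364 15364,D 5 1 664 664,U 2 3 415 0,D 3 4 11750 11750,U 3 5 8776 8776,D 4 5 6094 6094])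
(Cut (D 3 4 104 172)
(End [U 0 1 255 255,D 0 2 293 293,U 4 0 491 491,U 1 2 293 293,D 1 3 437 437,D 5 1 4 4,U 2 3 174 174,U 2 4 10 10,D 3 4 35 0,D 4 5 160 160])
(Cut (U 0 1 104 172)
(Cut (D 5 0 129 154)
(End [U 0 1 65 67,D 0 2 6 0,U 4 0 0 4,D 5 0 9 0,U 2 4 10 10,D 4 5 7 0])
(Cut (D 5 0 104 172)
(End [U 0 1 61 0,D 5 0 377 353,D 1 3 1314 1304,U 3 5 430 372])
(End [U 0 1 64 0,U 4 0 561 561,D 5 0 129 129,U 1 2 84 84,D 1 3 1503 1503,U 2 4 6 6,D 3 4 1730 1730,U 3 5 515 515,D 4 5 1197 1215])))
(Cut (U 4 0 148 136)
(Cut (U 0 1 97 176)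
(Cut (U 1 2 52 194)
(End [U 0 1 1387 1387,D 0 2 413 413,U 4 0 1205 1205,U 1 2 1519 1492,D 5 1 10 10,U 2 4 116 116,D 4 5 396 396])
(Near [(101,(4826,[U 0 1 1158 1158,U 4 0 1351 1351,U 1 2 664 664,D 1 3 1578 1578,D 5 1 41 41,U 2 4 40 40,D 3 4 1816 1816,U 3 5 540 540,D 4 5 375 375]),(2315,[U 0 1 190 190,D 0 2 222 222,U 1 2 36 45])),
(150,(10965,[U 0 1 1368 1386,U 4 0 1907 1907,U 1 2 477 477,U 2 4 161 161]),(926,[D 0 2 77 74])),
(251,(6375,[U 0 1 1530 1530,U 4 0 1785 1785,U 1 2 782 782,D 1 3 1996 1996,D 5 1 98 98,U 2 4 47 47,D 3 4 2821 2821,U 3 5 1295 1295,D 4 5 899 899]),(2596,[U 0 1 213 213,D 0 2 249 249,U 1 2 111 119,D 1 3 264 264,U 2 3 44 44])),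
(352,(926,[U 4 0 77 74]),(2378,[U 0 1 206 206,D 0 2 231 231,U 4 0 9 9,U 1 2 76 76,D 1 3 63 63,U 2 4 24 24,D 3 4 73 73,U 3 5 22 22,D 4 5 6 7])),
(401,(37788,[U 0 1 9069 9069,U 4 0 10581 10581,U 1 2 4884 4884,D 1 3 13575 13575,D 5 1 693 693,U 2 4 294 294,D 3 4 15620 15620,U 3 5 4649 4649,D 4 5 4278 4278]),(2330,[U 0 1 523 523,D 0 2 322 322,U 4 0 288 288,U 1 2 193 193,D 1 3 161 161,U 2 3 62 62,U 2 4 26 26,D 3 4 58 58,U 3 5 278 278,D 4 5 128 128])),
(41,(2941,[U 0 1 116 116,D 0 2 280 280,U 4 0 346 346,U 1 2 92 92,D 1 3 378 378,D 5 1 22 22,U 2 4 29 29,D 3 4 153 153,U 3 5 291 291,D 4 5 202 202]),(2725,[U 0 1 763 763,U 4 0 436 436,U 1 2 281 281,D 1 3 235 235,U 2 3 19 19,U 2 4 13 13,D 3 4 493 493])),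
(174,(3120,[D 0 2 260 260,U 4 0 260 260,U 1 2 82 83,D 5 1 2 2,U 2 4 25 25,D 4 5 85 85]),(405,[U 0 1 43 44])),
(174,(3002,[U 0 1 195 195,D 0 2 308 308,U 4 0 420 420,U 1 2 101 101,D 1 3 264 264,D 5 1 13 13,U 2 4 32 32,D 3 4 304 304,U 3 5 90 90,D 4 5 313 313]),(405,[U 0 1 43 44])),
(369,(144,[D 0 2 12 12,U 4 0 12 12,U 2 4 1 1]),(26197,[U 0 1 3280 3323,U 4 0 562 548,U 1 2 1143 1143,U 2 4 69 69])),
(369,(2513,[U 0 1 228 228,D 0 2 277 277,U 4 0 408 408,U 1 2 91 91,D 1 3 118 118,D 5 1 3 3,U 2 4 29 29,D 3 4 136 136,U 3 5 40 40,D 4 5 28 28]),(32046,[U 0 1 3123 3164,U 4 0 40 0,U 1 2 1088 1088,U 2 4 66 66]))]))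
(End [U 0 1 315 326,D 0 2 437 437,U 4 0 476 476,U 1 2 123 123,D 5 1 4 4,U 2 4 46 46,D 4 5 156 156]))
(End [U 0 1 1049 1084,U 4 0 2528 2599,U 1 2 917 917,U 2 4 66 66])))))
(Cut (U 2 3 120 161)
(End [D 0 2 34 22,U 4 0 138 138,D 1 3 0 5,U 2 3 15 0,D 3 4 119 119,U 3 5 4 0,D 4 5 0 3])
(End [U 0 1 169 169,D 0 2 194 194,U 4 0 325 325,U 1 2 852 852,D 1 3 1305 1379,U 2 3 231 231,D 3 4 423 423])))
(End [U 1 2 1 4,D 1 3 29 28,U 2 3 0 3])))
(End [U 0 1 385 385,D 0 2 396 438,U 4 0 247 247,U 1 2 556 556,D 1 3 384 384,D 5 1 15 15,D 3 4 362 362,U 3 5 197 197,D 4 5 137 137]))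
(End [U 0 1 161 161,D 0 2 96 96,U 4 0 307 307,U 1 2 53 53,D 1 3 186 186,U 2 4 19 19,D 3 4 506 506,U 3 5 119 149,D 4 5 880 880])))
(End [U 0 1 152 152,U 4 0 286 292,U 1 2 207 207,D 1 3 103 103,U 2 4 15 15,D 3 4 67 67,U 3 5 17 17,D 4 5 16 18])))))
(End [U 0 1 241 241,D 0 2 53 53,U 4 0 293 293,U 1 2 54 54,D 1 3 992 1007,D 5 1 42 42,U 2 4 31 31,D 3 4 653 653,D 4 5 1675 1675]))
(End [U 0 1 337 337,D 0 2 74 74,U 4 0 409 409,U 1 2 75 75,D 1 3 266 266,U 2 4 43 43,D 3 4 348 348,U 3 5 75 75,D 4 5 432 448]))
(End [D 3 4 71 92,U 3 5 168 168,D 4 5 40 58])))))))))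
(End [U 0 1 619 631,D 0 2 143 143,U 4 0 139 139,U 1 2 78 78,D 5 1 5 5,U 2 4 91 91,D 4 5 84 84]))
(End [U 0 1 110 110,D 0 2 42 78,U 1 2 98 91]))
(End [U 0 1 140 140,D 0 2 34 34,U 4 0 145 145,U 1 2 697 716,D 1 3 367 382,D 3 4 250 250]))
(End [D 3 4 0 6,U 3 5 14 13,D 4 5 4 10]))
(End [U 0 1 2090 2137,D 0 2 451 451,U 4 0 770 770,U 1 2 382 382,D 5 1 27 27,U 2 4 503 503,D 4 5 463 463]))
(End [D 3 4 0 3,U 3 5 7 6,D 4 5 1 4])))
(End [U 0 1 726 923,D 0 2 529 529,U 1 2 448 448,D 1 3 0 137,D 5 1 261 261,U 2 4 590 590,D 3 4 0 294,U 3 5 374 364,D 4 5 526 526]))))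
(End [U 1 2 5 5,D 1 3 6 10,U 2 4 7 9,D 3 4 3 6])))))))
(End [D 3 4 1184 1389,U 3 5 3971 4617,D 4 5 3446 3446])))
(Cut (U 5 0 186 76)
(End [D 0 2 3 3,U 5 0 5 0,D 4 5 4 4])
(Cut (D 0 2 172 104)
(End [D 0 2 10 8,U 4 0 3 3,U 2 4 3 3])
(Cut (U 5 0 154 129)
(End [U 0 1 11 11,D 0 2 39 39,U 5 0 30 0,D 5 1 0 9,U 2 4 18 0,D 4 5 39 39])
(Cut (U 0 1 83 183)
(Cut (D 4 5 83 183)
(Cut (U 1 2 83 183)
(End [U 0 1 19 15,U 4 0 10 10,U 1 2 19 15,U 2 4 10 10])
(Cut (U 3 5 154 129)
(End [D 1 3 20 20,D 5 1 92 92,U 3 5 29 8])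
(Cut (U 4 0 183 83)
(Cut (U 2 4 197 39)
(End [D 0 2 5 5,U 4 0 4 2,U 2 4 9 7])
(Cut (U 2 4 154 129)
(Cut (D 0 2 129 154)
(Cut (U 2 4 189 68)
(End [D 0 2 153 153,U 4 0 92 51,U 2 4 207 165])
(Cut (U 0 1 113 166)
(End [U 0 1 1787 1787,D 0 2 1094 1094,U 4 0 1456 1456,U 1 2 1116 1116,D 1 3 269 269,U 2 4 1302 1302,D 3 4 150 150])
(End [U 0 1 1595 1595,D 0 2 779 779,U 4 0 796 796,U 1 2 769 769,D 1 3 86 86,U 2 4 866 866,D 3 4 124 124])))
(End [U 0 1 61 61,D 0 2 39 65,U 1 2 52 52]))
(End [U 0 1 18 12,U 4 0 21 21,U 1 2 39 39,D 1 3 7 7,U 2 4 74 83,D 3 4 22 22])))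
(Cut (U 2 4 183 83)
(Cut (U 5 2 183 83)
(End [U 0 1 18 18,U 4 0 16 18,D 5 1 0 8,U 2 4 20 20,U 5 2 20 20,D 4 5 13 13])
(End [U 0 1 1080 1080,D 0 2 270 270,U 4 0 1080 1080,D 5 1 529 900,U 2 4 1252 1252,U 5 2 757 757,D 4 5 504 504]))
(End [U 0 1 32 32,U 4 0 29 33,U 1 2 34 34,D 1 3 7 7,U 2 4 20 29,D 3 4 4 4])))))
(End [U 0 1 19 15,U 4 0 10 10,D 1 3 5 5,D 5 1 0 7,D 3 4 6 6,U 3 5 5 5,D 4 5 9 18]))
(Cut (D 4 5 52 194)
(Cut (U 1 2 52 194)
(Cut (U 2 4 183 83)
(End [U 0 1 10 16,D 0 2 17 17,U 4 0 2 2,D 5 1 31 33,U 2 4 14 7,D 4 5 13 13])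
(Cut (D 4 5 136 148)
(End [U 0 1 307 315,D 0 2 81 81,U 5 0 134 134,U 1 2 184 184,D 5 1 230 230,U 2 4 246 246,D 4 5 186 78])
(Cut (U 3 5 154 129)
(End [D 1 3 20 20,D 5 1 92 92,U 3 5 29 8])
(Cut (D 3 4 104 172)
(End [U 0 1 9 9,U 4 0 1 1,D 1 3 5 5,D 5 1 25 27,D 3 4 25 23,D 4 5 13 13])
(Cut (D 3 4 83 183)
(End [U 0 1 24 24,U 4 0 3 3,D 1 3 33 33,D 5 1 136 136,D 3 4 222 215,U 3 5 38 38,D 4 5 70 70])
(Cut (D 4 5 76 186)
(Cut (U 1 2 136 148)
(End [U 0 1 7 7,U 4 0 1 1,U 1 2 62 16,D 5 1 204 204,U 2 4 46 0,D 4 5 136 124])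
(Cut (D 3 4 68 189)
(End [U 0 1 33 33,U 4 0 4 4,D 1 3 45 45,D 5 1 186 186,D 3 4 414 398,U 3 5 40 40,D 4 5 127 127])
(Cut (U 2 4 172 104)
(End [U 0 1 150 150,D 0 2 112 112,U 4 0 67 67,U 1 2 107 107,D 5 1 83 88,U 2 4 507 484,D 4 5 58 58])
(Cut (D 0 2 129 154)
(Cut (U 1 2 76 186)
(Cut (D 4 5 129 154)
(End [U 0 1 84 84,D 0 2 25 25,U 5 0 38 38,U 1 2 88 87,D 5 1 59 59,U 2 4 95 95,D 3 4 1 1,D 4 5 31 0])
(Cut (U 2 4 166 113)
(End [U 0 1 89 89,D 0 2 100 100,U 4 0 43 43,U 1 2 82 82,D 5 1 58 62,U 2 4 672 652,D 4 5 47 47])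
(Cut (U 0 1 68 189)
(End [U 0 1 507 488,D 0 2 45 45,U 4 0 57 57,U 1 2 155 155,D 1 3 4 4,U 2 4 199 199,D 3 4 48 48])
(Cut (D 3 4 20 200)
(Cut (U 2 4 161 120)
(End [U 0 1 799 799,D 0 2 751 751,U 4 0 306 306,U 1 2 622 622,D 1 3 52 52,D 5 1 648 648,U 2 4 6206 6049,D 3 4 210 210,U 3 5 154 154,D 4 5 511 511])
(Cut (D 0 2 154 129)
(End [D 0 2 30 13,U 4 0 16 16,U 2 4 74 74])
(Cut (U 0 1 20 200)
(Cut (U 5 0 83 183)
(Cut (D 4 5 120 161)
(End [U 0 1 43 43,D 0 2 13 13,U 5 0 15 15,U 1 2 26 26,D 5 1 15 15,U 2 4 39 39,D 4 5 37 30])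
(Cut (D 5 1 142 142)
(Cut (D 4 5 113 166)
(End [U 0 1 84 84,D 0 2 26 26,U 5 0 29 29,U 1 2 52 52,D 5 1 48 48,U 2 4 77 77,D 4 5 74 60])
(Cut (U 1 2 129 154)
(End [U 0 1 811 811,U 4 0 58 58,U 1 2 3434 3417,D 1 3 81 81,D 5 1 1212 1212,U 2 4 679 679,D 3 4 327 327,U 3 5 240 240,D 4 5 889 889])
(Cut (U 5 0 129 154)
(End [U 0 1 19 14,D 0 2 8 8,U 5 0 9 0,U 1 2 16 16,D 1 3 4 4,U 2 4 21 21,D 3 4 17 17,U 3 5 13 13,D 4 5 45 45])
(Cut (D 3 4 39 197)
(Cut (U 3 5 136 148)
(Cut (D 4 5 83 183)
(Cut (U 5 0 120 161)
(End [U 0 1 36 36,D 0 2 10 10,U 5 0 4 0,U 1 2 21 21,D 1 3 6 6,D 5 1 55 55,U 2 4 27 27,D 3 4 36 36,U 3 5 34 34,D 4 5 71 71])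
(Cut (U 1 2 97 176)
(Cut (D 5 1 154 129)
(End [U 1 2 652 625,D 1 3 564 564,D 5 1 8627 8396,U 2 4 544 544,D 3 4 3360 3360,U 3 5 3157 3157,D 4 5 2668 2668])
(Cut (D 3 4 56 193)
(End [U 0 1 71 71,U 4 0 5 5,D 1 3 59 59,D 5 1 639 639,D 3 4 672 652,U 3 5 136 136,D 4 5 337 337])
(Cut (U 2 4 154 129)
(End [U 0 1 1386 1386,D 0 2 1619 1619,U 4 0 362 362,U 1 2 1435 1435,D 1 3 79 79,D 5 1 2189 2189,U 2 4 5352 5153,D 3 4 826 826,U 3 5 465 465,D 4 5 1155 1155])
(Cut (U 0 1 56 193)
(End [U 0 1 264 247,U 4 0 28 28,U 1 2 140 135,D 1 3 3 3,U 2 4 154 154,D 3 4 109 109])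
(Cut (D 4 5 104 172)
(End [U 0 1 611 611,D 0 2 99 99,U 5 0 307 307,U 1 2 496 496,D 5 1 510 510,U 2 4 536 536,D 4 5 296 226])
(Cut (D 5 1 148 136)
(Cut (U 3 5 148 136)
(Cut (U 2 4 142 142)
(Cut (D 3 4 52 194)
(Cut (U 0 1 52 194)
(End [U 0 1 928 906,U 4 0 34 34,D 1 3 116 116,D 5 1 1802 1802,D 3 4 3791 3743,U 3 5 685 685,D 4 5 711 711])
(End [U 0 1 255 255,U 4 0 10 10,D 1 3 158 158,D 5 1 3256 3256,D 3 4 5441 5388,U 3 5 1238 1238,D 4 5 1284 1284]))
(Cut (U 1 2 113 166)
(End [U 0 1 55 55,U 4 0 3 3,U 1 2 79 0,D 5 1 1816 1816,U 2 4 244 167,D 3 4 206 234,U 3 5 691 691,D 4 5 716 716])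
(Cut (D 4 5 97 176)
(Cut (D 0 2 148 136)
(Cut (U 0 1 39 197)
(Cut (U 2 4 148 136)
(Near [(50,(3408,[U 0 1 256 256,D 0 2 246 246,U 4 0 40 40,U 1 2 397 397,D 1 3 3 3,U 2 4 813 813,D 3 4 154 154]),(2604,[U 0 1 418 418,D 0 2 133 133,U 1 2 215 215,D 1 3 17 17,D 5 1 815 815,U 2 4 440 440,D 3 4 223 223,U 3 5 279 279,D 4 5 938 938])),
(150,(13159,[U 0 1 1946 1946,U 4 0 136 136,U 1 2 1518 1518,D 1 3 41 41,D 5 1 1957 1957,U 2 4 4049 4049,D 3 4 536 536,U 3 5 670 670,D 4 5 2251 2251]),(926,[D 0 2 77 74])),
(251,(8759,[U 0 1 811 811,D 0 2 881 881,U 4 0 118 118,U 1 2 1424 1424,D 5 1 1570 1570,U 2 4 2915 2915,D 3 4 1665 1665,U 3 5 538 538,D 4 5 1807 1807]),(9746,[U 0 1 1486 1486,D 0 2 543 543,U 1 2 877 877,D 1 3 147 147,D 5 1 3636 3636,U 2 4 1796 1796,D 3 4 1389 1389,U 3 5 1245 1245,D 4 5 4184 4184])),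
(301,(2420,[U 0 1 109 109,D 0 2 56 56,U 4 0 21 21,U 1 2 91 91,D 5 1 67 67,U 2 4 186 186,D 3 4 7 8,U 3 5 23 23,D 4 5 77 77]),(3156,[U 0 1 428 428,D 0 2 206 206,U 1 2 334 334,D 1 3 9 9,D 5 1 430 430,U 2 4 683 683,D 3 4 118 118,U 3 5 147 147,D 4 5 495 495])),
(401,(21326,[U 0 1 1987 1987,D 0 2 1224 1224,U 4 0 199 199,U 5 0 327 327,U 1 2 1977 1977,D 1 3 15 15,D 5 1 2018 2018,U 2 4 4049 4049,D 3 4 767 767]),(3159,[U 0 1 471 471,D 0 2 182 182,U 1 2 294 294,D 1 3 40 40,D 5 1 1032 1032,U 2 4 602 602,D 3 4 525 525,U 3 5 656 656,D 4 5 1447 1447])),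
(195,(4690,[D 0 2 87 87,U 4 0 4 4,U 1 2 140 140,D 1 3 5 5,D 5 1 304 304,U 2 4 287 287,U 3 5 104 104,D 4 5 350 350]),(6045,[U 0 1 546 546,D 0 2 238 238,U 4 0 25 25,U 1 2 385 385,D 1 3 28 28,D 5 1 855 855,U 2 4 789 789,D 3 4 755 755,U 3 5 293 293,D 4 5 984 984])),
(195,(2556,[D 0 2 64 64,U 4 0 3 3,U 1 2 104 104,D 5 1 149 149,U 2 4 213 213,D 3 4 15 17,U 3 5 51 51,D 4 5 171 171]),(854,[U 0 1 47 48])),
(328,(864,[U 0 1 29 29,D 0 2 15 15,U 5 0 10 10,U 1 2 24 24,D 5 1 18 18,U 2 4 49 49,D 4 5 86 86]),(6342,[U 0 1 550 550,D 0 2 213 213,U 4 0 24 24,U 1 2 344 344,D 1 3 46 46,D 5 1 1193 1193,U 2 4 705 705,D 3 4 604 604,U 3 5 756 756,D 4 5 765 765])),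
(369,(264,[D 0 2 22 22,U 4 0 1 1,U 2 4 22 22]),(63441,[U 0 1 4193 4193,U 4 0 109 109,U 1 2 3271 3271,D 1 3 88 88,D 5 1 4215 4215,U 2 4 1946 1798,D 3 4 1154 1154,U 3 5 1443 1443,D 4 5 4850 4850])),
(502,(23239949,[]),(5088,[U 0 1 478 478,D 0 2 231 231,U 4 0 23 23,U 1 2 373 373,D 1 3 10 10,D 5 1 480 480,U 2 4 763 763,D 3 4 131 131,U 3 5 164 164,D 4 5 553 553]))])
(End [U 0 1 1999 1999,U 4 0 52 52,U 1 2 1559 1559,D 1 3 42 42,D 5 1 2009 2009,U 2 4 3345 3378,D 3 4 550 550,U 3 5 688 688,D 4 5 2312 2312]))
(End [U 0 1 60 70,D 0 2 34 22,D 5 1 254 254,U 2 4 137 137,D 4 5 276 272]))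
(End [U 0 1 400 400,D 0 2 108 143,U 1 2 683 683,D 5 1 576 576,U 2 4 310 310,D 3 4 59 67,U 3 5 197 197,D 4 5 663 663]))
(End [D 3 4 80 91,U 3 5 268 268,D 4 5 32 44]))))
(End [U 0 1 719 719,U 4 0 33 33,U 1 2 539 539,D 1 3 47 47,D 5 1 2002 2002,U 2 4 1164 1179,D 3 4 467 467,U 3 5 761 761,D 4 5 790 790]))
(End [D 3 4 94 94,U 3 5 47 54,D 4 5 66 68]))
(End [U 0 1 376 376,U 5 0 120 120,D 5 1 851 908,D 4 5 329 350])))))))
(Cut (U 0 1 52 194)
(Cut (U 2 4 154 129)
(End [U 0 1 172 172,D 0 2 64 64,U 4 0 16 16,U 1 2 122 124,U 2 4 234 231])
(End [U 0 1 1495 1495,D 0 2 557 557,U 4 0 139 139,U 1 2 1343 1391,D 1 3 16 16,U 2 4 757 757,D 3 4 308 308]))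
(End [U 0 1 26 33,D 0 2 48 48,U 1 2 20 28]))))
(End [U 0 1 15 15,U 4 0 1 1,D 1 3 14 14,D 5 1 91 91,D 3 4 84 84,U 3 5 79 79,D 4 5 404 408]))
(End [D 3 4 29 28,U 3 5 9 13,D 4 5 21 21]))
(End [U 0 1 343 343,D 0 2 162 162,U 5 0 270 270,U 1 2 344 344,D 5 1 329 329,U 2 4 443 443,D 3 4 943 1016,U 3 5 311 311,D 4 5 178 178])))))
(End [U 0 1 120 120,D 0 2 12 12,U 5 0 30 30,U 1 2 24 24,D 5 1 156 172,U 2 4 36 36,D 4 5 49 49])))
(End [U 0 1 120 120,D 0 2 44 44,U 4 0 32 32,U 5 0 13 28,U 1 2 89 89,D 1 3 3 3,D 5 1 73 73,U 2 4 132 132,D 3 4 40 40]))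
(End [U 0 1 507 515,D 0 2 42 42,U 1 2 85 85,D 1 3 16 16,D 5 1 198 198,U 2 4 126 126,D 3 4 64 64,U 3 5 47 47,D 4 5 156 156]))))
(End [U 0 1 144 144,D 0 2 135 135,U 4 0 55 55,U 1 2 463 463,D 5 1 467 467,U 2 4 594 594,D 3 4 1846 1876,U 3 5 111 111,D 4 5 368 368])))))
(End [U 0 1 241 241,D 0 2 271 271,U 4 0 116 116,U 1 2 1006 1032,D 1 3 7 7,U 2 4 336 336,D 3 4 90 90]))
(End [U 0 1 23 23,D 0 2 26 36,U 1 2 23 23])))))
(End [U 0 1 16 16,U 4 0 2 2,D 1 3 22 22,D 5 1 91 91,D 3 4 52 52,U 3 5 66 66,D 4 5 216 222])))))))
(End [U 0 1 5 10,D 0 2 12 12,U 1 2 11 16]))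
(End [U 0 1 25 25,U 4 0 3 3,D 5 1 19 28,D 4 5 36 40])))))))
(End [D 3 4 6 6,U 3 5 4 7,D 4 5 5 5]))))
(Cut (U 5 0 142 142)
(End [U 0 1 6 6,D 0 2 8 8,U 5 0 13 0,D 5 1 0 7,U 2 4 5 5,D 4 5 11 11])
(Cut (U 0 1 129 154)
(End [U 0 1 52 52,U 4 0 6 6,U 5 0 6 6,D 5 1 3 12,U 2 4 6 6,U 5 2 6 6])
(End [U 0 1 173 173,U 5 0 157 157,D 5 1 182 280]))))
(Cut (U 3 5 142 142)
(End [D 0 2 50 50,D 3 0 0 111,U 4 0 142 142,U 1 2 53 53,D 5 1 20 20,U 2 4 56 56,U 3 5 62 62,D 4 5 1 40])
(End [D 3 0 0 10,U 4 0 5 5,U 5 0 4 4,U 3 5 9 9,D 4 5 3 3])))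
(End [D 3 0 0 2,U 4 0 2 2,U 3 4 1 1])))))
(Cut (U 2 3 83 183)
(End [U 1 2 43 43,D 1 3 30 69,U 2 3 93 93])
(Cut (U 1 2 136 148)
(End [U 1 2 98 97,D 1 3 0 13,U 2 3 20 20])
(End [U 1 2 19 19,D 1 3 22 33,U 2 3 31 31]))))
(Cut (D 5 1 193 56)
(End [U 0 1 0 1,D 0 2 15 15,U 4 0 3 3,D 5 0 7 7,D 5 1 15 15,U 2 4 3 3,U 5 2 0 11])
(End [U 0 1 0 6,D 0 2 10 10,U 4 0 1 1,D 5 1 8 8,U 2 4 1 1,U 5 2 0 7])))
(End [D 0 2 13 13,D 5 1 6 6,U 5 2 0 14]))))
(End [U 0 1 19 19,D 0 2 34 52,U 1 2 19 19]))
(Cut (D 2 3 186 76)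
(End [U 1 2 1 1,D 5 1 1 1,D 2 3 3 0,U 3 5 1 1])
(Cut (U 1 2 56 193)
(Cut (U 1 2 104 172)
(Cut (D 3 4 148 136)
(End [U 0 1 1 1,U 4 0 2 2,U 1 2 3 3,D 2 3 7 7,U 2 4 0 12,D 3 4 36 36])
(Cut (D 2 3 142 142)
(End [U 1 2 2 2,D 5 1 1 1,D 2 3 56 56,U 2 4 0 23,D 3 4 20 20,U 3 5 1 1])
(Cut (D 3 4 136 148)
(End [D 2 3 9 9,U 2 4 0 10,D 3 4 116 115])
(End [D 2 3 157 157,U 2 4 182 280,D 3 4 164 164]))))
(End [U 1 2 65 99,D 1 3 24 24,U 2 4 36 73,D 3 4 36 36]))
(End [U 1 2 7 11,D 1 3 4 4,U 2 4 0 5,D 3 4 3 3]))))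
(Cut (U 0 1 56 193)
(Cut (U 0 1 104 172)
(Cut (D 4 5 148 136)
(End [U 0 1 2 2,U 4 0 0 10,D 5 0 6 6,U 1 2 1 1,U 2 4 1 1,D 4 5 29 29])
(Cut (D 5 0 142 142)
(End [U 0 1 2 2,U 4 0 0 23,D 5 0 56 56,D 1 3 1 1,U 3 5 1 1,D 4 5 20 20])
(Cut (D 4 5 136 148)
(End [U 4 0 0 10,D 5 0 9 9,D 4 5 116 115])
(End [U 4 0 182 280,D 5 0 157 157,D 4 5 164 164]))))
(End [U 0 1 65 99,U 4 0 36 73,D 5 1 24 24,D 4 5 36 36]))
(End [U 0 1 7 11,U 4 0 0 5,D 5 1 4 4,D 4 5 3 3]))))))
(End [U 0 1 9 9,U 5 0 8 8,D 5 1 12 22]))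
(End [U 1 2 9 9,D 1 3 12 22,U 2 3 8 8]))))
(End [U 0 1 1 1,D 0 2 2 3,U 1 2 1 1]))
(End [D 2 3 5 5,U 2 4 7 13,D 3 4 5 5]))
(End [U 4 0 7 13,D 5 0 5 5,D 4 5 5 5]))))"

lemma proves_024153: "proves [0, 2, 4, 1, 5, 3] quadrant tree_024153"
  by code_simp

lemma hits_024153: "hits tree_024153 = [[0, 133, 174, 307, 307, 101, 201, 251, 352, 452], [133, 133, 328, 328, 461, 101, 150, 251, 352, 401], [101, 150, 251, 352, 401, 41, 174, 174, 369, 369], [50, 150, 251, 301, 401, 195, 195, 328, 369, 502]]"
  by code_simp

section \<open>Optimality and uniqueness\<close>

lemma settled_if_refuted:
  assumes "ranking r" "proves r quadrant t" "hits t = []"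
  shows "settled r"
  by (rule settled_if_proved[OF assms(1,2)]) (simp add: assms(3))

lemma settled_representatives: "s \<in> set representatives \<Longrightarrow> settled s"
proof -
  have "list_all (\<lambda>r. distinct r \<and> set r = {..<6}) representatives"
    by code_simp
  then have ranking: "ranking r" if "r \<in> set representatives" for r
    using that by (simp add: list_all_iff)
  have "settled [0, 1, 3, 5, 2, 4]"
    using optimal_near_013524
    by (intro settled_if_proved[OF ranking proves_013524]) (simp_all add: representatives_def hits_013524)
  moreover have "settled [0, 2, 4, 1, 5, 3]"
    using optimal_near_024153
    by (intro settled_if_proved[OF ranking proves_024153]) (auto simp add: representatives_def hits_024153)
  ultimately have "\<forall>r\<in>set representatives. settled r"
    using settled_if_refuted[OF ranking proves_012345 hits_012345] settled_if_refuted[OF ranking proves_012354 hits_012354]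
      settled_if_refuted[OF ranking proves_012453 hits_012453] settled_if_refuted[OF ranking proves_012543 hits_012543]
      settled_if_refuted[OF ranking proves_013254 hits_013254] settled_if_refuted[OF ranking proves_013542 hits_013542]
      settled_if_refuted[OF ranking proves_015342 hits_015342] settled_if_refuted[OF ranking proves_014523 hits_014523]
    by (simp add: representatives_def)
  then show "s \<in> set representatives \<Longrightarrow> settled s" by blast
qed

section \<open>Sorted lifts of an arbitrary set of six points\<close>

lemma cyc_sorted_list:
  assumes "sorted zs" "length zs = 6" "set zs \<subseteq> {0..<1}"
  shows "cyc_sorted (\<lambda>i. zs ! i)"
proof -
  have "zs ! 5 \<in> set zs" "zs ! 0 \<in> set zs" using assms(2) by simp_all
  with assms(3) have "zs ! 5 \<in> {0..<1}" "zs ! 0 \<in> {0..<1}" by blast+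
  then show ?thesis using assms sorted_nth_mono[OF assms(1)] by (simp add: cyc_sorted_def)
qed

definition frac_lift :: "torus \<Rightarrow> real \<times> real" where
  "frac_lift t = (frac (fst (rep_torus t)), frac (snd (rep_torus t)))"

lemma proj_frac_lift: "proj_torus (frac_lift t) = t"
proof -
  have "proj_torus (frac_lift t) = proj_torus (rep_torus t)"
    unfolding proj_torus_eq_iff by (simp add: frac_lift_def frac_def minus_prod_def)
  then show ?thesis by (simp add: proj_rep)
qed

lemma frac_lift_bounds: "fst (frac_lift t) \<in> {0..<1}" "snd (frac_lift t) \<in> {0..<1}"
  by (simp_all add: frac_lift_def frac_lt_1)

text \<open>The points are lifted to the unit square and sorted by first coordinate. In that order
  their second coordinates form a permutation of the sorted list of heights; any permutation
  relating the two lists serves as ranking, so ties cause no trouble.\<close>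

lemma sorted_coordinates:
  assumes "card S = 6"
  obtains X Y r where "cyc_sorted X" "cyc_sorted Y" "ranking r" "S = pts X (\<lambda>i. Y (r ! i))"
proof -
  have "finite S" using assms by (simp add: card_ge_0_finite)
  then obtain ts where ts: "set ts = S" "distinct ts" using finite_distinct_list by blast
  define ls where "ls = sort_key fst (map frac_lift ts)"
  define ys where "ys = map snd ls"
  have len: "length ls = 6" using distinct_card[OF ts(2)] ts(1) assms by (simp add: ls_def)
  have ls: "set ls = frac_lift ` S" by (simp add: ls_def ts(1))
  have "mset ys = mset (sort ys)" by simp
  then obtain p where p: "p permutes {..<length (sort ys)}" "permute_list p (sort ys) = ys"
    by (rule mset_eq_permutation)
  have leny: "length ys = 6" using len by (simp add: ys_def)
  define r where "r = map p [0..<6]"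
  have r: "ranking r"
    using p(1) leny by (auto simp: r_def distinct_map permutes_inj_on lessThan_atLeast0[symmetric] permutes_image)
  have Y: "sort ys ! (r ! i) = snd (ls ! i)" if "i < 6" for i
  proof -
    have "ys ! i = sort ys ! p i" using permute_list_nth[OF p(1), of i] that leny p(2) by simp
    then show ?thesis using that len by (simp add: ys_def r_def)
  qed
  have "cyc_sorted (\<lambda>i. map fst ls ! i)"
  proof (rule cyc_sorted_list)
    show "sorted (map fst ls)" unfolding ls_def by (rule sorted_sort_key)
    show "set (map fst ls) \<subseteq> {0..<1}" using frac_lift_bounds by (auto simp: ls)
  qed (simp add: len)
  moreover have "cyc_sorted (\<lambda>k. sort ys ! k)"
    by (rule cyc_sorted_list) (use frac_lift_bounds leny in \<open>auto simp: ys_def ls\<close>)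
  moreover have "S = pts (\<lambda>i. map fst ls ! i) (\<lambda>i. sort ys ! (r ! i))"
  proof -
    have "pts (\<lambda>i. map fst ls ! i) (\<lambda>i. sort ys ! (r ! i)) = (\<lambda>i. proj_torus (ls ! i)) ` {..<6}"
      unfolding pts_def using Y len by (intro image_cong) simp_all
    also have "\<dots> = proj_torus ` set ls" using len by (auto simp: set_conv_nth)
    also have "\<dots> = S" by (simp add: ls image_image proj_frac_lift)
    finally show ?thesis by simp
  qed
  ultimately show ?thesis using r that by blast
qed

lemma packing_unique:
  assumes "packing S"
  shows "optimal S"
proof -
  have "card S = 6" using assms by (simp add: packing_def)
  then obtain X Y r where "cyc_sorted X" "cyc_sorted Y" "ranking r" and S: "S = pts X (\<lambda>i. Y (r ! i))"
    by (rule sorted_coordinates)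
  then show ?thesis
    using settled_all[OF settled_representatives] assms unfolding settled_def S by blast
qed

section \<open>The minimal distance\<close>

lemma finite_distances: "finite S \<Longrightarrow> finite {dist u v | u v. u \<in> S \<and> v \<in> S \<and> u \<noteq> v}"
  by (rule finite_subset[of _ "(\<lambda>(u, v). dist u v) ` (S \<times> S)"]) auto

lemma packing_iff_min_dist:
  assumes "card S = 6"
  shows "packing S \<longleftrightarrow> opt_dist \<le> min_dist S"
proof -
  have fin: "finite S" using assms by (simp add: card_ge_0_finite)
  obtain u v where "u \<in> S" "v \<in> S" "u \<noteq> v"
    using assms card_le_Suc0_iff_eq[OF fin] by fastforce
  then have "{dist u v | u v. u \<in> S \<and> v \<in> S \<and> u \<noteq> v} \<noteq> {}" by blast
  then show ?thesis
    unfolding min_dist_def using Min_ge_iff[OF finite_distances[OF fin]] assms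
    by (auto simp: packing_def)
qed

lemma min_dist_isometric:
  assumes "isometric S T"
  shows "min_dist T = min_dist S"
proof -
  from assms obtain f where f: "isometry f" "T = f ` S" by (auto simp: isometric_def)
  then have d: "dist (f u) (f v) = dist u v" "f u = f v \<longleftrightarrow> u = v" for u v
    by (auto simp: isometry_def bij_def inj_eq)
  have "{dist u v | u v. u \<in> T \<and> v \<in> T \<and> u \<noteq> v} = {dist u v | u v. u \<in> S \<and> v \<in> S \<and> u \<noteq> v}"
  proof (intro equalityI subsetI)
    fix t assume "t \<in> {dist u v | u v. u \<in> S \<and> v \<in> S \<and> u \<noteq> v}"
    then obtain u v where "t = dist (f u) (f v)" "f u \<in> T" "f v \<in> T" "f u \<noteq> f v"
      by (auto simp: d f(2))
    then show "t \<in> {dist u v | u v. u \<in> T \<and> v \<in> T \<and> u \<noteq> v}" by blast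
  qed (auto simp: d f(2), blast)
  then show ?thesis by (simp add: min_dist_def)
qed

text \<open>The contact of the points 0 and 1 gives one bound, the separation of all pairs the
  other.\<close>

lemma min_dist_opt: "min_dist (pts opt_x opt_y) = opt_dist"
proof (rule antisym)
  let ?u = "proj_torus (opt_x 0, opt_y 0)" and ?v = "proj_torus (opt_x 1, opt_y 1)"
  have mem: "?u \<in> pts opt_x opt_y" "?v \<in> pts opt_x opt_y" 
    unfolding pts_def by (rule image_eqI[OF refl], simp)+
  have ge: "opt_dist \<le> dist ?u ?v"
    unfolding dist_proj_ge_iff[OF less_imp_le[OF opt_dist_pos]] using opt_separated[of 0 1] by simp
  have "dist ?u ?v \<le> norm ((opt_x 0, opt_y 0) - (opt_x 1, opt_y 1) + 0)"
    unfolding dist_proj by (rule lattice_dist_le) (simp add: int_lattice_closed(1))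
  also have "\<dots> = sqrt ((opt_x 1 - opt_x 0 + of_int 0)\<^sup>2 + (opt_y 1 - opt_y 0 + of_int 0)\<^sup>2)"
    by (simp add: norm_prod_def power_divide)
  also have "\<dots> = opt_dist"
    using contact_dist[of 0 1 0 0] opt_dist_pos by (simp add: contacts_def)
  finally have "dist ?u ?v \<le> opt_dist" .
  moreover have "?u \<noteq> ?v" using ge opt_dist_pos by auto
  moreover have "finite (pts opt_x opt_y)" by (simp add: pts_def)
  ultimately show "min_dist (pts opt_x opt_y) \<le> opt_dist"
    unfolding min_dist_def using mem by (intro Min.coboundedI[THEN order_trans] finite_distances) blast+
next
  show "opt_dist \<le> min_dist (pts opt_x opt_y)"
    using packing_opt packing_iff_min_dist by (auto simp: packing_def)
qed

theorem theorem1: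
  fixes d R :: real and P :: "torus set"
  assumes d_eq: "d = sqrt 3 / 2 - sqrt 2 * sqrt (3 * sqrt 3 + 2) / 6 + 1 / 6"
    and R_eq: "R = sqrt 2 * sqrt (3 * sqrt 3 + 2)"
    and P_eq: "P = proj_torus `
      {(0, 0),
       (d / 2, sqrt 3 / 2 * d),
       (1 - d / 2, sqrt 3 / 2 * d),
       (1 / 2, 1 + sqrt 3 / 3 - sqrt 3 / 12 * R - 1 / 4 * R),
       ((1 - d) / 2, 5 / 4 + sqrt 3 / 4 - 1 / 4 * R),
       ((1 + d) / 2, 5 / 4 + sqrt 3 / 4 - 1 / 4 * R)}"
  shows "\<bar>d - 0.40040554\<bar> < 1 / 10 ^ 8
    \<and> (\<exists>X :: torus set. card X = 6 \<and> min_dist X = d)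
    \<and> (\<forall>X :: torus set. card X = 6 \<longrightarrow> min_dist X \<le> d)
    \<and> (\<forall>X :: torus set. card X = 6 \<longrightarrow>
         (min_dist X = d \<longleftrightarrow> (\<exists>f :: torus \<Rightarrow> torus. isometry f \<and> X = f ` P)))"
proof -
  have d: "d = opt_dist" by (simp add: d_eq opt_dist_def)
  \<comment> \<open>Solving the definition of d for R turns the stated heights into those of
    \<open>opt_y\<close>.\<close>
  have R: "R = 3 * sqrt 3 + 1 - 6 * d" by (simp add: d_eq R_eq)
  have y: "1 + sqrt 3 / 3 - sqrt 3 / 12 * R - 1 / 4 * R = opt_y 3" "5 / 4 + sqrt 3 / 4 - 1 / 4 * R = opt_y 4"
    unfolding R d by (simp_all add: field_simps)
  have P: "P = pts opt_x opt_y"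
  proof -
    have "{..<6 :: nat} = {0, 1, 2, 3, 4, 5}" by auto
    then show ?thesis unfolding P_eq y pts_def by (simp add: d)
  qed
  \<comment> \<open>The hypothesis is only \<open>d \<le> min_dist X\<close>. The conclusion forces
    equality, which gives maximality, and the isometry gives uniqueness.\<close>
  have uniq: "min_dist X = d \<and> (\<exists>f. isometry f \<and> X = f ` P)" if "card X = 6" "d \<le> min_dist X" for X :: "torus set"
    using packing_unique[of X] min_dist_isometric[of P X] packing_iff_min_dist[OF that(1)] that
    by (simp add: d P min_dist_opt isometric_def)
  have "\<bar>d - 0.40040554\<bar> < 1 / 10 ^ 8" using opt_dist_bounds by (simp add: d abs_less_iff)
  moreover have "card P = 6 \<and> min_dist P = d"
    using packing_opt by (simp add: P d packing_def min_dist_opt)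
  moreover have "min_dist X \<le> d" if "card X = 6" for X :: "torus set"
    using uniq[OF that] by force
  moreover have "min_dist X = d \<longleftrightarrow> (\<exists>f. isometry f \<and> X = f ` P)" if "card X = 6" for X :: "torus set"
    using uniq[OF that] min_dist_isometric[of P X] by (auto simp: isometric_def P d min_dist_opt)
  ultimately show ?thesis by blast
qed

end
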